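(* Let $D>0$ and, for $i=1,\dots,N$, set $$c_i=\Big((p_i-1)^{p_i-1}\,p_i^{-p_i}\Big)^{\frac1{p_i-1}},\qquad \delta_i=\Big(\frac{c_ip_i}{p_i-1}\Big)^{p_i-1},\qquad \alpha=-\sum_{i=1}^N\delta_i .$$ Then the function $$\mathcal{B}(x,t)=D\,t^{\alpha}\exp\bigg(-\sum_{i=1}^Nc_i\Big(\frac{|x_i|^{p_i}}{t}\Big)^{\frac1{p_i-1}}\bigg),\qquad (x,t)\in\mathbb{R}^N\times(0,\infty),$$ is a solution in $\mathbb{R}^N\times(0,\infty)$ of $$\partial_t u-\sum_{i=1}^N\partial_i\big(u^{2-p_i}|\partial_i u|^{p_i-2}\partial_i u\big)=0 .$$
   Context: The numbers $p_1,\dots,p_N$ satisfy $1<p_1\le p_2\le\dots\le p_N<\infty$, and their harmonic mean $p$, $\frac1p=\frac1N\sum_{i=1}^N\frac1{p_i}$, is assumed to satisfy $p<N$. "Solution" means nonnegative local weak solution, as follows. For $\Omega\subseteq\mathbb{R}^N$ open and an open time interval $I$: $W^{1,\mathbf p}(\Omega)=\{u\in W^{1,1}(\Omega): D_iu\in L^{p_i}(\Omega),\ i=1,\dots,N\}$; $L^{\mathbf p}(I;W^{1,\mathbf p}(\Omega))=\{u\in L^1(I;W^{1,1}(\Omega)): D_iu\in L^{p_i}(I;L^{p_i}(\Omega)),\ i=1,\dots,N\}$; $W_0^{1,\mathbf p}(\Omega)=W^{1,1}_0(\Omega)\cap W^{1,\mathbf p}(\Omega)$; $L^{\mathbf p}(I;W^{1,\mathbf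 p}_0(\Omega))=L^1(I;W^{1,1}_0(\Omega))\cap L^{\mathbf p}(I;W^{1,\mathbf p}(\Omega))$. A measurable $u:\Omega\times I\to[0,\infty)$ with $u\in C_{loc}(I;L^{p_N/(p_N-1)}_{loc}(\Omega))$, $u^{1/(p_N-1)}\in L^{\mathbf p}_{loc}(I;W^{1,\mathbf p}_{loc}(\Omega))$ and $D_i(u^{1/(p_i-1)})\in L^{p_i}_{loc}(I;L^{p_i}_{loc}(\Omega))$ for all $i$, is a nonnegative local weak sub(super)-solution in $\Omega\times I$ if for every compact $E\subset\Omega$ and every compact interval $[t_1,t_2]\subset I$ $$\int_E u\varphi\,dx\Big|_{t_1}^{t_2}+\int_{t_1}^{t_2}\!\!\int_E\Big[-u\,\varphi_t+\sum_{i=1}^N A_i\,D_i\varphi\Big]dx\,dt\le(\ge)\,0$$ for all nonnegative $\varphi\in W^{1,p_N}_{loc}(I;L^{p_N}(E))\cap L^{\mathbf p}_{loc}(I;W^{1,\mathbf p}_0(E))$, where $A_i=u^{2-p_i}|D_iu|^{p_i-2}D_iu$, understood as $(p_i-1)^{p_i-1}|D_i(u^{1/(p_i-1)})|^{p_i-2}D_i(u^{1/(p_i-1)})$. A local weak solution is both a sub- and a super-solution. Here $\Omega=\mathbb{R}^N$ and $I=(0,\infty)$. *)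

theory Defs
  imports "HOL-Analysis.Analysis"
begin

text \<open>
  Functions of space and time are curried with time first, so that \<open>u t\<close> is the spatial slice at
  time \<open>t\<close>. Elements of \<open>L\<^sup>q\<close> and Sobolev spaces are represented by functions, not by classes modulo
  null sets; consequently the norms below are seminorms.
\<close>

section \<open>Smooth functions with compact support\<close>

primrec C_k :: "nat \<Rightarrow> ('a::euclidean_space \<Rightarrow> real) \<Rightarrow> bool" where
  "C_k 0 f \<longleftrightarrow> continuous_on UNIV f"
| "C_k (Suc k) f \<longleftrightarrow> (\<forall>x. f differentiable at x) \<and>
     (\<forall>b\<in>Basis. C_k k (\<lambda>x. frechet_derivative f (at x) b))"

definition Cc_infinity :: "'a::euclidean_space set \<Rightarrow> ('a \<Rightarrow> real) set" where
  "Cc_infinity S = {f. (\<forall>k. C_k k f) \<and>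
     compact (closure {x. f x \<noteq> 0}) \<and> closure {x. f x \<noteq> 0} \<subseteq> S}"

section \<open>Lebesgue and Sobolev spaces\<close>

definition Lq :: "(real^'n) set \<Rightarrow> real \<Rightarrow> (real^'n \<Rightarrow> real) set" where
  "Lq S q = {v. set_borel_measurable lebesgue S v \<and>
     set_integrable lebesgue S (\<lambda>x. \<bar>v x\<bar> powr q)}"

definition Lq_norm :: "(real^'n) set \<Rightarrow> real \<Rightarrow> (real^'n \<Rightarrow> real) \<Rightarrow> real" where
  "Lq_norm S q v = (LINT x:S|lebesgue. \<bar>v x\<bar> powr q) powr (1 / q)"

definition weak_deriv ::
    "(real^'n) set \<Rightarrow> 'n \<Rightarrow> (real^'n \<Rightarrow> real) \<Rightarrow> (real^'n \<Rightarrow> real) \<Rightarrow> bool" where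
  "weak_deriv \<Omega> i v g \<longleftrightarrow>
     (\<forall>K. compact K \<and> K \<subseteq> \<Omega> \<longrightarrow> set_integrable lebesgue K v \<and> set_integrable lebesgue K g) \<and>
     (\<forall>\<eta>\<in>Cc_infinity \<Omega>.
        (LINT x:\<Omega>|lebesgue. v x * frechet_derivative \<eta> (at x) (axis i 1)) =
        - (LINT x:\<Omega>|lebesgue. g x * \<eta> x))"

text \<open>For open \<open>\<Omega>\<close> the weak derivative is unique up to null sets; \<open>wD\<close> picks a representative.\<close>

definition wD :: "(real^'n) set \<Rightarrow> 'n \<Rightarrow> (real^'n \<Rightarrow> real) \<Rightarrow> real^'n \<Rightarrow> real" where
  "wD \<Omega> i v = (SOME g. weak_deriv \<Omega> i v g)"

definition W11 :: "(real^'n) set \<Rightarrow> (real^'n \<Rightarrow> real) set" where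
  "W11 \<Omega> = {v. v \<in> Lq \<Omega> 1 \<and> (\<forall>i. (\<exists>g. weak_deriv \<Omega> i v g) \<and> wD \<Omega> i v \<in> Lq \<Omega> 1)}"

definition W11_norm :: "(real^'n) set \<Rightarrow> (real^'n \<Rightarrow> real) \<Rightarrow> real" where
  "W11_norm \<Omega> v = Lq_norm \<Omega> 1 v + (\<Sum>i\<in>UNIV. Lq_norm \<Omega> 1 (wD \<Omega> i v))"

text \<open>
  Elements of \<open>W\<^sub>0\<^sup>1\<^sup>,\<^sup>1(S)\<close> are identified with their extension by zero to the whole space. This makes
  sense for open and for compact \<open>S\<close>; for compact \<open>S\<close> one obtains the space of the interior of \<open>S\<close>.
  In particular elements vanish almost everywhere outside \<open>S\<close>, and their derivatives are
  \<open>wD UNIV i\<close>.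
\<close>

definition W11_0 :: "(real^'n) set \<Rightarrow> (real^'n \<Rightarrow> real) set" where
  "W11_0 S = {v \<in> W11 UNIV. \<exists>\<eta>. (\<forall>k. \<eta> k \<in> Cc_infinity S) \<and>
     (\<lambda>k. W11_norm UNIV (\<lambda>x. v x - \<eta> k x)) \<longlonglongrightarrow> 0}"

section \<open>Bochner spaces over a bounded time set\<close>

text \<open>
  Here \<open>J\<close> is a bounded measurable set of times, \<open>V\<close> a vector space of functions and \<open>nrm\<close> a seminorm
  on \<open>V\<close>.
\<close>

definition simple_into :: "real set \<Rightarrow> ('a \<Rightarrow> real) set \<Rightarrow> (real \<Rightarrow> 'a \<Rightarrow> real) \<Rightarrow> bool" where
  "simple_into J V s \<longleftrightarrow> finite (s ` J) \<and> s ` J \<subseteq> V \<and> (\<forall>v. {t\<in>J. s t = v} \<in> sets lebesgue)"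

definition simple_integral :: "real set \<Rightarrow> (real \<Rightarrow> 'a \<Rightarrow> real) \<Rightarrow> 'a \<Rightarrow> real" where
  "simple_integral J s = (\<lambda>x. \<Sum>v\<in>s ` J. measure lebesgue {t\<in>J. s t = v} * v x)"

definition strongly_measurable ::
    "real set \<Rightarrow> ('a \<Rightarrow> real) set \<Rightarrow> (('a \<Rightarrow> real) \<Rightarrow> real) \<Rightarrow> (real \<Rightarrow> 'a \<Rightarrow> real) \<Rightarrow> bool" where
  "strongly_measurable J V nrm f \<longleftrightarrow>
     (AE t in lebesgue_on J. f t \<in> V) \<and>
     (\<exists>s. (\<forall>k. simple_into J V (s k)) \<and>
        (AE t in lebesgue_on J. (\<lambda>k. nrm (\<lambda>x. f t x - s k t x)) \<longlonglongrightarrow> 0))"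

definition in_bochner_Lq ::
    "real set \<Rightarrow> real \<Rightarrow> ('a \<Rightarrow> real) set \<Rightarrow> (('a \<Rightarrow> real) \<Rightarrow> real) \<Rightarrow> (real \<Rightarrow> 'a \<Rightarrow> real) \<Rightarrow> bool" where
  "in_bochner_Lq J q V nrm f \<longleftrightarrow>
     strongly_measurable J V nrm f \<and> set_integrable lebesgue J (\<lambda>t. (nrm (f t)) powr q)"

definition has_bochner_integral_into ::
    "real set \<Rightarrow> ('a \<Rightarrow> real) set \<Rightarrow> (('a \<Rightarrow> real) \<Rightarrow> real) \<Rightarrow> (real \<Rightarrow> 'a \<Rightarrow> real) \<Rightarrow> ('a \<Rightarrow> real) \<Rightarrow> bool" where
  "has_bochner_integral_into J V nrm f z \<longleftrightarrow>
     strongly_measurable J V nrm f \<and> z \<in> V \<and>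
     (\<exists>s. (\<forall>k. simple_into J V (s k)) \<and>
        (\<lambda>k. \<integral>\<^sup>+ t. ennreal (nrm (\<lambda>x. f t x - s k t x)) \<partial>(lebesgue_on J)) \<longlonglongrightarrow> 0 \<and>
        (\<lambda>k. nrm (\<lambda>x. z x - simple_integral J (s k) x)) \<longlonglongrightarrow> 0)"

definition continuous_into ::
    "real set \<Rightarrow> ('a \<Rightarrow> real) set \<Rightarrow> (('a \<Rightarrow> real) \<Rightarrow> real) \<Rightarrow> (real \<Rightarrow> 'a \<Rightarrow> real) \<Rightarrow> bool" where
  "continuous_into J V nrm f \<longleftrightarrow>
     (\<forall>t\<in>J. f t \<in> V \<and> ((\<lambda>s. nrm (\<lambda>x. f s x - f t x)) \<longlongrightarrow> 0) (at t within J))"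

text \<open>\<open>\<phi> \<in> W\<^sup>1\<^sup>,\<^sup>q\<^bsub>loc\<^esub>(I; V)\<close> with weak time derivative \<open>\<psi>\<close>\<close>

definition W1q_loc_time ::
    "real set \<Rightarrow> real \<Rightarrow> ('a \<Rightarrow> real) set \<Rightarrow> (('a \<Rightarrow> real) \<Rightarrow> real) \<Rightarrow>
     (real \<Rightarrow> 'a \<Rightarrow> real) \<Rightarrow> (real \<Rightarrow> 'a \<Rightarrow> real) \<Rightarrow> bool" where
  "W1q_loc_time I q V nrm \<phi> \<psi> \<longleftrightarrow>
     (\<forall>a b. {a..b} \<subseteq> I \<longrightarrow>
        in_bochner_Lq {a..b} q V nrm \<phi> \<and> in_bochner_Lq {a..b} q V nrm \<psi> \<and>
        (\<forall>\<eta>\<in>Cc_infinity {a<..<b}. \<exists>z.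
           has_bochner_integral_into {a..b} V nrm (\<lambda>t x. deriv \<eta> t * \<phi> t x) z \<and>
           has_bochner_integral_into {a..b} V nrm (\<lambda>t x. \<eta> t * \<psi> t x) (\<lambda>x. - z x)))"

section \<open>Anisotropic parabolic spaces\<close>

definition in_LpW1p ::
    "real set \<Rightarrow> (real^'n) set \<Rightarrow> ('n \<Rightarrow> real) \<Rightarrow> (real \<Rightarrow> real^'n \<Rightarrow> real) \<Rightarrow> bool" where
  "in_LpW1p J \<Omega> p f \<longleftrightarrow>
     in_bochner_Lq J 1 (W11 \<Omega>) (W11_norm \<Omega>) f \<and>
     (\<forall>i. in_bochner_Lq J (p i) (Lq \<Omega> (p i)) (Lq_norm \<Omega> (p i)) (\<lambda>t. wD \<Omega> i (f t)))"

definition in_LpW1p_loc ::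
    "real set \<Rightarrow> (real^'n) set \<Rightarrow> ('n \<Rightarrow> real) \<Rightarrow> (real \<Rightarrow> real^'n \<Rightarrow> real) \<Rightarrow> bool" where
  "in_LpW1p_loc I \<Omega> p f \<longleftrightarrow>
     (\<forall>a b \<Omega>'. {a..b} \<subseteq> I \<and> open \<Omega>' \<and> compact (closure \<Omega>') \<and> closure \<Omega>' \<subseteq> \<Omega> \<longrightarrow>
        in_LpW1p {a..b} \<Omega>' p f)"

definition in_LpW1p_0 ::
    "real set \<Rightarrow> (real^'n) set \<Rightarrow> ('n \<Rightarrow> real) \<Rightarrow> (real \<Rightarrow> real^'n \<Rightarrow> real) \<Rightarrow> bool" where
  "in_LpW1p_0 J S p f \<longleftrightarrow>
     in_bochner_Lq J 1 (W11_0 S) (W11_norm UNIV) f \<and> in_LpW1p J UNIV p f"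

section \<open>Local weak solutions\<close>

definition last_exponent :: "('n::{finite,linorder} \<Rightarrow> real) \<Rightarrow> real" where
  "last_exponent p = p (Max UNIV)"

definition solution_class ::
    "('n::{finite,linorder} \<Rightarrow> real) \<Rightarrow> (real, 'n) vec set \<Rightarrow> real set \<Rightarrow> (real \<Rightarrow> (real, 'n) vec \<Rightarrow> real) \<Rightarrow> bool" where
  "solution_class p \<Omega> I u \<longleftrightarrow>
     (\<forall>t\<in>I. \<forall>x\<in>\<Omega>. 0 \<le> u t x) \<and>
     (\<lambda>(t, x). u t x) \<in> borel_measurable (lebesgue_on (I \<times> \<Omega>)) \<and>
     (let r = last_exponent p / (last_exponent p - 1) in
        \<forall>a b K. {a..b} \<subseteq> I \<and> compact K \<and> K \<subseteq> \<Omega> \<longrightarrow>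
          continuous_into {a..b} (Lq K r) (Lq_norm K r) u) \<and>
     in_LpW1p_loc I \<Omega> p (\<lambda>t x. u t x powr (1 / (last_exponent p - 1))) \<and>
     (\<forall>i. (AE t in lebesgue_on I. \<exists>g. weak_deriv \<Omega> i (\<lambda>x. u t x powr (1 / (p i - 1))) g) \<and>
        (\<forall>a b K. {a..b} \<subseteq> I \<and> compact K \<and> K \<subseteq> \<Omega> \<longrightarrow>
          in_bochner_Lq {a..b} (p i) (Lq K (p i)) (Lq_norm K (p i))
            (\<lambda>t. wD \<Omega> i (\<lambda>x. u t x powr (1 / (p i - 1))))))"

text \<open>\<open>flux p \<Omega> i v\<close> is \<open>v\<^bsup>2-p\<^sub>i\<^esup> \<bar>D\<^sub>i v\<bar>\<^bsup>p\<^sub>i-2\<^esup> D\<^sub>i v\<close>, expressed through the weak derivative of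
  \<open>v\<^bsup>1/(p\<^sub>i-1)\<^esup>\<close>.\<close>

definition flux ::
    "('n::finite \<Rightarrow> real) \<Rightarrow> (real^'n) set \<Rightarrow> 'n \<Rightarrow> (real^'n \<Rightarrow> real) \<Rightarrow> real^'n \<Rightarrow> real" where
  "flux p \<Omega> i v x =
     (let g = wD \<Omega> i (\<lambda>y. v y powr (1 / (p i - 1))) x
      in (p i - 1) powr (p i - 1) * \<bar>g\<bar> powr (p i - 2) * g)"

text \<open>
  \<open>\<psi>\<close> is the weak time derivative of \<open>\<phi>\<close>. Elements of \<open>W\<^sup>1\<^sup>,\<^sup>q\<^bsub>loc\<^esub>(I; L\<^sup>q(E))\<close> have a representative that
  is continuous in time; \<open>\<phi>\<close> is taken to be this representative, since the weak formulation evaluates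
  \<open>\<phi>\<close> at individual times.
\<close>

definition test_function ::
    "('n::{finite,linorder} \<Rightarrow> real) \<Rightarrow> (real, 'n) vec set \<Rightarrow> real set \<Rightarrow>
     (real \<Rightarrow> (real, 'n) vec \<Rightarrow> real) \<Rightarrow> (real \<Rightarrow> (real, 'n) vec \<Rightarrow> real) \<Rightarrow> bool" where
  "test_function p E I \<phi> \<psi> \<longleftrightarrow>
     (let q = last_exponent p in
        W1q_loc_time I q (Lq E q) (Lq_norm E q) \<phi> \<psi> \<and>
        continuous_into I (Lq E q) (Lq_norm E q) \<phi>) \<and>
     (\<forall>a b. {a..b} \<subseteq> I \<longrightarrow> in_LpW1p_0 {a..b} E p \<phi>) \<and>
     (\<forall>t\<in>I. AE x in lebesgue_on E. 0 \<le> \<phi> t x)"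

definition weak_form ::
    "('n::finite \<Rightarrow> real) \<Rightarrow> (real^'n) set \<Rightarrow> (real^'n) set \<Rightarrow> real \<Rightarrow> real \<Rightarrow>
     (real \<Rightarrow> real^'n \<Rightarrow> real) \<Rightarrow> (real \<Rightarrow> real^'n \<Rightarrow> real) \<Rightarrow> (real \<Rightarrow> real^'n \<Rightarrow> real) \<Rightarrow> real" where
  "weak_form p \<Omega> E t1 t2 u \<phi> \<psi> =
     (LINT x:E|lebesgue. u t2 x * \<phi> t2 x) - (LINT x:E|lebesgue. u t1 x * \<phi> t1 x) +
     (LINT t:{t1..t2}|lebesgue. LINT x:E|lebesgue.
        - u t x * \<psi> t x + (\<Sum>i\<in>UNIV. flux p \<Omega> i (u t) x * wD UNIV i (\<phi> t) x))"

definition weak_subsolution ::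
    "('n::{finite,linorder} \<Rightarrow> real) \<Rightarrow> (real, 'n) vec set \<Rightarrow> real set \<Rightarrow> (real \<Rightarrow> (real, 'n) vec \<Rightarrow> real) \<Rightarrow> bool" where
  "weak_subsolution p \<Omega> I u \<longleftrightarrow> solution_class p \<Omega> I u \<and>
     (\<forall>E t1 t2 \<phi> \<psi>. compact E \<and> E \<subseteq> \<Omega> \<and> t1 \<le> t2 \<and> {t1..t2} \<subseteq> I \<and> test_function p E I \<phi> \<psi> \<longrightarrow>
        weak_form p \<Omega> E t1 t2 u \<phi> \<psi> \<le> 0)"

definition weak_supersolution ::
    "('n::{finite,linorder} \<Rightarrow> real) \<Rightarrow> (real, 'n) vec set \<Rightarrow> real set \<Rightarrow> (real \<Rightarrow> (real, 'n) vec \<Rightarrow> real) \<Rightarrow> bool" where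
  "weak_supersolution p \<Omega> I u \<longleftrightarrow> solution_class p \<Omega> I u \<and>
     (\<forall>E t1 t2 \<phi> \<psi>. compact E \<and> E \<subseteq> \<Omega> \<and> t1 \<le> t2 \<and> {t1..t2} \<subseteq> I \<and> test_function p E I \<phi> \<psi> \<longrightarrow>
        weak_form p \<Omega> E t1 t2 u \<phi> \<psi> \<ge> 0)"

definition local_weak_solution ::
    "('n::{finite,linorder} \<Rightarrow> real) \<Rightarrow> (real, 'n) vec set \<Rightarrow> real set \<Rightarrow> (real \<Rightarrow> (real, 'n) vec \<Rightarrow> real) \<Rightarrow> bool" where
  "local_weak_solution p \<Omega> I u \<longleftrightarrow> weak_subsolution p \<Omega> I u \<and> weak_supersolution p \<Omega> I u"

end

theory Submission
  imports Defs
begin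

text \<open>
  Every power of \<open>B\<close> is again of the form \<open>K t\<^sup>a exp (- \<Sum> e\<^sub>i \<bar>x\<^sub>i\<bar>\<^bsup>1+m\<^sub>i\<^esup> t\<^bsup>-m\<^sub>i\<^esup>)\<close> with
  \<open>m\<^sub>i = 1 / (p\<^sub>i - 1)\<close>, hence \<open>C\<^sup>1\<close> for \<open>t > 0\<close>, so the required Sobolev and Bochner regularity holds
  with classical derivatives. The flux linearises: \<open>A\<^sub>i = - \<delta>\<^sub>i x\<^sub>i B / t\<close>, and since
  \<open>\<delta>\<^sub>i = 1 / p\<^sub>i\<close> one computes \<open>\<partial>\<^sub>t B = \<Sum> \<partial>\<^sub>i A\<^sub>i\<close> pointwise. For the weak formulation, elements of
  \<open>W\<^sub>0\<^sup>1\<^sup>,\<^sup>1(E)\<close> are approximated by smooth functions to integrate by parts in space, and the product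
  rule \<open>d/dt \<integral> B \<phi> = \<integral> B \<psi> + \<integral> \<phi> \<partial>\<^sub>t B\<close> is proved from the distributional definition of \<open>\<psi>\<close>.
\<close>

section \<open>Smooth functions\<close>

text \<open>The constants are forced. Up to a numerical factor, \<open>D_i (u powr m i)\<close> with
  \<open>m i = 1 / (p i - 1)\<close> is a product of powers with exponents \<open>m i\<close>, so
  the outer power \<open>p i - 1\<close> turns it into \<open>x $ i * u / t\<close>: on this profile
  the nonlinear flux is a linear drift. Its divergence and the time derivative of \<open>u\<close>
  then have the same \<open>\<bar>x $ i\<bar> powr (1 + m i)\<close> terms exactly when
  \<open>\<delta> i * (1 + m i) = m i\<close>, that is, \<open>\<delta> i = 1 / p i\<close>, which
  is what \<open>c i\<close> achieves. The terms without \<open>x\<close> fix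
  \<open>\<alpha>\<close>. The effort goes into the generality of the test functions.
  \<open>\<phi>\<close> and \<open>\<psi>\<close> are curves in spaces of functions, so each
  identity about them is extracted by pairing with a continuous function of \<open>x\<close>, which
  leaves real functions of time. Moreover \<open>wD\<close> is a choice operator, so a classical
  derivative replaces it only almost everywhere, by uniqueness of weak derivatives. Uniqueness and
  the time increments both need explicit smooth cutoffs, obtained from
  \<open>exp (- 1 / x)\<close>.\<close>

lemma C_k_SucD: "C_k (Suc k) f \<Longrightarrow> C_k k f"
proof (induction k arbitrary: f)
  case 0
  then show ?case
    by (auto intro!: continuous_at_imp_continuous_on differentiable_imp_continuous_within)
qed auto

lemma C_k_const: "C_k k (\<lambda>x. c)"
  by (induction k arbitrary: c) auto

lemma C_k_add:
  "C_k k f \<Longrightarrow> C_k k g \<Longrightarrow> C_k k (\<lambda>x. f x + g x)"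
proof (induction k arbitrary: f g)
  case 0
  then show ?case by (auto intro: continuous_intros)
next
  case (Suc k)
  have "frechet_derivative (\<lambda>x. f x + g x) (at x) b =
      frechet_derivative f (at x) b + frechet_derivative g (at x) b" for x b
  proof -
    have "((\<lambda>x. f x + g x) has_derivative
        (\<lambda>b. frechet_derivative f (at x) b + frechet_derivative g (at x) b)) (at x)"
      using Suc.prems by (intro has_derivative_add) (auto simp: frechet_derivative_works[symmetric])
    then show ?thesis
      using fun_cong[OF frechet_derivative_at, of _ _ _ b] by fastforce
  qed
  then show ?case
    using Suc by (auto intro!: differentiable_add)
qed

text \<open>The Leibniz rule puts an undifferentiated factor of class \<open>Suc k\<close> next to a
  derivative of class \<open>k\<close>; \<open>C_k_SucD\<close> lowers the former so that the
  induction hypothesis applies to each product.\<close>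

lemma C_k_mult:
  "C_k k f \<Longrightarrow> C_k k g \<Longrightarrow> C_k k (\<lambda>x. f x * g x)"
proof (induction k arbitrary: f g)
  case 0
  then show ?case by (auto intro: continuous_intros)
next
  case (Suc k)
  have "frechet_derivative (\<lambda>x. f x * g x) (at x) b =
      f x * frechet_derivative g (at x) b + frechet_derivative f (at x) b * g x" for x b
  proof -
    have "((\<lambda>x. f x * g x) has_derivative
        (\<lambda>b. f x * frechet_derivative g (at x) b + frechet_derivative f (at x) b * g x)) (at x)"
      using Suc.prems by (intro has_derivative_mult) (auto simp: frechet_derivative_works[symmetric])
    then show ?thesis
      using fun_cong[OF frechet_derivative_at, of _ _ _ b] by fastforce
  qed
  moreover have "C_k k (\<lambda>x. f x * frechet_derivative g (at x) b + frechet_derivative f (at x) b * g x)"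
    if "b \<in> Basis" for b
    using Suc.prems Suc.prems[THEN C_k_SucD] that
    by (intro C_k_add Suc.IH) (auto simp only: C_k.simps)
  ultimately show ?case
    using Suc.prems by (auto intro!: differentiable_mult)
qed

lemma C_k_prod:
  "finite A \<Longrightarrow> (\<And>i. i \<in> A \<Longrightarrow> C_k k (f i)) \<Longrightarrow> C_k k (\<lambda>x. \<Prod>i\<in>A. f i x)"
  by (induction A rule: finite_induct) (auto intro: C_k_const C_k_mult)

lemma C_k_Suc_realI:
  fixes f :: "real \<Rightarrow> real"
  assumes "\<And>x. (f has_real_derivative f' x) (at x)" "C_k k f'"
  shows "C_k (Suc k) f"
proof -
  have *: "frechet_derivative f (at x) = (*) (f' x)" for x
    using assms(1)[of x] frechet_derivative_at unfolding has_field_derivative_def by metis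
  show ?thesis
    using assms unfolding C_k.simps *
    by (auto simp: real_differentiable_def field_differentiable_def
        intro: field_differentiable_imp_differentiable)
qed

lemma C_k_Suc_realE:
  fixes f :: "real \<Rightarrow> real"
  assumes "C_k (Suc k) f"
  obtains f' where "\<And>x. (f has_real_derivative f' x) (at x)" "C_k k f'"
proof -
  have d: "(f has_real_derivative deriv f x) (at x)" for x
    using assms by (auto simp: DERIV_deriv_iff_real_differentiable)
  have *: "frechet_derivative f (at x) = (*) (deriv f x)" for x
    using d[of x] frechet_derivative_at unfolding has_field_derivative_def by metis
  show ?thesis
    using that[OF d] assms unfolding C_k.simps * by simp
qed

text \<open>The cutoffs below are built from rescaled steps in single coordinates, so composition
  with affine maps and with coordinate projections replaces a general chain rule.\<close>

lemma C_k_affine: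
  fixes f :: "real \<Rightarrow> real"
  shows "C_k k f \<Longrightarrow> C_k k (\<lambda>x. f (c * x + d))"
proof (induction k arbitrary: f)
  case 0
  then show ?case
    by (auto intro!: continuous_intros continuous_on_compose2[of UNIV f])
next
  case (Suc k)
  obtain f' where f': "\<And>x. (f has_real_derivative f' x) (at x)" "C_k k f'"
    using C_k_Suc_realE[OF Suc.prems] by blast
  show ?case
  proof (rule C_k_Suc_realI)
    show "((\<lambda>x. f (c * x + d)) has_real_derivative f' (c * x + d) * c) (at x)" for x
      by (rule DERIV_chain2[where f = f and g = "\<lambda>x. c * x + d"]) (auto intro!: derivative_eq_intros f')
    show "C_k k (\<lambda>x. f' (c * x + d) * c)"
      using Suc.IH[OF f'(2)] by (intro C_k_mult C_k_const)
  qed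
qed

lemma C_k_vec_nth:
  fixes f :: "real \<Rightarrow> real"
  shows "C_k k f \<Longrightarrow> C_k k (\<lambda>x :: real^'n. f (x $ i))"
proof (induction k arbitrary: f)
  case 0
  then show ?case
    by (auto intro!: continuous_intros continuous_on_compose2[of UNIV f])
next
  case (Suc k)
  obtain f' where f': "\<And>x. (f has_real_derivative f' x) (at x)" "C_k k f'"
    using C_k_Suc_realE[OF Suc.prems] by blast
  have d: "((\<lambda>x::real^'n. f (x $ i)) has_derivative (\<lambda>b. f' (x $ i) * b $ i)) (at x)" for x
    using has_derivative_compose[of "\<lambda>x. x $ i" "\<lambda>b. b $ i" x UNIV f "(*) (f' (x $ i))"]
      f'(1)[of "x $ i"] bounded_linear_imp_has_derivative[OF bounded_linear_vec_nth[of i], of "at x"]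
    by (simp add: has_field_derivative_def)
  have *: "frechet_derivative (\<lambda>x::real^'n. f (x $ i)) (at x) = (\<lambda>b. f' (x $ i) * b $ i)" for x
    using frechet_derivative_at[OF d[of x]] by simp
  show ?case
    using d Suc.IH[OF f'(2)] unfolding C_k.simps *
    by (auto simp: differentiable_def intro: C_k_mult C_k_const)
qed

section \<open>A smooth step function from exp(-1/x)\<close>

text \<open>The negative powers are included so that derivatives stay in the linear span of the
  family; smoothness of all members then follows by one induction.\<close>

definition flat :: "nat \<Rightarrow> real \<Rightarrow> real" where
  "flat n x = (if x > 0 then inverse x ^ n * exp (- inverse x) else 0)"

text \<open>With \<open>y = inverse x\<close> the right-hand limit is that of
  \<open>y ^ n / exp y\<close> at infinity.\<close>

lemma flat_tendsto_0: "(flat n \<longlongrightarrow> 0) (at 0)"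
proof -
  have "((\<lambda>x. inverse x ^ n * exp (- inverse x)) \<longlongrightarrow> (0::real)) (at_right 0)"
    using filterlim_compose[OF tendsto_power_div_exp_0[of n] filterlim_inverse_at_top_right]
    by (simp add: exp_minus field_simps)
  then have "(flat n \<longlongrightarrow> 0) (at_right 0)"
    by (rule Lim_transform_eventually)
      (auto simp: flat_def eventually_at_right_field intro!: exI[of _ 1])
  moreover have "(flat n \<longlongrightarrow> 0) (at_left 0)"
    by (rule Lim_transform_eventually[OF tendsto_const])
      (auto simp: flat_def eventually_at_left_field intro!: exI[of _ "-1"])
  ultimately show ?thesis
    by (simp add: filterlim_split_at)
qed

lemma flat_has_derivative:
  "(flat n has_real_derivative flat (n + 2) x - real n * flat (Suc n) x) (at x)"
proof -
  consider "x > 0" | "x < 0" | "x = 0" by linarith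
  then show ?thesis
  proof cases
    case 1
    have "((\<lambda>x. inverse x ^ n * exp (- inverse x)) has_real_derivative
        flat (n + 2) x - real n * flat (Suc n) x) (at x)"
      using 1 by (auto intro!: derivative_eq_intros simp: flat_def)
         (cases n; simp add: field_simps power2_eq_square)
    then show ?thesis
      by (rule DERIV_cong_ev[THEN iffD1, rotated 3])
        (use 1 in \<open>auto simp: flat_def eventually_nhds intro!: exI[of _ "{0<..}"]\<close>)
  next
    case 2
    have "((\<lambda>x. 0) has_real_derivative flat (n + 2) x - real n * flat (Suc n) x) (at x)"
      using 2 by (auto simp: flat_def)
    then show ?thesis
      by (rule DERIV_cong_ev[THEN iffD1, rotated 3])
        (use 2 in \<open>auto simp: flat_def eventually_nhds intro!: exI[of _ "{..<0}"]\<close>)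
  next
    case 3
    \<comment> \<open>At 0 the difference quotient is the next member of the family, which tends to
      0; the claimed derivative is 0 there by the default value of \<open>flat\<close>.\<close>
    have "(flat n (0 + h) - flat n 0) / h = flat (Suc n) h" if "h \<noteq> 0" for h
      using that by (simp add: flat_def field_simps)
    then have "((\<lambda>h. (flat n (0 + h) - flat n 0) / h) \<longlongrightarrow> 0) (at 0)"
      using flat_tendsto_0[of "Suc n"]
      by (rule_tac Lim_transform_eventually) (auto simp: eventually_at intro!: exI[of _ 1])
    then show ?thesis
      using 3 by (simp add: DERIV_def flat_def)
  qed
qed

lemma C_k_flat: "C_k k (flat n)"
proof (induction k arbitrary: n)
  case 0
  then show ?case
    by (auto intro!: continuous_at_imp_continuous_on DERIV_isCont flat_has_derivative)
next
  case (Suc k)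
  have "C_k k (\<lambda>x. flat (n + 2) x + (- real n) * flat (Suc n) x)"
    by (intro C_k_add C_k_mult C_k_const Suc)
  then show ?case
    by (intro C_k_Suc_realI[OF flat_has_derivative]) simp
qed

text \<open>The step is the normalised primitive of the bump
  \<open>flat 0 x * flat 0 (1 - x)\<close>, which is positive exactly on (0,1). Hence
  \<open>S'\<close> is a nonnegative kernel of mass one, which later serves as an approximate
  identity.\<close>

lemma smooth_step_exists:
  obtains S S' :: "real \<Rightarrow> real"
  where "\<And>k. C_k k S" "\<And>x. (S has_real_derivative S' x) (at x)" "continuous_on UNIV S'"
    "\<And>x. S' x \<ge> 0" "\<And>x. x \<le> 0 \<Longrightarrow> S x = 0" "\<And>x. x \<ge> 1 \<Longrightarrow> S x = 1" "\<And>x. 0 \<le> S x" "\<And>x. S x \<le> 1"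
    "\<And>x. x \<le> 0 \<or> 1 \<le> x \<Longrightarrow> S' x = 0"
proof -
  define b where "b x = flat 0 x * flat 0 (1 - x)" for x
  have b_smooth: "C_k k b" for k
    using C_k_mult[OF C_k_flat[of k 0] C_k_affine[OF C_k_flat[of k 0], of "-1" 1]]
    by (simp add: b_def[abs_def])
  have b_cont: "continuous_on A b" for A
    using b_smooth[of 0] by (auto intro: continuous_on_subset)
  have b_nonneg: "b x \<ge> 0" and b_zero: "x \<le> 0 \<or> 1 \<le> x \<Longrightarrow> b x = 0"
    and b_pos: "0 < x \<Longrightarrow> x < 1 \<Longrightarrow> 0 < b x" for x
    by (auto simp: b_def flat_def)
  \<comment> \<open>Starting at -1 and not at 0 makes the two-sided derivative available at 0. Left
    of 0 the primitive vanishes identically, which settles the remaining points.\<close>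
  define B where "B x = integral {-1..x} b" for x
  have B_deriv: "(B has_real_derivative b x) (at x)" if "x > -1" for x
  proof -
    have "(B has_real_derivative b x) (at x within {-1..x+1})"
      unfolding B_def using that by (intro integral_has_real_derivative b_cont) auto
    then show ?thesis
      using that at_within_Icc_at[of "-1" x "x+1"] by simp
  qed
  have B_0: "B x = 0" if "x \<le> 0" for x
    unfolding B_def using that by (subst integral_cong[of _ b "\<lambda>x. 0"]) (auto simp: b_zero)
  have B_deriv: "(B has_real_derivative b x) (at x)" for x
  proof (cases "x > -1")
    case False
    have "(B has_real_derivative 0) (at x)"
      by (rule DERIV_cong_ev[THEN iffD1, rotated 3, OF DERIV_const[of 0]])
        (use False in \<open>auto simp: eventually_nhds B_0 intro!: exI[of _ "{..<0}"]\<close>)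
    then show ?thesis using False b_zero[of x] by simp
  qed (rule B_deriv)
  have B_mono: "x \<le> y \<Longrightarrow> B x \<le> B y" for x y
    by (rule DERIV_nonneg_imp_nondecreasing) (auto intro: B_deriv b_nonneg)
  have B_1: "B x = B 1" if "x \<ge> 1" for x
  proof (cases "x = 1")
    case False
    then have "1 < x" using that by simp
    then obtain z where "1 < z" "B x - B 1 = (x - 1) * b z"
      using MVT2[OF _ B_deriv] by metis
    then show ?thesis by (simp add: b_zero)
  qed simp
  \<comment> \<open>\<open>b\<close> vanishes at 0 and 1, so strict growth is taken on a closed
    interval inside (0,1); it makes \<open>B 1\<close> a legitimate normalising constant.\<close>
  have "B (1/4) < B (3/4)"
    by (rule DERIV_pos_imp_increasing) (auto intro!: exI[of _ "b _"] B_deriv b_pos)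
  then have pos: "B 1 > 0"
    using B_mono[of 0 "1/4"] B_mono[of "3/4" 1] B_0[of 0] by simp
  have B_smooth: "C_k k B" for k
    by (cases k) (auto intro!: C_k_Suc_realI B_deriv b_smooth continuous_at_imp_continuous_on DERIV_isCont
        simp del: C_k.simps(2))
  show ?thesis
  proof (rule that[of "\<lambda>x. inverse (B 1) * B x" "\<lambda>x. inverse (B 1) * b x"])
    show "((\<lambda>x. inverse (B 1) * B x) has_real_derivative inverse (B 1) * b x) (at x)" for x
      by (rule DERIV_cmult[OF B_deriv])
    show "inverse (B 1) * B x \<le> 1" for x
      using B_mono[of x "max x 1"] B_1[of "max x 1"] pos by (simp add: field_simps)
    show "0 \<le> inverse (B 1) * B x" for x
      using B_mono[of "min x 0" x] B_0[of "min x 0"] pos by (simp add: field_simps)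
    show "inverse (B 1) * B x = 1" if "x \<ge> 1" for x
      using B_1[OF that] pos by simp
  qed (use pos in \<open>auto intro!: C_k_mult C_k_const B_smooth continuous_intros b_cont simp: B_0 b_nonneg b_zero\<close>)
qed

section \<open>Weak derivatives\<close>

lemma compact_set_integrable_lebesgue:
  fixes f :: "'a::euclidean_space \<Rightarrow> real"
  assumes "compact K" "continuous_on K f"
  shows "set_integrable lebesgue K f"
proof -
  have i: "integrable lborel (\<lambda>x. indicator K x *\<^sub>R f x)"
    using borel_integrable_compact[OF assms] by (simp add: mult.commute indicator_def if_distrib cong: if_cong)
  show ?thesis
    unfolding set_integrable_def using borel_measurable_integrable[OF i] i
    by (subst integrable_completion) auto
qed

lemma integrable_compact_support:
  fixes f :: "'a::euclidean_space \<Rightarrow> real"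
  assumes "continuous_on UNIV f" "compact K" "\<And>x. x \<notin> K \<Longrightarrow> f x = 0"
  shows "integrable lborel f"
proof -
  have "(\<lambda>x. indicator K x *\<^sub>R f x) = f"
    using assms(3) by (fastforce simp: indicator_def)
  then show ?thesis
    using borel_integrable_compact[OF assms(2) continuous_on_subset[OF assms(1)]] by (metis subset_UNIV)
qed

section \<open>Integration by parts for classical derivatives\<close>

lemma partial_derivative_eq_0:
  fixes F :: "real^'n \<Rightarrow> real"
  assumes "((\<lambda>h. F (x + h *\<^sub>R e)) has_real_derivative d) (at 0)"
    and "closed K" "\<And>x. x \<notin> K \<Longrightarrow> F x = 0" "x \<notin> K"
  shows "d = 0"
proof -
  have "continuous (at 0) (\<lambda>h. x + h *\<^sub>R e)"
    by (intro continuous_intros)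
  then have "((\<lambda>h. x + h *\<^sub>R e) \<longlongrightarrow> x) (nhds 0)"
    unfolding isCont_def by (simp add: tendsto_nhds_iff)
  moreover have "\<forall>\<^sub>F y in nhds x. y \<in> - K"
    using assms by (intro eventually_nhds_in_open) auto
  ultimately have "\<forall>\<^sub>F h in nhds 0. x + h *\<^sub>R e \<in> - K"
    by (rule eventually_compose_filterlim[rotated])
  then have "\<forall>\<^sub>F h in nhds 0. F (x + h *\<^sub>R e) = 0"
    by eventually_elim (simp add: assms)
  then have "((\<lambda>h. F (x + h *\<^sub>R e)) has_real_derivative 0) (at 0)"
    using DERIV_cong_ev[OF refl, of _ "\<lambda>h. 0" 0 0 0] by auto
  then show ?thesis
    using assms(1) DERIV_unique by blast
qed

lemma integral_translate:
  fixes F :: "real^'n \<Rightarrow> real"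
  assumes "F \<in> borel_measurable borel"
  shows "(LINT x|lborel. F (x + c)) = (LINT x|lborel. F x)"
proof -
  have "(LINT x|lborel. F x) = (LINT x|distr lborel borel ((+) c). F x)"
    by (simp add: lborel_distr_plus)
  also have "\<dots> = (LINT x|lborel. F (c + x))"
    using assms by (subst integral_distr) auto
  finally show ?thesis by (simp add: add.commute)
qed

text \<open>The integral of \<open>F (x + h e)\<close> does not depend on \<open>h\<close>; differentiate it at \<open>h = 0\<close>.\<close>

lemma integral_partial_derivative:
  fixes F :: "real^'n \<Rightarrow> real"
  assumes F: "continuous_on UNIV F" and G: "continuous_on UNIV G"
    and deriv: "\<And>x. ((\<lambda>h. F (x + h *\<^sub>R e)) has_real_derivative G x) (at 0)"
    and K: "compact K" "\<And>x. x \<notin> K \<Longrightarrow> F x = 0"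
  shows "integrable lborel G" "(LINT x|lborel. G x) = 0"
proof -
  have Gz: "G x = 0" if "x \<notin> K" for x
    using partial_derivative_eq_0[OF deriv compact_imp_closed[OF K(1)] K(2) that] by blast
  obtain M where M: "M > 0" "\<And>x. \<bar>G x\<bar> \<le> M"
  proof -
    have "bounded (G ` K)"
      using K G by (intro compact_imp_bounded compact_continuous_image) (auto intro: continuous_on_subset)
    then obtain M where "M > 0" "\<And>x. x \<in> K \<Longrightarrow> \<bar>G x\<bar> \<le> M"
      unfolding bounded_pos by auto
    then show ?thesis using that[of M] Gz by (metis abs_zero less_eq_real_def)
  qed
  \<comment> \<open>For \<open>0 < h \<le> 1\<close> all translates of the support by
    \<open>- h *\<^sub>R e\<close> lie in \<open>K'\<close>, so \<open>M * indicator K'\<close>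
    dominates every difference quotient at once.\<close>
  define K' where "K' = {x + y | x y. x \<in> K \<and> y \<in> cball 0 (norm e)}"
  have K': "compact K'"
    unfolding K'_def using K by (intro compact_sums) auto
  define h where "h n = inverse (real (Suc n))" for n
  have h: "0 < h n" "h n \<le> 1" for n by (auto simp: h_def field_simps)
  define D where "D n x = (F (x + h n *\<^sub>R e) - F x) / h n" for n x
  have deriv': "((\<lambda>t. F (x + t *\<^sub>R e)) has_real_derivative G (x + s *\<^sub>R e)) (at s)" for x s
    using DERIV_shift[of "\<lambda>t. F (x + t *\<^sub>R e)" "G (x + s *\<^sub>R e)" 0 s] deriv[of "x + s *\<^sub>R e"]
    by (simp add: algebra_simps)
  have D_bound: "\<bar>D n x\<bar> \<le> M * indicator K' x" for n x
  proof (cases "x \<in> K'")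
    case True
    obtain z where "F (x + h n *\<^sub>R e) - F (x + 0 *\<^sub>R e) = (h n - 0) * G (x + z *\<^sub>R e)"
      using MVT2[OF h(1) deriv'] by blast
    then show ?thesis using h(1)[of n] M True by (simp add: D_def)
  next
    case False
    have "x \<notin> K"
      using False unfolding K'_def by (force intro: exI[of _ 0])
    moreover have "x + h n *\<^sub>R e \<notin> K"
    proof
      assume "x + h n *\<^sub>R e \<in> K"
      moreover have "- h n *\<^sub>R e \<in> cball 0 (norm e)"
        using h[of n] by (simp add: mult_left_le_one_le)
      ultimately have "(x + h n *\<^sub>R e) + (- h n *\<^sub>R e) \<in> K'"
        unfolding K'_def by blast
      then show False using False by simp
    qed
    ultimately show ?thesis using False K by (simp add: D_def)
  qed
  have meas [measurable]: "F \<in> borel_measurable borel" "G \<in> borel_measurable borel"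
    using F G by (auto intro: borel_measurable_continuous_onI)
  have meas_K' [measurable]: "K' \<in> sets borel" using K' by (simp add: borel_compact)
  have dom: "integrable lborel (\<lambda>x. M * indicator K' x)"
    using emeasure_compact_finite[OF K'] by (auto intro!: integrable_real_indicator)
  have lim: "(\<lambda>n. D n x) \<longlonglongrightarrow> G x" for x
  proof -
    have "((\<lambda>t. (F (x + t *\<^sub>R e) - F x) / t) \<longlongrightarrow> G x) (at 0)"
      using deriv[of x] by (simp add: DERIV_def)
    moreover have "filterlim h (at 0) sequentially"
      unfolding filterlim_at h_def using LIMSEQ_inverse_real_of_nat by (auto simp: )
    ultimately show ?thesis
      unfolding D_def by (rule filterlim_compose)
  qed
  have Dm: "D n \<in> borel_measurable lborel" for n unfolding D_def by measurable
  have conv: "(\<lambda>n. LINT x|lborel. D n x) \<longlonglongrightarrow> (LINT x|lborel. G x)"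
    by (rule integral_dominated_convergence[OF _ Dm dom]) (use lim D_bound in auto)
  show "integrable lborel G"
    by (rule integrable_compact_support[OF G K(1) Gz])
  have "(LINT x|lborel. D n x) = 0" for n
  proof -
    have i: "integrable lborel F"
      using integrable_compact_support[OF F K] .
    have "integrable lborel (\<lambda>x. F (x + h n *\<^sub>R e))"
      using i integrable_distr[of "(+) (h n *\<^sub>R e)" lborel borel F]
      by (simp add: lborel_distr_plus add.commute)
    then show ?thesis
      unfolding D_def using i integral_translate[OF meas(1)] by simp
  qed
  then have "(\<lambda>n. 0) \<longlonglongrightarrow> (LINT x|lborel. G x)"
    using conv by simp
  then show "(LINT x|lborel. G x) = 0"
    using LIMSEQ_unique[OF _ tendsto_const] by blast
qed

lemma Cc_infinityD:
  fixes \<eta> :: "real^'n \<Rightarrow> real"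
  assumes "\<eta> \<in> Cc_infinity S"
  shows "continuous_on UNIV \<eta>"
    and "continuous_on UNIV (\<lambda>x. frechet_derivative \<eta> (at x) (axis i 1))"
    and "((\<lambda>h. \<eta> (x + h *\<^sub>R axis i 1)) has_real_derivative
           frechet_derivative \<eta> (at x) (axis i 1)) (at 0)"
    and "x \<notin> S \<Longrightarrow> \<eta> x = 0"
    and "x \<notin> S \<Longrightarrow> frechet_derivative \<eta> (at x) (axis i 1) = 0"
proof -
  have C: "C_k 0 \<eta>" "C_k (Suc 0) \<eta>" and cl: "closure {x. \<eta> x \<noteq> 0} \<subseteq> S"
    using assms by (auto simp: Cc_infinity_def simp del: C_k.simps)
  show "continuous_on UNIV \<eta>" using C by simp
  show "continuous_on UNIV (\<lambda>x. frechet_derivative \<eta> (at x) (axis i 1))"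
    using C(2) by (auto simp: axis_in_Basis_iff)
  have "(\<eta> has_derivative frechet_derivative \<eta> (at x)) (at x)" for x
    using C(2) by (auto simp: frechet_derivative_works[symmetric])
  moreover have "((\<lambda>h. x + h *\<^sub>R axis i 1) has_derivative (\<lambda>h. h *\<^sub>R axis i 1)) (at 0)" for x :: "real^'n"
    by (auto intro!: derivative_eq_intros)
  ultimately have hd: "((\<lambda>h. \<eta> (x + h *\<^sub>R axis i 1)) has_derivative
      (\<lambda>h. frechet_derivative \<eta> (at x) (h *\<^sub>R axis i 1))) (at 0)" for x
    using has_derivative_compose[of "\<lambda>h. x + h *\<^sub>R axis i 1" "\<lambda>h. h *\<^sub>R axis i 1" 0 UNIV \<eta>
        "frechet_derivative \<eta> (at x)"]
    by simp
  show d: "((\<lambda>h. \<eta> (x + h *\<^sub>R axis i 1)) has_real_derivative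
      frechet_derivative \<eta> (at x) (axis i 1)) (at 0)" for x
  proof -
    have "linear (frechet_derivative \<eta> (at x))"
      using C(2) by (auto intro: linear_frechet_derivative)
    then have "(\<lambda>h. frechet_derivative \<eta> (at x) (h *\<^sub>R axis i 1)) =
        (*) (frechet_derivative \<eta> (at x) (axis i 1))"
      by (simp add: linear_cmul fun_eq_iff)
    then show ?thesis
      using hd[of x]
      unfolding has_field_derivative_def by simp
  qed
  show "\<eta> x = 0" if "x \<notin> S"
    using cl closure_subset[of "{x. \<eta> x \<noteq> 0}"] that by blast
  show "frechet_derivative \<eta> (at x) (axis i 1) = 0" if "x \<notin> S"
  proof (rule partial_derivative_eq_0[OF d])
    show "\<eta> y = 0" if "y \<notin> closure {x. \<eta> x \<noteq> 0}" for y
      using that closure_subset[of "{x. \<eta> x \<noteq> 0}"] by blast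
  qed (use that cl in auto)
qed

lemma Cc_infinity_mono: "\<eta> \<in> Cc_infinity S \<Longrightarrow> S \<subseteq> T \<Longrightarrow> \<eta> \<in> Cc_infinity T"
  unfolding Cc_infinity_def by auto

lemma Cc_infinity_support:
  "\<eta> \<in> Cc_infinity S \<Longrightarrow> \<exists>K. compact K \<and> K \<subseteq> S \<and> \<eta> \<in> Cc_infinity K"
  unfolding Cc_infinity_def by blast

text \<open>The product \<open>v * \<eta>\<close> has compact support, so its partial derivative has
  integral zero. As \<open>\<eta>\<close> and its derivative vanish off \<open>\<Omega>\<close>,
  both sides are integrals over the whole space; \<open>\<Omega>\<close> is later an open set as
  well as the compact set \<open>E\<close>.\<close>

lemma integration_by_parts_Cc:
  fixes v g :: "real^'n \<Rightarrow> real"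
  assumes v: "continuous_on UNIV v" and g: "continuous_on UNIV g"
    and deriv: "\<And>x. ((\<lambda>h. v (x + h *\<^sub>R axis i 1)) has_real_derivative g x) (at 0)"
    and \<eta>: "\<eta> \<in> Cc_infinity \<Omega>"
  shows "(LINT x:\<Omega>|lebesgue. v x * frechet_derivative \<eta> (at x) (axis i 1)) =
        - (LINT x:\<Omega>|lebesgue. g x * \<eta> x)"
proof -
  obtain K where K: "compact K" "\<eta> \<in> Cc_infinity K"
    using Cc_infinity_support[OF \<eta>] by blast
  define \<eta>' where "\<eta>' x = frechet_derivative \<eta> (at x) (axis i 1)" for x
  note c = Cc_infinityD(1)[OF \<eta>] Cc_infinityD(2)[OF \<eta>, of i, folded \<eta>'_def]
  note z = Cc_infinityD(4)[OF \<eta>] Cc_infinityD(5)[OF \<eta>, of _ i, folded \<eta>'_def]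
  note zK = Cc_infinityD(4)[OF K(2)] Cc_infinityD(5)[OF K(2), of _ i, folded \<eta>'_def]
  have cm: "continuous_on UNIV (\<lambda>x. v x * \<eta>' x)" "continuous_on UNIV (\<lambda>x. g x * \<eta> x)"
    using v g c by (auto intro!: continuous_intros)
  have "((\<lambda>h. v (x + h *\<^sub>R axis i 1) * \<eta> (x + h *\<^sub>R axis i 1)) has_real_derivative
      g x * \<eta> x + v x * \<eta>' x) (at 0)" for x
    using DERIV_mult[OF deriv[of x] Cc_infinityD(3)[OF \<eta>, of x i, folded \<eta>'_def]]
    by (simp add: mult.commute)
  note * = integral_partial_derivative(2)[OF _ _ this K(1)]
  have 0: "(LINT x|lborel. g x * \<eta> x + v x * \<eta>' x) = 0"
    by (rule *) (use v g c cm zK in \<open>auto intro!: continuous_intros\<close>)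
  have i: "integrable lborel f" if "continuous_on UNIV f" "\<And>x. x \<notin> K \<Longrightarrow> f x = 0" for f :: "real^'n \<Rightarrow> real"
    using integrable_compact_support[OF that(1) K(1) that(2)] .
  have "(LINT x|lborel. g x * \<eta> x) + (LINT x|lborel. v x * \<eta>' x) = 0"
    using 0 i[OF cm(1)] i[OF cm(2)] zK by simp
  moreover have "(LINT x:\<Omega>|lebesgue. v x * \<eta>' x) = (LINT x|lborel. v x * \<eta>' x)"
    using cm z unfolding set_lebesgue_integral_def
    by (subst integral_completion[symmetric])
      (auto intro!: borel_measurable_continuous_onI Bochner_Integration.integral_cong simp: indicator_def)
  moreover have "(LINT x:\<Omega>|lebesgue. g x * \<eta> x) = (LINT x|lborel. g x * \<eta> x)"
    using cm z unfolding set_lebesgue_integral_def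
    by (subst integral_completion[symmetric])
      (auto intro!: borel_measurable_continuous_onI Bochner_Integration.integral_cong simp: indicator_def)
  ultimately show ?thesis unfolding \<eta>'_def by simp
qed

lemma weak_deriv_C1:
  fixes v g :: "real^'n \<Rightarrow> real"
  assumes "continuous_on UNIV v" "continuous_on UNIV g"
    and "\<And>x. ((\<lambda>h. v (x + h *\<^sub>R axis i 1)) has_real_derivative g x) (at 0)"
  shows "weak_deriv \<Omega> i v g"
  unfolding weak_deriv_def
  using assms by (auto intro!: compact_set_integrable_lebesgue integration_by_parts_Cc intro: continuous_on_subset)

section \<open>The fundamental lemma of the calculus of variations\<close>

text \<open>One rescaled step per face of the box, multiplied together. Inside the open box all
  factors are eventually 1; off it some factor is 0 for every \<open>n\<close>.\<close>

lemma box_indicator_approx: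
  fixes a b :: "real^'n"
  obtains \<eta> where "\<And>n::nat. \<eta> n \<in> Cc_infinity (cbox a b)" "\<And>n x. \<bar>\<eta> n x\<bar> \<le> 1"
    "\<And>x. (\<lambda>n. \<eta> n x) \<longlonglongrightarrow> indicator (box a b) x"
proof -
  obtain S S' :: "real \<Rightarrow> real" where S: "\<And>k. C_k k S" "\<And>x. x \<le> 0 \<Longrightarrow> S x = 0"
      "\<And>x. x \<ge> 1 \<Longrightarrow> S x = 1" "\<And>x. 0 \<le> S x" "\<And>x. S x \<le> 1"
    using smooth_step_exists by metis
  define \<eta> where "\<eta> n x = (\<Prod>i\<in>UNIV. S (real n * (x $ i) + (- real n * a $ i)) *
      S ((- real n) * (x $ i) + real n * b $ i))" for n and x :: "real^'n"
  have zero: "\<eta> n x = 0" if x: "x \<notin> box a b" for n x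
  proof -
    obtain i where "x $ i \<le> a $ i \<or> b $ i \<le> x $ i"
      using x by (auto simp: mem_box_cart not_less)
    then have "real n * (x $ i) + (- real n * a $ i) \<le> 0 \<or> (- real n) * (x $ i) + real n * b $ i \<le> 0"
      by (auto simp: mult_left_mono)
    then show ?thesis
      unfolding \<eta>_def by (intro prod_zero) (auto intro!: bexI[of _ i] S)
  qed
  have supp: "closure {x. \<eta> n x \<noteq> 0} \<subseteq> cbox a b" for n
    using zero box_subset_cbox by (intro closure_minimal closed_cbox) blast
  show ?thesis
  proof
    have "C_k k (\<eta> n)" for k n
      unfolding \<eta>_def
      by (intro C_k_prod C_k_mult C_k_vec_nth C_k_affine S) auto
    moreover have "compact (closure {x. \<eta> n x \<noteq> 0})" for n
      using supp by (meson bounded_cbox bounded_subset closed_closure compact_eq_bounded_closed)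
    ultimately show "\<eta> n \<in> Cc_infinity (cbox a b)" for n
      unfolding Cc_infinity_def using supp by blast
    show "\<bar>\<eta> n x\<bar> \<le> 1" for n x
      unfolding \<eta>_def abs_prod
      by (intro prod_le_1) (auto simp: abs_mult S intro!: mult_le_one)
    show "(\<lambda>n. \<eta> n x) \<longlonglongrightarrow> indicator (box a b) x" for x
    proof (cases "x \<in> box a b")
      case True
      have "\<forall>\<^sub>F n in sequentially. 1 \<le> real n * c" if "c > 0" for c
      proof -
        obtain N where "1 / c \<le> real N"
          using real_arch_simple by blast
        then have "1 \<le> real n * c" if "n \<ge> N" for n
          using that \<open>c > 0\<close> order_trans[of "1 / c" "real N" "real n"] by (simp add: field_simps)
        then show ?thesis
          by (auto simp: eventually_sequentially)
      qed
      then have "\<forall>\<^sub>F n in sequentially. \<forall>i. 1 \<le> real n * (x $ i - a $ i) \<and> 1 \<le> real n * (b $ i - x $ i)"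
        using True by (auto simp: mem_box_cart eventually_all_finite eventually_conj_iff)
      then have "\<forall>\<^sub>F n in sequentially. \<eta> n x = 1"
        by eventually_elim (auto simp: \<eta>_def S(3) algebra_simps)
      then show ?thesis
        using True by (simp add: tendsto_eventually)
    qed (simp add: zero)
  qed
qed

text \<open>Open boxes form an intersection-stable generator of the Borel sets. Vanishing integrals
  therefore extend to all Borel sets by Dynkin induction, and a density is determined by its
  integrals.\<close>

lemma AE_zero_if_box_integrals_zero:
  fixes g :: "'a::euclidean_space \<Rightarrow> real"
  assumes int: "set_integrable lebesgue (cbox a b) g"
    and zero: "\<And>c d. cbox c d \<subseteq> cbox a b \<Longrightarrow> (LINT x:box c d|lebesgue. g x) = 0"
  shows "AE x in lebesgue. x \<in> cbox a b \<longrightarrow> g x = 0"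
proof -
  define f0 where "f0 x = indicator (box a b) x * g x" for x
  have f0: "integrable lebesgue f0"
    using set_integrable_subset[OF int, of "box a b"] box_subset_cbox
    by (auto simp: f0_def[abs_def] set_integrable_def)
  \<comment> \<open>\<open>g\<close> is only Lebesgue measurable, whereas the generator argument
    lives on Borel sets; hence the passage to a Borel representative.\<close>
  obtain f where f [measurable]: "f \<in> borel_measurable lborel" and ae: "AE x in lborel. f0 x = f x"
    using completion_ex_borel_measurable_real[OF borel_measurable_integrable[OF f0]] by blast
  have ae': "AE x in lebesgue. f0 x = f x"
    using ae by (rule AE_completion)
  have f_leb: "f \<in> borel_measurable lebesgue"
    using f by (rule measurable_completion)
  have "integrable lebesgue f"
    using integrable_cong_AE[THEN iffD1, OF borel_measurable_integrable[OF f0] f_leb ae' f0] .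
  then have fi: "integrable lborel f"
    by (simp add: integrable_completion)
  have si: "set_integrable lborel A f" if "A \<in> sets borel" for A
    using fi that unfolding set_integrable_def by (intro integrable_mult_indicator) auto
  have box: "(LINT x:box l u|lborel. f x) = 0" for l u
  proof -
    have [measurable]: "box l u \<in> sets borel" by simp
    have "(LINT x:box l u|lborel. f x) = (LINT x:box l u|lebesgue. f x)"
      unfolding set_lebesgue_integral_def by (subst integral_completion) auto
    also have "\<dots> = (LINT x:box l u|lebesgue. f0 x)"
      unfolding set_lebesgue_integral_def
      using ae' f_leb borel_measurable_integrable[OF f0]
      by (intro integral_cong_AE borel_measurable_scaleR borel_measurable_indicator) auto
    also have "\<dots> = (LINT x:box l u \<inter> box a b|lebesgue. g x)"
      unfolding set_lebesgue_integral_def f0_def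
      by (intro Bochner_Integration.integral_cong) (auto simp: indicator_def)
    also have "\<dots> = 0"
    proof -
      obtain c d where cd: "box l u \<inter> box a b = box c d"
        using box_Int_box[of l u a b] by blast
      show ?thesis
      proof (cases "box c d = {}")
        case False
        then have "cbox c d = closure (box c d)"
          by (simp add: closure_box)
        also have "\<dots> \<subseteq> cbox a b"
          using cd box_subset_cbox by (intro closure_minimal closed_cbox) blast
        finally show ?thesis using zero cd by simp
      qed (simp add: cd set_lebesgue_integral_def)
    qed
    finally show ?thesis .
  qed
  have UNIV: "(LINT x|lborel. f x) = 0"
  proof -
    have "(LINT x|lborel. f x) = (LINT x|lebesgue. f x)"
      by (simp add: integral_completion)
    also have "\<dots> = (LINT x|lebesgue. f0 x)"
      using ae' f_leb borel_measurable_integrable[OF f0] by (intro integral_cong_AE) auto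
    also have "\<dots> = (LINT x:box a b|lebesgue. g x)"
      by (simp add: f0_def set_lebesgue_integral_def)
    also have "\<dots> = 0"
      using zero by simp
    finally show ?thesis .
  qed
  have all: "(LINT x:A|lborel. f x) = 0" if "A \<in> sets borel" for A
  proof -
    let ?E = "range (\<lambda>(a, b). box a b) :: 'a set set"
    have sub: "sigma_sets UNIV ?E = sets borel"
      by (simp add: borel_eq_box)
    have "Int_stable ?E" "?E \<subseteq> Pow UNIV" "A \<in> sigma_sets UNIV ?E"
      using that by (auto simp: Int_stable_def box_Int_box sub)
    then show ?thesis
    proof (induct rule: sigma_sets_induct_disjoint)
      case (basic A)
      then show ?case using box by auto
    next
      case empty
      then show ?case by (simp add: set_lebesgue_integral_def)
    next
      case (compl A)
      then have A: "A \<in> sets borel" "- A \<in> sets borel" by (auto simp: sub)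
      have "(LINT x|lborel. f x) = (LINT x:A \<union> - A|lborel. f x)"
        by (simp add: set_lebesgue_integral_def)
      also have "\<dots> = (LINT x:A|lborel. f x) + (LINT x:-A|lborel. f x)"
        using A si by (intro set_integral_Un) auto
      finally show ?case
        using UNIV compl by (simp add: Compl_eq_Diff_UNIV)
    next
      case (union A)
      have A: "A i \<in> sets borel" for i using union(2) by (auto simp: sub)
      have "(LINT x:(\<Union>i. A i)|lborel. f x) = (\<Sum>i. LINT x:A i|lborel. f x)"
        by (rule lebesgue_integral_countable_add)
          (use A si union(1) in \<open>auto simp: disjoint_family_on_def\<close>)
      then show ?case using union by simp
    qed
  qed
  have "AE x in lborel. f x = 0"
    by (rule density_unique_real) (use fi all in auto)
  then have "AE x in lebesgue. f x = 0"
    by (rule AE_completion)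
  \<comment> \<open>\<open>f0\<close> was cut off to the open box and carries no information on the
    boundary, which is a null set.\<close>
  moreover have "AE x in lebesgue. x \<notin> cbox a b - box a b"
    using null_sets_cbox_Diff_box[of a b] by (intro AE_completion AE_not_in)
  ultimately show ?thesis
    using ae' by eventually_elim (auto simp: f0_def)
qed

lemma set_integrable_mult_continuous:
  fixes f w :: "'a::euclidean_space \<Rightarrow> real"
  assumes f: "set_integrable lebesgue K f" and K: "compact K" and w: "continuous_on K w"
  shows "set_integrable lebesgue K (\<lambda>x. f x * w x)"
proof -
  have "bounded (w ` K)"
    using w K by (intro compact_imp_bounded compact_continuous_image)
  then obtain B where B: "\<And>x. x \<in> K \<Longrightarrow> \<bar>w x\<bar> \<le> B"
    unfolding bounded_iff by auto
  note wm = borel_measurable_integrable[OF compact_set_integrable_lebesgue[OF K w, unfolded set_integrable_def]]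
  note fm = borel_measurable_integrable[OF f[unfolded set_integrable_def]]
  have "integrable lebesgue (\<lambda>x. (indicator K x *\<^sub>R f x) * (indicator K x *\<^sub>R w x))"
  proof (rule Bochner_Integration.integrable_bound)
    show "integrable lebesgue (\<lambda>x. B * (indicator K x *\<^sub>R f x))"
      using f unfolding set_integrable_def by simp
    show "AE x in lebesgue. norm ((indicator K x *\<^sub>R f x) * (indicator K x *\<^sub>R w x)) \<le>
        norm (B * (indicator K x *\<^sub>R f x))"
    proof (intro AE_I2)
      fix x
      show "norm ((indicator K x *\<^sub>R f x) * (indicator K x *\<^sub>R w x)) \<le>
        norm (B * (indicator K x *\<^sub>R f x))"
      proof (cases "x \<in> K")
        case True
        then have "\<bar>w x\<bar> \<le> \<bar>B\<bar>" using B[of x] by simp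
        then show ?thesis
          using True mult_left_mono[of "\<bar>w x\<bar>" "\<bar>B\<bar>" "\<bar>f x\<bar>"] by (simp add: abs_mult mult.commute)
      qed simp
    qed
  qed (intro borel_measurable_times fm wm)
  moreover have "(\<lambda>x. (indicator K x *\<^sub>R f x) * (indicator K x *\<^sub>R w x)) =
      (\<lambda>x. indicator K x *\<^sub>R (f x * w x))"
    by (auto simp: indicator_def fun_eq_iff)
  ultimately show ?thesis
    unfolding set_integrable_def by simp
qed

lemma set_integrable_mult_Cc:
  fixes f \<eta> :: "real^'n \<Rightarrow> real"
  assumes "\<And>K. compact K \<Longrightarrow> K \<subseteq> \<Omega> \<Longrightarrow> set_integrable lebesgue K f" "\<eta> \<in> Cc_infinity \<Omega>"
  shows "set_integrable lebesgue \<Omega> (\<lambda>x. f x * \<eta> x)"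
proof -
  obtain K where K: "compact K" "K \<subseteq> \<Omega>" "\<eta> \<in> Cc_infinity K"
    using Cc_infinity_support[OF assms(2)] by blast
  have "set_integrable lebesgue K (\<lambda>x. f x * \<eta> x)"
    using Cc_infinityD(1)[OF assms(2)] assms(1) K
    by (intro set_integrable_mult_continuous) (auto intro: continuous_on_subset)
  moreover have "(\<lambda>x. indicator \<Omega> x *\<^sub>R (f x * \<eta> x)) = (\<lambda>x. indicator K x *\<^sub>R (f x * \<eta> x))"
    using K Cc_infinityD(4)[OF K(3)] by (force simp: fun_eq_iff indicator_def)
  ultimately show ?thesis unfolding set_integrable_def by simp
qed

text \<open>Testing with approximations of a box indicator and passing to the limit by dominated
  convergence gives zero integrals over boxes. Countably many closed boxes cover
  \<open>\<Omega>\<close>, so the exceptional null sets can be united.\<close>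

lemma fundamental_lemma_calculus_of_variations:
  fixes g :: "real^'n \<Rightarrow> real"
  assumes \<Omega>: "open \<Omega>"
    and int: "\<And>K. compact K \<Longrightarrow> K \<subseteq> \<Omega> \<Longrightarrow> set_integrable lebesgue K g"
    and zero: "\<And>\<eta>. \<eta> \<in> Cc_infinity \<Omega> \<Longrightarrow> (LINT x:\<Omega>|lebesgue. g x * \<eta> x) = 0"
  shows "AE x in lebesgue. x \<in> \<Omega> \<longrightarrow> g x = 0"
proof -
  have box: "(LINT x:box c d|lebesgue. g x) = 0" if sub: "cbox c d \<subseteq> \<Omega>" for c d
  proof -
    obtain \<eta> where \<eta>: "\<And>n::nat. \<eta> n \<in> Cc_infinity (cbox c d)" "\<And>n x. \<bar>\<eta> n x\<bar> \<le> 1"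
      "\<And>x. (\<lambda>n. \<eta> n x) \<longlonglongrightarrow> indicator (box c d) x"
      using box_indicator_approx[of c d] by blast
    have gi: "set_integrable lebesgue (cbox c d) g"
      using int[OF compact_cbox sub] .
    have \<eta>\<Omega>: "\<eta> n \<in> Cc_infinity \<Omega>" for n
      using Cc_infinity_mono[OF \<eta>(1) sub] .
    have i\<eta>: "set_integrable lebesgue \<Omega> (\<lambda>x. g x * \<eta> n x)" for n
      by (rule set_integrable_mult_Cc[OF int \<eta>\<Omega>])
    have "(\<lambda>n. LINT x:\<Omega>|lebesgue. g x * \<eta> n x) \<longlonglongrightarrow> (LINT x:box c d|lebesgue. g x)"
      unfolding set_lebesgue_integral_def
    proof (rule integral_dominated_convergence)
      show "integrable lebesgue (\<lambda>x. norm (indicator (cbox c d) x *\<^sub>R g x))"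
        using gi unfolding set_integrable_def by (rule integrable_norm)
      show "(\<lambda>x. indicator \<Omega> x *\<^sub>R (g x * \<eta> n x)) \<in> borel_measurable lebesgue" for n
        using i\<eta>[of n] unfolding set_integrable_def by (rule borel_measurable_integrable)
      show "(\<lambda>x. indicator (box c d) x *\<^sub>R g x) \<in> borel_measurable lebesgue"
        using set_integrable_subset[OF gi, of "box c d"] box_subset_cbox
        unfolding set_integrable_def by (auto intro: borel_measurable_integrable)
      show "AE x in lebesgue. (\<lambda>n. indicator \<Omega> x *\<^sub>R (g x * \<eta> n x)) \<longlonglongrightarrow> indicator (box c d) x *\<^sub>R g x"
      proof (intro AE_I2)
        fix x
        have "(\<lambda>n. indicator \<Omega> x *\<^sub>R (g x * \<eta> n x)) \<longlonglongrightarrow>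
            indicator \<Omega> x *\<^sub>R (g x * indicator (box c d) x)"
          by (intro tendsto_intros \<eta>)
        moreover have "indicator \<Omega> x *\<^sub>R (g x * indicator (box c d) x) = indicator (box c d) x *\<^sub>R g x"
          using sub box_subset_cbox[of c d] by (auto simp: indicator_def)
        ultimately show "(\<lambda>n. indicator \<Omega> x *\<^sub>R (g x * \<eta> n x)) \<longlonglongrightarrow> indicator (box c d) x *\<^sub>R g x"
          by (simp only:)
      qed
      show "AE x in lebesgue. norm (indicator \<Omega> x *\<^sub>R (g x * \<eta> n x)) \<le>
          norm (indicator (cbox c d) x *\<^sub>R g x)" for n
      proof (intro AE_I2)
        fix x
        show "norm (indicator \<Omega> x *\<^sub>R (g x * \<eta> n x)) \<le> norm (indicator (cbox c d) x *\<^sub>R g x)"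
          using Cc_infinityD(4)[OF \<eta>(1), of x n] \<eta>(2)[of n x] sub
          by (auto simp: indicator_def abs_mult mult_left_le)
      qed
    qed
    then have "(\<lambda>n. 0) \<longlonglongrightarrow> (LINT x:box c d|lebesgue. g x)"
      using zero[OF \<eta>\<Omega>] by simp
    then show ?thesis
      using LIMSEQ_unique[OF _ tendsto_const] by blast
  qed
  obtain \<D> where \<D>: "countable \<D>" "\<D> \<subseteq> Pow \<Omega>" "\<And>X. X \<in> \<D> \<Longrightarrow> \<exists>a b. X = cbox a b" "\<Union>\<D> = \<Omega>"
    using open_countable_Union_open_cbox[OF \<Omega>] by metis
  have "AE x in lebesgue. x \<in> X \<longrightarrow> g x = 0" if X: "X \<in> \<D>" for X
  proof -
    obtain a b where ab: "X = cbox a b" using \<D>(3)[OF X] by blast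
    then have sub: "cbox a b \<subseteq> \<Omega>" using X \<D>(2) by blast
    show ?thesis
      unfolding ab using AE_zero_if_box_integrals_zero[OF int[OF compact_cbox sub]] box sub by blast
  qed
  then have "AE x in lebesgue. \<forall>X\<in>\<D>. x \<in> X \<longrightarrow> g x = 0"
    by (intro AE_ball_countable[OF \<D>(1), THEN iffD2]) blast
  then show ?thesis
    by eventually_elim (use \<D>(4) in blast)
qed

section \<open>Uniqueness and linearity of weak derivatives\<close>

lemma weak_deriv_unique:
  assumes \<Omega>: "open \<Omega>" and g: "weak_deriv \<Omega> i v g" and h: "weak_deriv \<Omega> i v h"
  shows "AE x in lebesgue. x \<in> \<Omega> \<longrightarrow> g x = h x"
proof -
  have gi: "set_integrable lebesgue K g" and hi: "set_integrable lebesgue K h"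
    if "compact K" "K \<subseteq> \<Omega>" for K
    using that g h unfolding weak_deriv_def by auto
  have "AE x in lebesgue. x \<in> \<Omega> \<longrightarrow> g x - h x = 0"
  proof (rule fundamental_lemma_calculus_of_variations[OF \<Omega>])
    fix \<eta> assume \<eta>: "\<eta> \<in> Cc_infinity \<Omega>"
    have "(LINT x:\<Omega>|lebesgue. (g x - h x) * \<eta> x) =
        (LINT x:\<Omega>|lebesgue. g x * \<eta> x) - (LINT x:\<Omega>|lebesgue. h x * \<eta> x)"
      unfolding left_diff_distrib
      by (intro set_integral_diff set_integrable_mult_Cc gi hi \<eta>)
    also have "\<dots> = 0"
    proof -
      have "- (LINT x:\<Omega>|lebesgue. g x * \<eta> x) = - (LINT x:\<Omega>|lebesgue. h x * \<eta> x)"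
        using g h \<eta> unfolding weak_deriv_def by (metis (no_types, lifting))
      then show ?thesis by simp
    qed
    finally show "(LINT x:\<Omega>|lebesgue. (g x - h x) * \<eta> x) = 0" .
  qed (intro set_integral_diff gi hi)
  then show ?thesis by simp
qed

lemma weak_deriv_wD: "weak_deriv \<Omega> i v g \<Longrightarrow> weak_deriv \<Omega> i v (wD \<Omega> i v)"
  unfolding wD_def by (rule someI[of "weak_deriv \<Omega> i v"])

text \<open>This is how the choice behind \<open>wD\<close> is evaluated. Since it gives values only
  almost everywhere, the lemmas on families below allow \<open>f t\<close> to differ from the
  continuous \<open>G t\<close> on a null set.\<close>

lemma wD_AE_eq:
  "open \<Omega> \<Longrightarrow> weak_deriv \<Omega> i v g \<Longrightarrow> AE x in lebesgue. x \<in> \<Omega> \<longrightarrow> wD \<Omega> i v x = g x"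
  by (rule weak_deriv_unique[OF _ weak_deriv_wD])

text \<open>\<open>wD\<close> of a difference is a fresh choice; this lemma lets the Sobolev norm of
  a difference be computed from the two derivatives.\<close>

lemma weak_deriv_diff:
  assumes g: "weak_deriv \<Omega> i v g" and h: "weak_deriv \<Omega> i w h"
  shows "weak_deriv \<Omega> i (\<lambda>x. v x - w x) (\<lambda>x. g x - h x)"
  unfolding weak_deriv_def
proof (intro conjI allI impI ballI)
  fix K assume "compact K \<and> K \<subseteq> \<Omega>"
  then show "set_integrable lebesgue K (\<lambda>x. v x - w x)" "set_integrable lebesgue K (\<lambda>x. g x - h x)"
    using g h unfolding weak_deriv_def by (auto intro: set_integral_diff)
next
  fix \<eta> assume \<eta>: "\<eta> \<in> Cc_infinity \<Omega>"
  have loc: "set_integrable lebesgue K f" if "compact K" "K \<subseteq> \<Omega>" "f \<in> {v, w, g, h}" for K f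
    using that g h unfolding weak_deriv_def by auto
  obtain K where K: "compact K" "K \<subseteq> \<Omega>" "\<eta> \<in> Cc_infinity K"
    using Cc_infinity_support[OF \<eta>] by blast
  let ?d = "\<lambda>x. frechet_derivative \<eta> (at x) (axis i 1)"
  have di: "set_integrable lebesgue \<Omega> (\<lambda>x. f x * ?d x)" if "f \<in> {v, w}" for f
  proof -
    have "set_integrable lebesgue K (\<lambda>x. f x * ?d x)"
      using Cc_infinityD(2)[OF \<eta>, of i] loc[of K f] that K
      by (intro set_integrable_mult_continuous) (auto intro: continuous_on_subset)
    moreover have "(\<lambda>x. indicator \<Omega> x *\<^sub>R (f x * ?d x)) = (\<lambda>x. indicator K x *\<^sub>R (f x * ?d x))"
      using K Cc_infinityD(5)[OF K(3)] by (force simp: fun_eq_iff indicator_def)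
    ultimately show ?thesis unfolding set_integrable_def by simp
  qed
  have "(LINT x:\<Omega>|lebesgue. (v x - w x) * ?d x) =
      (LINT x:\<Omega>|lebesgue. v x * ?d x) - (LINT x:\<Omega>|lebesgue. w x * ?d x)"
    unfolding left_diff_distrib by (intro set_integral_diff di) auto
  also have "\<dots> = - (LINT x:\<Omega>|lebesgue. g x * \<eta> x) + (LINT x:\<Omega>|lebesgue. h x * \<eta> x)"
    using g h \<eta> unfolding weak_deriv_def by simp
  also have "\<dots> = - (LINT x:\<Omega>|lebesgue. (g x - h x) * \<eta> x)"
    unfolding left_diff_distrib
    by (subst set_integral_diff(2)) (auto intro!: set_integrable_mult_Cc \<eta> loc)
  finally show "(LINT x:\<Omega>|lebesgue. (v x - w x) * ?d x) =
      - (LINT x:\<Omega>|lebesgue. (g x - h x) * \<eta> x)" .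
qed

section \<open>Lebesgue and Bochner spaces\<close>

text \<open>Completeness of Lebesgue measure transfers measurability from \<open>f\<close> to
  \<open>g\<close>. This matters where \<open>g\<close> contains \<open>wD\<close> and nothing else
  is known about its measurability.\<close>

lemma lebesgue_integral_cong_AE:
  fixes f g :: "'a::euclidean_space \<Rightarrow> real"
  assumes "f \<in> borel_measurable lebesgue" "AE x in lebesgue. f x = g x"
  shows "(LINT x|lebesgue. f x) = (LINT x|lebesgue. g x)"
  using assms borel_measurable_AE[OF assms] by (intro integral_cong_AE)

lemma Lq_bounded:
  fixes v :: "real^'n \<Rightarrow> real"
  assumes S: "S \<in> lmeasurable" and v: "set_borel_measurable lebesgue S v"
    and B: "0 \<le> B" "AE x in lebesgue. x \<in> S \<longrightarrow> \<bar>v x\<bar> \<le> B" and q: "0 < q"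
  shows "v \<in> Lq S q" "Lq_norm S q v \<le> B * measure lebesgue S powr (1 / q)"
proof -
  have dom: "integrable lebesgue (\<lambda>x. B powr q * indicator S x)"
    using S by (auto simp: fmeasurable_def)
  have meas: "(\<lambda>x. indicator S x *\<^sub>R (\<bar>v x\<bar> powr q)) \<in> borel_measurable lebesgue"
  proof -
    have "(\<lambda>x. \<bar>indicator S x *\<^sub>R v x\<bar> powr q) \<in> borel_measurable lebesgue"
      using v unfolding set_borel_measurable_def by measurable
    moreover have "(\<lambda>x. \<bar>indicator S x *\<^sub>R v x\<bar> powr q) = (\<lambda>x. indicator S x *\<^sub>R (\<bar>v x\<bar> powr q))"
      using q by (auto simp: indicator_def fun_eq_iff)
    ultimately show ?thesis by simp
  qed
  have le: "AE x in lebesgue. indicator S x *\<^sub>R (\<bar>v x\<bar> powr q) \<le> B powr q * indicator S x"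
    using B(2) by eventually_elim (use q in \<open>auto simp: indicator_def intro!: powr_mono2\<close>)
  have int: "integrable lebesgue (\<lambda>x. indicator S x *\<^sub>R (\<bar>v x\<bar> powr q))"
    by (rule Bochner_Integration.integrable_bound[OF dom meas])
      (use le in eventually_elim, auto simp: indicator_def split: if_splits)
  then show "v \<in> Lq S q"
    unfolding Lq_def set_integrable_def using v by simp
  have "(LINT x:S|lebesgue. \<bar>v x\<bar> powr q) \<le> (LINT x|lebesgue. B powr q * indicator S x)"
    unfolding set_lebesgue_integral_def by (rule integral_mono_AE[OF int dom le])
  also have "\<dots> = B powr q * measure lebesgue S"
    by simp
  finally have "(LINT x:S|lebesgue. \<bar>v x\<bar> powr q) powr (1 / q) \<le> (B powr q * measure lebesgue S) powr (1 / q)"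
    using q by (intro powr_mono2) (auto simp: set_lebesgue_integral_def intro!: integral_nonneg_AE)
  also have "\<dots> = B * measure lebesgue S powr (1 / q)"
    using q B(1) by (simp add: powr_mult powr_powr)
  finally show "Lq_norm S q v \<le> B * measure lebesgue S powr (1 / q)"
    unfolding Lq_norm_def .
qed

lemma Lq_norm_nonneg: "0 \<le> Lq_norm S q v"
  unfolding Lq_norm_def by simp

lemma set_borel_measurable_cong_AE:
  fixes v w :: "'a::euclidean_space \<Rightarrow> real"
  assumes "set_borel_measurable lebesgue S w" "AE x in lebesgue. x \<in> S \<longrightarrow> v x = w x"
  shows "set_borel_measurable lebesgue S v"
  unfolding set_borel_measurable_def
  by (rule borel_measurable_AE[OF assms(1)[unfolded set_borel_measurable_def]])
    (use assms(2) in eventually_elim, auto simp: indicator_def)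

lemma Lq_norm_cong_AE:
  fixes v w :: "real^'n \<Rightarrow> real"
  assumes "set_borel_measurable lebesgue S w" "AE x in lebesgue. x \<in> S \<longrightarrow> v x = w x"
  shows "Lq_norm S q v = Lq_norm S q w"
proof -
  have w: "(\<lambda>x. indicator S x *\<^sub>R (\<bar>w x\<bar> powr q)) \<in> borel_measurable lebesgue"
  proof -
    have "(\<lambda>x. indicator {x. indicator S x *\<^sub>R w x \<noteq> 0} x * (\<bar>indicator S x *\<^sub>R w x\<bar> powr q)) \<in> borel_measurable lebesgue"
      using assms(1) unfolding set_borel_measurable_def by measurable
    moreover have "(\<lambda>x. indicator {x. indicator S x *\<^sub>R w x \<noteq> 0} x * (\<bar>indicator S x *\<^sub>R w x\<bar> powr q)) =
        (\<lambda>x. indicator S x *\<^sub>R (\<bar>w x\<bar> powr q))"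
      by (auto simp: indicator_def fun_eq_iff)
    ultimately show ?thesis by simp
  qed
  have "AE x in lebesgue. indicator S x *\<^sub>R (\<bar>w x\<bar> powr q) = indicator S x *\<^sub>R (\<bar>v x\<bar> powr q)"
    using assms(2) by eventually_elim (auto simp: indicator_def)
  from lebesgue_integral_cong_AE[OF w this] show ?thesis
    unfolding Lq_norm_def set_lebesgue_integral_def by simp
qed

lemma set_borel_measurable_continuous:
  fixes v :: "'a::euclidean_space \<Rightarrow> real"
  assumes "continuous_on S v" "S \<in> sets lebesgue"
  shows "set_borel_measurable lebesgue S v"
proof -
  have "(\<lambda>x. if x \<in> S then v x else 0) \<in> borel_measurable lebesgue"
    using borel_measurable_if_I[OF continuous_imp_measurable_on_sets_lebesgue[OF assms] assms(2)] .
  moreover have "(\<lambda>x. if x \<in> S then v x else 0) = (\<lambda>x. indicator S x *\<^sub>R v x)"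
    by (auto simp: indicator_def)
  ultimately show ?thesis unfolding set_borel_measurable_def by simp
qed

section \<open>Continuous families are Bochner measurable and integrable\<close>

text \<open>Heine-Cantor on the compact product gives one modulus of continuity in time for all
  \<open>x\<close> in \<open>K\<close>, the source of every Bochner regularity statement about the
  profile.\<close>

lemma slices_uniformly_continuous:
  fixes G :: "real \<Rightarrow> 'a::metric_space \<Rightarrow> real"
  assumes "continuous_on ({a..b} \<times> K) (\<lambda>(t, x). G t x)" "compact K" "0 < e"
  obtains d where "0 < d" "\<And>s t x. s \<in> {a..b} \<Longrightarrow> t \<in> {a..b} \<Longrightarrow> \<bar>s - t\<bar> < d \<Longrightarrow> x \<in> K \<Longrightarrow> \<bar>G s x - G t x\<bar> \<le> e"
proof -
  have "uniformly_continuous_on ({a..b} \<times> K) (\<lambda>(t, x). G t x)"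
    using assms by (intro compact_uniformly_continuous compact_Times) auto
  then obtain d where d: "d > 0" and
    *: "\<And>y z. y \<in> {a..b} \<times> K \<Longrightarrow> z \<in> {a..b} \<times> K \<Longrightarrow> dist z y < d \<Longrightarrow> dist ((\<lambda>(t, x). G t x) z) ((\<lambda>(t, x). G t x) y) < e"
    using assms(3) unfolding uniformly_continuous_on_def by metis
  show ?thesis
  proof (rule that[OF d])
    fix s t x assume "s \<in> {a..b}" "t \<in> {a..b}" "\<bar>s - t\<bar> < d" "x \<in> K"
    then show "\<bar>G s x - G t x\<bar> \<le> e"
      using *[of "(t, x)" "(s, x)"] by (simp add: dist_Pair_Pair dist_real_def)
  qed
qed

lemma slice_continuous:
  assumes "continuous_on (J \<times> K) (\<lambda>(t, x). G t x)" "t \<in> J"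
  shows "continuous_on K (G t)"
proof -
  have "continuous_on K (\<lambda>x. (\<lambda>(t, x). G t x) (t, x))"
    by (rule continuous_on_compose2[OF assms(1)]) (use assms(2) in \<open>auto intro!: continuous_intros\<close>)
  then show ?thesis by simp
qed

lemma continuous_on_weighted_integral:
  fixes G :: "real \<Rightarrow> 'a::euclidean_space \<Rightarrow> real"
  assumes G: "continuous_on ({a..b} \<times> K) (\<lambda>(t, x). G t x)" "compact K"
    and v: "set_integrable lebesgue K v" and S: "S \<subseteq> K" "S \<in> sets lebesgue"
  shows "continuous_on {a..b} (\<lambda>t. LINT x:S|lebesgue. v x * G t x)"
proof -
  have vS: "set_integrable lebesgue S v"
    using set_integrable_subset[OF v S(2,1)] .
  have vG: "set_integrable lebesgue S (\<lambda>x. v x * G t x)" if "t \<in> {a..b}" for t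
    using set_integrable_subset[OF set_integrable_mult_continuous[OF v G(2) slice_continuous[OF G(1) that]] S(2,1)] .
  define M where "M = (LINT x:S|lebesgue. \<bar>v x\<bar>)"
  have M: "M \<ge> 0" unfolding M_def set_lebesgue_integral_def by (intro integral_nonneg_AE) auto
  have "uniformly_continuous_on {a..b} (\<lambda>t. LINT x:S|lebesgue. v x * G t x)"
    unfolding uniformly_continuous_on_def
  proof (intro allI impI)
    fix e :: real assume e: "e > 0"
    \<comment> \<open>With \<open>M\<close> the L1 norm of \<open>v\<close>, the error is at most
      \<open>M * (e / (M + 1))\<close>; the added 1 covers \<open>M = 0\<close> and makes the bound
      strict.\<close>
    obtain d where d: "0 < d" "\<And>s t x. s \<in> {a..b} \<Longrightarrow> t \<in> {a..b} \<Longrightarrow> \<bar>s - t\<bar> < d \<Longrightarrow> x \<in> K \<Longrightarrow>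
        \<bar>G s x - G t x\<bar> \<le> e / (M + 1)"
      using slices_uniformly_continuous[OF G, of "e / (M + 1)"] e M by (smt (verit) divide_pos_pos)
    have "dist (LINT x:S|lebesgue. v x * G s x) (LINT x:S|lebesgue. v x * G t x) < e"
      if st: "t \<in> {a..b}" "s \<in> {a..b}" "dist s t < d" for s t
    proof -
      have "\<bar>(LINT x:S|lebesgue. v x * G s x) - (LINT x:S|lebesgue. v x * G t x)\<bar> =
          \<bar>LINT x:S|lebesgue. v x * G s x - v x * G t x\<bar>"
        using vG st by (simp add: set_integral_diff)
      also have "\<dots> \<le> (LINT x:S|lebesgue. \<bar>v x * G s x - v x * G t x\<bar>)"
        unfolding set_lebesgue_integral_def
        by (rule order_trans[OF integral_abs_bound]) (simp add: abs_mult)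
      also have "\<dots> \<le> (LINT x:S|lebesgue. \<bar>v x\<bar> * (e / (M + 1)))"
      proof (rule set_integral_mono)
        show "set_integrable lebesgue S (\<lambda>x. \<bar>v x * G s x - v x * G t x\<bar>)"
          using vG st by (intro set_integrable_abs set_integral_diff) auto
        show "set_integrable lebesgue S (\<lambda>x. \<bar>v x\<bar> * (e / (M + 1)))"
          using vS by (intro set_integrable_mult_left set_integrable_abs) auto
        show "\<bar>v x * G s x - v x * G t x\<bar> \<le> \<bar>v x\<bar> * (e / (M + 1))" if "x \<in> S" for x
          unfolding right_diff_distrib[symmetric] abs_mult
          using d(2)[of s t x] st that S by (intro mult_left_mono) (auto simp: dist_real_def)
      qed
      also have "\<dots> = M * (e / (M + 1))"
        unfolding M_def by (rule set_integral_mult_left)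
      also have "\<dots> < e"
        using e M by (simp add: field_simps)
      finally show ?thesis by (simp add: dist_real_def)
    qed
    then show "\<exists>d>0. \<forall>t\<in>{a..b}. \<forall>s\<in>{a..b}. dist s t < d \<longrightarrow>
        dist (LINT x:S|lebesgue. v x * G s x) (LINT x:S|lebesgue. v x * G t x) < e"
      using d(1) by blast
  qed
  then show ?thesis
    by (rule uniformly_continuous_imp_continuous)
qed

text \<open>Sampling \<open>f\<close> at the left grid point of mesh \<open>1 / c\<close> leaves
  finitely many values.\<close>

lemma simple_into_sampled:
  fixes f :: "real \<Rightarrow> 'a \<Rightarrow> real"
  assumes "\<And>t. t \<in> {a..b} \<Longrightarrow> f t \<in> V" and c: "c > 0"
  shows "simple_into {a..b} V (\<lambda>t. f (a + of_int \<lfloor>(t - a) * c\<rfloor> / c))"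
proof -
  have in_ab: "a + of_int \<lfloor>(t - a) * c\<rfloor> / c \<in> {a..b}" if "t \<in> {a..b}" for t
  proof -
    have "0 \<le> \<lfloor>(t - a) * c\<rfloor>" using that c by simp
    moreover have "of_int \<lfloor>(t - a) * c\<rfloor> / c \<le> t - a"
      using c by (simp add: divide_le_eq)
    ultimately show ?thesis using that c by auto
  qed
  have "(\<lambda>t. f (a + of_int \<lfloor>(t - a) * c\<rfloor> / c)) ` {a..b} \<subseteq> (\<lambda>j. f (a + of_int j / c)) ` {0..\<lfloor>(b - a) * c\<rfloor>}"
    using c by (auto intro!: imageI floor_mono mult_right_mono)
  then have "finite ((\<lambda>t. f (a + of_int \<lfloor>(t - a) * c\<rfloor> / c)) ` {a..b})"
    by (rule finite_subset) auto
  \<comment> \<open>Different grid points may carry the same function \<open>v\<close>; the level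
    set is nevertheless the preimage of a set of integers under a Borel map.\<close>
  moreover have "{t \<in> {a..b}. f (a + of_int \<lfloor>(t - a) * c\<rfloor> / c) = v} \<in> sets lebesgue" for v
  proof -
    have "(\<lambda>t. \<lfloor>(t - a) * c\<rfloor>) \<in> borel \<rightarrow>\<^sub>M count_space UNIV"
      by measurable
    then have "(\<lambda>t. \<lfloor>(t - a) * c\<rfloor>) -` {j. f (a + of_int j / c) = v} \<inter> space borel \<in> sets borel"
      by (rule measurable_sets) simp
    then have "{a..b} \<inter> ((\<lambda>t. \<lfloor>(t - a) * c\<rfloor>) -` {j. f (a + of_int j / c) = v}) \<in> sets borel"
      by auto
    also have "{a..b} \<inter> ((\<lambda>t. \<lfloor>(t - a) * c\<rfloor>) -` {j. f (a + of_int j / c) = v}) =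
        {t \<in> {a..b}. f (a + of_int \<lfloor>(t - a) * c\<rfloor> / c) = v}"
      by auto
    finally show ?thesis by simp
  qed
  ultimately show ?thesis
    unfolding simple_into_def using assms in_ab by blast
qed

text \<open>Grid sampling of mesh \<open>1 / Suc k\<close> converges in \<open>nrm\<close> at every
  time. \<open>nrm\<close> is merely a nonnegative functional here, without a triangle inequality,
  so continuity of \<open>nrm (f t)\<close> in \<open>t\<close> is a separate hypothesis.\<close>

lemma in_bochner_Lq_continuous:
  fixes f :: "real \<Rightarrow> 'a \<Rightarrow> real"
  assumes V: "\<And>t. t \<in> {a..b} \<Longrightarrow> f t \<in> V" and nonneg: "\<And>v. 0 \<le> nrm v"
    and unif: "\<And>e. e > 0 \<Longrightarrow> \<exists>d>0. \<forall>s\<in>{a..b}. \<forall>t\<in>{a..b}. \<bar>s - t\<bar> < d \<longrightarrow> nrm (\<lambda>x. f s x - f t x) \<le> e"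
    and cont: "continuous_on {a..b} (\<lambda>t. nrm (f t))" and q: "q > 0"
  shows "in_bochner_Lq {a..b} q V nrm f"
proof -
  define r where "r k t = a + of_int \<lfloor>(t - a) * real (Suc k)\<rfloor> / real (Suc k)" for k t
  have r: "r k t \<in> {a..b}" "\<bar>t - r k t\<bar> \<le> 1 / real (Suc k)" if "t \<in> {a..b}" for k t
  proof -
    have "0 \<le> \<lfloor>(t - a) * real (Suc k)\<rfloor>" using that by simp
    moreover have 1: "of_int \<lfloor>(t - a) * real (Suc k)\<rfloor> / real (Suc k) \<le> t - a"
      by (subst divide_le_eq) auto
    ultimately show "r k t \<in> {a..b}" using that by (auto simp: r_def)
    have "(t - a) * real (Suc k) \<le> of_int \<lfloor>(t - a) * real (Suc k)\<rfloor> + 1"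
      by linarith
    then have "t - a \<le> (of_int \<lfloor>(t - a) * real (Suc k)\<rfloor> + 1) / real (Suc k)"
      by (subst le_divide_eq) auto
    then show "\<bar>t - r k t\<bar> \<le> 1 / real (Suc k)"
      using 1 unfolding r_def by (simp add: add_divide_distrib)
  qed
  have "(\<lambda>k. nrm (\<lambda>x. f t x - f (r k t) x)) \<longlonglongrightarrow> 0" if t: "t \<in> {a..b}" for t
  proof (rule LIMSEQ_I)
    fix e :: real assume "e > 0"
    then obtain d where d: "d > 0" "\<forall>s\<in>{a..b}. \<forall>t\<in>{a..b}. \<bar>s - t\<bar> < d \<longrightarrow> nrm (\<lambda>x. f s x - f t x) \<le> e / 2"
      using unif[of "e / 2"] by auto
    obtain N where N: "1 / real (Suc N) < d"
      using d(1) by (meson nat_approx_posE)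
    have "norm (nrm (\<lambda>x. f t x - f (r k t) x) - 0) < e" if "k \<ge> N" for k
    proof -
      have "1 / real (Suc k) \<le> 1 / real (Suc N)"
        using that by (intro divide_left_mono) auto
      then have "\<bar>t - r k t\<bar> < d"
        using r(2)[OF t, of k] N by linarith
      then have "nrm (\<lambda>x. f t x - f (r k t) x) \<le> e / 2"
        using d(2) t r(1)[OF t] by blast
      then show ?thesis using \<open>e > 0\<close> nonneg[of "\<lambda>x. f t x - f (r k t) x"] by simp
    qed
    then show "\<exists>N. \<forall>k\<ge>N. norm (nrm (\<lambda>x. f t x - f (r k t) x) - 0) < e" by blast
  qed
  moreover have "simple_into {a..b} V (\<lambda>t. f (r k t))" for k
    unfolding r_def using V by (intro simple_into_sampled) auto
  ultimately have "strongly_measurable {a..b} V nrm f"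
    unfolding strongly_measurable_def using V
    by (intro conjI exI[of _ "\<lambda>k t. f (r k t)"] AE_I2) auto
  moreover have "set_integrable lebesgue {a..b} (\<lambda>t. nrm (f t) powr q)"
    using cont q nonneg by (intro compact_set_integrable_lebesgue continuous_on_powr') auto
  ultimately show ?thesis
    unfolding in_bochner_Lq_def by blast
qed

text \<open>\<open>f\<close> is the family of interest, typically a chosen weak derivative, and
  \<open>G\<close> its continuous version; \<open>S\<close> is an open set with closure
  \<open>K\<close>, or \<open>K\<close> itself. The last claim speaks of every \<open>v\<close> that
  agrees almost everywhere with \<open>G s x - G t x\<close>, because \<open>wD\<close> of a
  difference need not be the difference of the \<open>wD\<close>.\<close>

lemma Lq_norm_continuous_family:
  fixes f G :: "real \<Rightarrow> real^'n \<Rightarrow> real"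
  assumes G: "continuous_on ({a..b} \<times> K) (\<lambda>(t, x). G t x)" "compact K"
    and S: "S \<subseteq> K" "S \<in> sets lebesgue" and q: "q > 0"
    and f: "\<forall>t\<in>{a..b}. AE x in lebesgue. x \<in> S \<longrightarrow> f t x = G t x"
  shows "\<And>t. t \<in> {a..b} \<Longrightarrow> f t \<in> Lq S q"
    and "continuous_on {a..b} (\<lambda>t. Lq_norm S q (f t))"
    and "\<And>e. e > 0 \<Longrightarrow> \<exists>d>0. \<forall>s\<in>{a..b}. \<forall>t\<in>{a..b}. \<bar>s - t\<bar> < d \<longrightarrow>
      (\<forall>v. (AE x in lebesgue. x \<in> S \<longrightarrow> v x = G s x - G t x) \<longrightarrow> Lq_norm S q v \<le> e)"
proof -
  have SK: "S \<in> lmeasurable"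
    using S G(2) bounded_set_imp_lmeasurable bounded_subset compact_imp_bounded by metis
  have Gm: "set_borel_measurable lebesgue S (G t)" if "t \<in> {a..b}" for t
    using slice_continuous[OF G(1) that] S
    by (intro set_borel_measurable_continuous) (auto intro: continuous_on_subset)
  show "f t \<in> Lq S q" if t: "t \<in> {a..b}" for t
  proof -
    have "bounded (G t ` K)"
      using slice_continuous[OF G(1) t] G(2) by (intro compact_imp_bounded compact_continuous_image)
    then obtain B where B: "B > 0" "\<And>x. x \<in> K \<Longrightarrow> \<bar>G t x\<bar> \<le> B"
      unfolding bounded_pos by auto
    show ?thesis
    proof (rule Lq_bounded(1)[OF SK _ _ _ q])
      show "set_borel_measurable lebesgue S (f t)"
        by (rule set_borel_measurable_cong_AE[OF Gm[OF t] bspec[OF f t]])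
      show "AE x in lebesgue. x \<in> S \<longrightarrow> \<bar>f t x\<bar> \<le> B"
        using bspec[OF f t] by eventually_elim (use B S in auto)
    qed (use B in auto)
  qed
  have "continuous_on ({a..b} \<times> K) (\<lambda>z. \<bar>(\<lambda>(t, x). G t x) z\<bar> powr q)"
    using G(1) q by (intro continuous_on_powr' continuous_intros) auto
  then have "continuous_on ({a..b} \<times> K) (\<lambda>(t, x). \<bar>G t x\<bar> powr q)"
    by (simp add: case_prod_unfold)
  then have "continuous_on {a..b} (\<lambda>t. LINT x:S|lebesgue. 1 * \<bar>G t x\<bar> powr q)"
    using G(2) S by (intro continuous_on_weighted_integral compact_set_integrable_lebesgue) auto
  then have "continuous_on {a..b} (\<lambda>t. Lq_norm S q (G t))"
    unfolding Lq_norm_def using q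
    by (intro continuous_on_powr' continuous_intros)
      (auto simp: set_lebesgue_integral_def intro!: integral_nonneg_AE)
  then show "continuous_on {a..b} (\<lambda>t. Lq_norm S q (f t))"
    using continuous_on_cong[OF refl, of "{a..b}" "\<lambda>t. Lq_norm S q (f t)" "\<lambda>t. Lq_norm S q (G t)"]
      Lq_norm_cong_AE[OF Gm bspec[OF f]] by blast
  show "\<exists>d>0. \<forall>s\<in>{a..b}. \<forall>t\<in>{a..b}. \<bar>s - t\<bar> < d \<longrightarrow>
      (\<forall>v. (AE x in lebesgue. x \<in> S \<longrightarrow> v x = G s x - G t x) \<longrightarrow> Lq_norm S q v \<le> e)" if e: "e > 0" for e
  proof -
    define m where "m = measure lebesgue S powr (1 / q)"
    have m: "m \<ge> 0" by (simp add: m_def)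
    define e' where "e' = e / (m + 1)"
    have e': "e' > 0" "e' * m \<le> e" using e m by (auto simp: e'_def field_simps)
    obtain d where d: "0 < d" "\<And>s t x. s \<in> {a..b} \<Longrightarrow> t \<in> {a..b} \<Longrightarrow> \<bar>s - t\<bar> < d \<Longrightarrow> x \<in> K \<Longrightarrow>
        \<bar>G s x - G t x\<bar> \<le> e'"
      using slices_uniformly_continuous[OF G e'(1)] by metis
    show ?thesis
    proof (intro exI[of _ d] conjI d(1) ballI impI allI)
      fix s t v assume st: "s \<in> {a..b}" "t \<in> {a..b}" "\<bar>s - t\<bar> < d"
        and v: "AE x in lebesgue. x \<in> S \<longrightarrow> v x = G s x - G t x"
      have "set_borel_measurable lebesgue S v"
        by (rule set_borel_measurable_cong_AE[OF _ v])
          (use slice_continuous[OF G(1)] st S in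
            \<open>auto intro!: set_borel_measurable_continuous continuous_intros intro: continuous_on_subset\<close>)
      then have "Lq_norm S q v \<le> e' * m"
        unfolding m_def
      proof (rule Lq_bounded(2)[OF SK _ _ _ q])
        show "AE x in lebesgue. x \<in> S \<longrightarrow> \<bar>v x\<bar> \<le> e'"
          using v by eventually_elim (use d(2) st S in auto)
      qed (use e' in auto)
      then show "Lq_norm S q v \<le> e" using e' by linarith
    qed
  qed
qed

lemma Lq_continuous_family:
  fixes f G :: "real \<Rightarrow> real^'n \<Rightarrow> real"
  assumes "continuous_on ({a..b} \<times> K) (\<lambda>(t, x). G t x)" "compact K"
    and "S \<subseteq> K" "S \<in> sets lebesgue" and "q > 0"
    and f: "\<forall>t\<in>{a..b}. AE x in lebesgue. x \<in> S \<longrightarrow> f t x = G t x"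
  shows "in_bochner_Lq {a..b} q (Lq S q) (Lq_norm S q) f"
    and "continuous_into {a..b} (Lq S q) (Lq_norm S q) f"
proof -
  note fam = Lq_norm_continuous_family[OF assms]
  have unif: "\<exists>d>0. \<forall>s\<in>{a..b}. \<forall>t\<in>{a..b}. \<bar>s - t\<bar> < d \<longrightarrow> Lq_norm S q (\<lambda>x. f s x - f t x) \<le> e"
    if "e > 0" for e
  proof -
    obtain d where d: "d > 0" "\<forall>s\<in>{a..b}. \<forall>t\<in>{a..b}. \<bar>s - t\<bar> < d \<longrightarrow>
      (\<forall>v. (AE x in lebesgue. x \<in> S \<longrightarrow> v x = G s x - G t x) \<longrightarrow> Lq_norm S q v \<le> e)"
      using fam(3)[OF \<open>e > 0\<close>] by blast
    have ae: "AE x in lebesgue. x \<in> S \<longrightarrow> f s x - f t x = G s x - G t x" if "s \<in> {a..b}" "t \<in> {a..b}" for s t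
      using bspec[OF f that(1)] bspec[OF f that(2)] by eventually_elim auto
    show ?thesis
    proof (intro exI[of _ d] conjI d(1) ballI impI)
      fix s t assume st: "s \<in> {a..b}" "t \<in> {a..b}" "\<bar>s - t\<bar> < d"
      from d(2)[rule_format, OF this ae[OF st(1,2)]]
      show "Lq_norm S q (\<lambda>x. f s x - f t x) \<le> e" .
    qed
  qed
  show "in_bochner_Lq {a..b} q (Lq S q) (Lq_norm S q) f"
  proof (rule in_bochner_Lq_continuous)
    show "f t \<in> Lq S q" if "t \<in> {a..b}" for t by (rule fam(1)[OF that])
    show "0 \<le> Lq_norm S q v" for v by (rule Lq_norm_nonneg)
  qed (fact unif fam(2) \<open>q > 0\<close>)+
  have "((\<lambda>s. Lq_norm S q (\<lambda>x. f s x - f t x)) \<longlongrightarrow> 0) (at t within {a..b})" if t: "t \<in> {a..b}" for t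
    unfolding tendsto_iff eventually_at
  proof (intro allI impI)
    fix e :: real assume "e > 0"
    then obtain d where d: "d > 0" "\<forall>s\<in>{a..b}. \<forall>t\<in>{a..b}. \<bar>s - t\<bar> < d \<longrightarrow> Lq_norm S q (\<lambda>x. f s x - f t x) \<le> e / 2"
      using unif[of "e / 2"] by auto
    show "\<exists>d>0. \<forall>s\<in>{a..b}. s \<noteq> t \<and> dist s t < d \<longrightarrow> dist (Lq_norm S q (\<lambda>x. f s x - f t x)) 0 < e"
    proof (intro exI[of _ d] conjI d(1) ballI impI)
      fix s assume "s \<in> {a..b}" "s \<noteq> t \<and> dist s t < d"
      then have "Lq_norm S q (\<lambda>x. f s x - f t x) \<le> e / 2"
        using d(2) t by (auto simp: dist_real_def)
      then show "dist (Lq_norm S q (\<lambda>x. f s x - f t x)) 0 < e"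
        using \<open>e > 0\<close> Lq_norm_nonneg[of S q "\<lambda>x. f s x - f t x"] by (simp add: dist_real_def)
    qed
  qed
  then show "continuous_into {a..b} (Lq S q) (Lq_norm S q) f"
    unfolding continuous_into_def using fam(1) by blast
qed

lemma W11_norm_nonneg: "0 \<le> W11_norm \<Omega> v"
  unfolding W11_norm_def by (intro add_nonneg_nonneg sum_nonneg Lq_norm_nonneg)

lemma in_LpW1p_continuous_family:
  fixes f :: "real \<Rightarrow> real^'n \<Rightarrow> real" and G :: "'n \<Rightarrow> real \<Rightarrow> real^'n \<Rightarrow> real"
  assumes f: "continuous_on ({a..b} \<times> closure \<Omega>) (\<lambda>(t, x). f t x)"
    and G: "\<And>i. continuous_on ({a..b} \<times> closure \<Omega>) (\<lambda>(t, x). G i t x)"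
    and \<Omega>: "open \<Omega>" "compact (closure \<Omega>)"
    and wd: "\<And>i t. t \<in> {a..b} \<Longrightarrow> weak_deriv \<Omega> i (f t) (G i t)" and p: "\<And>i. 0 < p i"
  shows "in_LpW1p {a..b} \<Omega> p f"
proof -
  have \<Omega>m: "\<Omega> \<in> sets lebesgue" using \<Omega>(1) by auto
  note famf = Lq_norm_continuous_family[OF f \<Omega>(2) closure_subset \<Omega>m zero_less_one, of f, simplified]
  have ae: "\<forall>t\<in>{a..b}. AE x in lebesgue. x \<in> \<Omega> \<longrightarrow> wD \<Omega> i (f t) x = G i t x" for i
    using wD_AE_eq[OF \<Omega>(1) wd] by blast
  note famG = Lq_norm_continuous_family[OF G \<Omega>(2) closure_subset \<Omega>m zero_less_one ae]
  have "in_bochner_Lq {a..b} 1 (W11 \<Omega>) (W11_norm \<Omega>) f"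
  proof (rule in_bochner_Lq_continuous[OF _ W11_norm_nonneg])
    show "f t \<in> W11 \<Omega>" if "t \<in> {a..b}" for t
      unfolding W11_def using famf(1) famG(1) wd that by fastforce
    show "continuous_on {a..b} (\<lambda>t. W11_norm \<Omega> (f t))"
      unfolding W11_norm_def by (intro continuous_intros famf(2) famG(2))
    fix e :: real assume e: "e > 0"
    \<comment> \<open>The norm of \<open>W11\<close> has one summand for the function and one for
      each coordinate, and each receives an equal share of \<open>e\<close>.\<close>
    define e' where "e' = e / (1 + real CARD('n))"
    have "1 + real CARD('n) > 0" by simp
    then have "e' > 0" "e' * (1 + real CARD('n)) = e"
      unfolding e'_def using e by (simp_all del: of_nat_add)
    then have e': "e' > 0" "e' + real CARD('n) * e' = e"
      by (simp_all add: algebra_simps)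
    obtain d0 where d0: "d0 > 0" "\<forall>s\<in>{a..b}. \<forall>t\<in>{a..b}. \<bar>s - t\<bar> < d0 \<longrightarrow>
      (\<forall>v. (AE x in lebesgue. x \<in> \<Omega> \<longrightarrow> v x = f s x - f t x) \<longrightarrow> Lq_norm \<Omega> 1 v \<le> e')"
      using famf(3)[OF e'(1)] by blast
    have "\<forall>i. \<exists>d>0. \<forall>s\<in>{a..b}. \<forall>t\<in>{a..b}. \<bar>s - t\<bar> < d \<longrightarrow>
      (\<forall>v. (AE x in lebesgue. x \<in> \<Omega> \<longrightarrow> v x = G i s x - G i t x) \<longrightarrow> Lq_norm \<Omega> 1 v \<le> e')"
      using famG(3)[OF e'(1)] by blast
    from choice[OF this] obtain d where d: "\<And>i. d i > 0" "\<And>i. \<forall>s\<in>{a..b}. \<forall>t\<in>{a..b}. \<bar>s - t\<bar> < d i \<longrightarrow>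
      (\<forall>v. (AE x in lebesgue. x \<in> \<Omega> \<longrightarrow> v x = G i s x - G i t x) \<longrightarrow> Lq_norm \<Omega> 1 v \<le> e')"
      by blast
    define \<delta> where "\<delta> = Min (insert d0 (range d))"
    have \<delta>: "\<delta> > 0" "\<delta> \<le> d0"
      using d0(1) d(1) by (auto simp: \<delta>_def Min_gr_iff)
    have \<delta>_le: "\<delta> \<le> d i" for i
      unfolding \<delta>_def by (rule Min_le) auto
    show "\<exists>d>0. \<forall>s\<in>{a..b}. \<forall>t\<in>{a..b}. \<bar>s - t\<bar> < d \<longrightarrow> W11_norm \<Omega> (\<lambda>x. f s x - f t x) \<le> e"
    proof (intro exI[of _ \<delta>] conjI \<delta>(1) ballI impI)
      fix s t assume st: "s \<in> {a..b}" "t \<in> {a..b}" "\<bar>s - t\<bar> < \<delta>"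
      have "Lq_norm \<Omega> 1 (\<lambda>x. f s x - f t x) \<le> e'"
        using d0(2) st \<delta>(2) by force
      \<comment> \<open>Here \<open>v\<close> in the last claim of \<open>famG\<close> is the
        derivative chosen for the difference \<open>f s - f t\<close>.\<close>
      moreover have "Lq_norm \<Omega> 1 (wD \<Omega> i (\<lambda>x. f s x - f t x)) \<le> e'" for i
        using d(2)[of i] st \<delta>_le[of i] wD_AE_eq[OF \<Omega>(1) weak_deriv_diff[OF wd[OF st(1)] wd[OF st(2)]], of i]
        by force
      then have "(\<Sum>i\<in>UNIV. Lq_norm \<Omega> 1 (wD \<Omega> i (\<lambda>x. f s x - f t x))) \<le> real CARD('n) * e'"
        using sum_bounded_above[of UNIV "\<lambda>i. Lq_norm \<Omega> 1 (wD \<Omega> i (\<lambda>x. f s x - f t x))" e'] by simp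
      ultimately show "W11_norm \<Omega> (\<lambda>x. f s x - f t x) \<le> e"
        unfolding W11_norm_def using e' by linarith
    qed
  qed simp
  moreover have "in_bochner_Lq {a..b} (p i) (Lq \<Omega> (p i)) (Lq_norm \<Omega> (p i)) (\<lambda>t. wD \<Omega> i (f t))" for i
    by (rule Lq_continuous_family(1)[OF G \<Omega>(2) closure_subset \<Omega>m p ae])
  ultimately show ?thesis
    unfolding in_LpW1p_def by blast
qed

section \<open>Pairing with continuous functions\<close>

lemma LqD:
  assumes "v \<in> Lq S q"
  shows "set_borel_measurable lebesgue S v" "set_integrable lebesgue S (\<lambda>x. \<bar>v x\<bar> powr q)"
  using assms unfolding Lq_def by auto

text \<open>In place of the sharp Hoelder constant, \<open>y \<le> 1 + y powr q\<close> is applied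
  to \<open>\<bar>v x\<bar> / l\<close> and the scale \<open>l\<close> is optimised. The resulting
  factor \<open>measure lebesgue E + 1\<close> is crude but sufficient.\<close>

lemma Lq_imp_integrable:
  fixes v :: "real^'n \<Rightarrow> real"
  assumes E: "E \<in> lmeasurable" and q: "1 \<le> q" and v: "v \<in> Lq E q"
  shows "set_integrable lebesgue E v"
    and "(LINT x:E|lebesgue. \<bar>v x\<bar>) \<le> (measure lebesgue E + 1) * Lq_norm E q v"
proof -
  define I where "I = (LINT x:E|lebesgue. \<bar>v x\<bar> powr q)"
  have I: "I \<ge> 0"
    unfolding I_def set_lebesgue_integral_def by (intro integral_nonneg_AE) auto
  have one: "set_integrable lebesgue E (\<lambda>x. 1 :: real)"
    using E unfolding set_integrable_def by (auto simp: fmeasurable_def)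
  have young: "y \<le> 1 + y powr q" if "y \<ge> 0" for y :: real
    using powr_mono[of 1 q y] q that by (cases "y \<le> 1") (auto intro: add_increasing2)
  show int: "set_integrable lebesgue E v"
  proof (rule set_integrable_bound)
    show "set_integrable lebesgue E (\<lambda>x. 1 + \<bar>v x\<bar> powr q)"
      using one LqD[OF v] by (intro set_integral_add)
    show "set_borel_measurable lebesgue E v" using LqD[OF v] by blast
    show "AE x in lebesgue. x \<in> E \<longrightarrow> norm (v x) \<le> norm (1 + \<bar>v x\<bar> powr q)"
      using young[of "\<bar>v _\<bar>"] by (auto intro!: AE_I2)
  qed
  have key: "(LINT x:E|lebesgue. \<bar>v x\<bar>) \<le> l * measure lebesgue E + l * (I / l powr q)" if l: "l > 0" for l
  proof -
    have "(LINT x:E|lebesgue. \<bar>v x\<bar>) \<le> (LINT x:E|lebesgue. l * 1 + l / l powr q * (\<bar>v x\<bar> powr q))"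
    proof (rule set_integral_mono)
      show "set_integrable lebesgue E (\<lambda>x. \<bar>v x\<bar>)"
        using int by (rule set_integrable_abs)
      show "set_integrable lebesgue E (\<lambda>x. l * 1 + l / l powr q * (\<bar>v x\<bar> powr q))"
        using one LqD(2)[OF v] by (intro set_integral_add set_integrable_mult_right) auto
      show "\<bar>v x\<bar> \<le> l * 1 + l / l powr q * (\<bar>v x\<bar> powr q)" for x
      proof -
        have "\<bar>v x\<bar> / l \<le> 1 + (\<bar>v x\<bar> / l) powr q"
          using l by (intro young) auto
        then have "l * (\<bar>v x\<bar> / l) \<le> l * (1 + (\<bar>v x\<bar> / l) powr q)"
          using l by (intro mult_left_mono) auto
        then show ?thesis
          using l by (simp add: powr_divide distrib_left)
      qed
    qed
    also have "\<dots> = l * (LINT x:E|lebesgue. 1) + l / l powr q * I"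
    proof -
      have "set_integrable lebesgue E (\<lambda>x. l * 1)" "set_integrable lebesgue E (\<lambda>x. l / l powr q * (\<bar>v x\<bar> powr q))"
        using one LqD(2)[OF v] by (intro set_integrable_mult_right; simp)+
      from set_integral_add(2)[OF this] show ?thesis
        unfolding I_def set_integral_mult_right .
    qed
    also have "(LINT x:E|lebesgue. 1) = measure lebesgue E"
      using E by (simp add: set_lebesgue_integral_def)
    finally show ?thesis by simp
  qed
  show "(LINT x:E|lebesgue. \<bar>v x\<bar>) \<le> (measure lebesgue E + 1) * Lq_norm E q v"
  proof (cases "I = 0")
    case False
    \<comment> \<open>At this scale the second term of \<open>key\<close> equals \<open>l\<close>,
      so the bound becomes \<open>l * measure lebesgue E + l\<close>.\<close>
    define l where "l = Lq_norm E q v"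
    have l: "l > 0" "l powr q = I"
      using False I q unfolding l_def Lq_norm_def I_def[symmetric] by (auto simp: powr_powr)
    have "l * (I / l powr q) = l" using l False by simp
    then show ?thesis
      using key[OF l(1)] by (simp add: l_def[symmetric] algebra_simps)
  next
    case True
    let ?X = "LINT x:E|lebesgue. \<bar>v x\<bar>"
    have m: "measure lebesgue E \<ge> 0" by simp
    have "?X \<le> 0"
    proof (rule ccontr)
      assume "\<not> ?X \<le> 0"
      then have X: "?X > 0" by simp
      \<comment> \<open>With \<open>I = 0\<close>, \<open>key\<close> bounds \<open>?X\<close> by
        \<open>l * measure lebesgue E\<close> for every positive \<open>l\<close>; this one makes
        the bound smaller than \<open>?X\<close> itself.\<close>
      define l where "l = ?X / (2 * (measure lebesgue E + 1))"
      have "?X \<le> l * measure lebesgue E"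
        using key[of l] X True m by (auto simp: l_def)
      also have "\<dots> = ?X * (measure lebesgue E / (2 * (measure lebesgue E + 1)))"
        by (simp add: l_def)
      also have "\<dots> < ?X * 1"
      proof (intro mult_strict_left_mono X)
        have "y / (2 * (y + 1)) < 1" if "0 \<le> y" for y :: real
          using that by (simp add: divide_less_eq_1)
        then show "measure lebesgue E / (2 * (measure lebesgue E + 1)) < 1"
          by (simp only: m)
      qed
      finally show False by simp
    qed
    then show ?thesis
      using mult_nonneg_nonneg[OF _ Lq_norm_nonneg[of E q v], of "measure lebesgue E + 1"] m
      by (meson add_nonneg_nonneg order_trans zero_le_one)
  qed
qed

lemma Lq_scale:
  assumes "v \<in> Lq S q" shows "(\<lambda>x. c * v x) \<in> Lq S q"
proof -
  have "(\<lambda>x. c * (indicator S x *\<^sub>R v x)) \<in> borel_measurable lebesgue"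
    using LqD(1)[OF assms] unfolding set_borel_measurable_def by (intro borel_measurable_times) auto
  then show ?thesis
    using LqD(2)[OF assms]
    unfolding Lq_def set_borel_measurable_def by (auto simp: abs_mult powr_mult mult.left_commute)
qed

lemma Lq_diff:
  assumes v: "v \<in> Lq S q" and w: "w \<in> Lq S q" and q: "0 \<le> q"
  shows "(\<lambda>x. v x - w x) \<in> Lq S q"
proof -
  have "(\<lambda>x. (indicator S x *\<^sub>R v x) - (indicator S x *\<^sub>R w x)) \<in> borel_measurable lebesgue"
    using LqD(1)[OF v] LqD(1)[OF w] unfolding set_borel_measurable_def by (intro borel_measurable_diff)
  then have m: "set_borel_measurable lebesgue S (\<lambda>x. v x - w x)"
    unfolding set_borel_measurable_def by (simp add: right_diff_distrib)
  have m2: "set_borel_measurable lebesgue S (\<lambda>x. \<bar>v x - w x\<bar> powr q)"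
  proof -
    have "(\<lambda>x. indicator {x. indicator S x *\<^sub>R (v x - w x) \<noteq> 0} x * (\<bar>indicator S x *\<^sub>R (v x - w x)\<bar> powr q)) \<in> borel_measurable lebesgue"
      using m unfolding set_borel_measurable_def by measurable
    moreover have "(\<lambda>x. indicator {x. indicator S x *\<^sub>R (v x - w x) \<noteq> 0} x * (\<bar>indicator S x *\<^sub>R (v x - w x)\<bar> powr q)) =
        (\<lambda>x. indicator S x *\<^sub>R (\<bar>v x - w x\<bar> powr q))"
      by (auto simp: indicator_def fun_eq_iff)
    ultimately show ?thesis unfolding set_borel_measurable_def by simp
  qed
  have "set_integrable lebesgue S (\<lambda>x. \<bar>v x - w x\<bar> powr q)"
  proof (rule set_integrable_bound)
    show "set_integrable lebesgue S (\<lambda>x. 2 powr q * (\<bar>v x\<bar> powr q + \<bar>w x\<bar> powr q))"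
      using LqD(2)[OF v] LqD(2)[OF w] by (intro set_integrable_mult_right set_integral_add)
    have "\<bar>y - z\<bar> powr q \<le> 2 powr q * (\<bar>y\<bar> powr q + \<bar>z\<bar> powr q)" for y z :: real
    proof -
      have "\<bar>y - z\<bar> powr q \<le> (2 * max \<bar>y\<bar> \<bar>z\<bar>) powr q"
        using q by (intro powr_mono2) auto
      also have "\<dots> = 2 powr q * (max \<bar>y\<bar> \<bar>z\<bar>) powr q"
        by (simp add: powr_mult)
      also have "\<dots> \<le> 2 powr q * (\<bar>y\<bar> powr q + \<bar>z\<bar> powr q)"
        by (intro mult_left_mono) (auto simp: max_def)
      finally show ?thesis .
    qed
    then show "AE x in lebesgue. x \<in> S \<longrightarrow> norm (\<bar>v x - w x\<bar> powr q) \<le>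
        norm (2 powr q * (\<bar>v x\<bar> powr q + \<bar>w x\<bar> powr q))"
      by (auto intro!: AE_I2 order_trans[OF _ abs_ge_self])
  qed (rule m2)
  then show ?thesis
    unfolding Lq_def using m by simp
qed

lemma Lq_sum:
  assumes "finite A" "\<And>v. v \<in> A \<Longrightarrow> f v \<in> Lq S q" "0 < q"
  shows "(\<lambda>x. \<Sum>v\<in>A. f v x) \<in> Lq S q"
  using assms
proof (induction A rule: finite_induct)
  case empty
  then show ?case by (auto simp: Lq_def set_borel_measurable_def set_integrable_def)
next
  case (insert v A)
  have "(\<lambda>x. f v x - (-1) * (\<Sum>v\<in>A. f v x)) \<in> Lq S q"
    using insert by (intro Lq_diff Lq_scale) auto
  then show ?case using insert by simp
qed

text \<open>Integration against a continuous weight is a linear functional bounded in the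
  \<open>Lq\<close> norm. It converts statements about curves in \<open>Lq E q\<close> into
  statements about real functions of time.\<close>

lemma Lq_pairing:
  fixes v w :: "real^'n \<Rightarrow> real"
  assumes E: "compact E" and q: "1 \<le> q" and v: "v \<in> Lq E q" and w: "continuous_on E w"
  shows "set_integrable lebesgue E (\<lambda>x. v x * w x)"
    and "\<lbrakk>0 \<le> B; \<And>x. x \<in> E \<Longrightarrow> \<bar>w x\<bar> \<le> B\<rbrakk> \<Longrightarrow>
      \<bar>LINT x:E|lebesgue. v x * w x\<bar> \<le> B * ((measure lebesgue E + 1) * Lq_norm E q v)"
proof -
  note Em = lmeasurable_compact[OF E]
  note vi = Lq_imp_integrable[OF Em q v]
  show vw: "set_integrable lebesgue E (\<lambda>x. v x * w x)"
    by (rule set_integrable_mult_continuous[OF vi(1) E w])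
  assume B: "0 \<le> B" "\<And>x. x \<in> E \<Longrightarrow> \<bar>w x\<bar> \<le> B"
  have "\<bar>LINT x:E|lebesgue. v x * w x\<bar> \<le> (LINT x:E|lebesgue. \<bar>v x * w x\<bar>)"
    unfolding set_lebesgue_integral_def
    by (rule order_trans[OF integral_abs_bound]) (simp add: abs_mult)
  also have "\<dots> \<le> (LINT x:E|lebesgue. B * \<bar>v x\<bar>)"
  proof (rule set_integral_mono)
    show "set_integrable lebesgue E (\<lambda>x. \<bar>v x * w x\<bar>)" using vw by (rule set_integrable_abs)
    show "set_integrable lebesgue E (\<lambda>x. B * \<bar>v x\<bar>)"
      using vi(1) by (intro set_integrable_mult_right set_integrable_abs) auto
    show "\<bar>v x * w x\<bar> \<le> B * \<bar>v x\<bar>" if "x \<in> E" for x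
      using mult_right_mono[OF B(2)[OF that], of "\<bar>v x\<bar>"] by (simp add: abs_mult mult.commute)
  qed
  also have "\<dots> = B * (LINT x:E|lebesgue. \<bar>v x\<bar>)" by simp
  also have "\<dots> \<le> B * ((measure lebesgue E + 1) * Lq_norm E q v)"
    using vi(2) B(1) by (rule mult_left_mono)
  finally show "\<bar>LINT x:E|lebesgue. v x * w x\<bar> \<le> B * ((measure lebesgue E + 1) * Lq_norm E q v)" .
qed

lemma Lq_pairing_diff:
  fixes v w :: "real^'n \<Rightarrow> real"
  assumes E: "compact E" and q: "1 \<le> q" and v: "v \<in> Lq E q" "v' \<in> Lq E q" and w: "continuous_on E w"
    and B: "0 \<le> B" "\<And>x. x \<in> E \<Longrightarrow> \<bar>w x\<bar> \<le> B"
  shows "\<bar>(LINT x:E|lebesgue. v x * w x) - (LINT x:E|lebesgue. v' x * w x)\<bar>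
    \<le> B * ((measure lebesgue E + 1) * Lq_norm E q (\<lambda>x. v x - v' x))"
proof -
  have "(LINT x:E|lebesgue. v x * w x) - (LINT x:E|lebesgue. v' x * w x) =
      (LINT x:E|lebesgue. (v x - v' x) * w x)"
    unfolding left_diff_distrib
    using Lq_pairing(1)[OF E q v(1) w] Lq_pairing(1)[OF E q v(2) w] by (simp add: set_integral_diff)
  then show ?thesis
    using Lq_pairing(2)[OF E q Lq_diff[OF v] w B] q by simp
qed

lemma bounded_family:
  fixes w :: "real \<Rightarrow> 'a::metric_space \<Rightarrow> real"
  assumes "continuous_on ({a..b} \<times> E) (\<lambda>(t, x). w t x)" "compact E"
  obtains B where "0 < B" "\<And>t x. t \<in> {a..b} \<Longrightarrow> x \<in> E \<Longrightarrow> \<bar>w t x\<bar> \<le> B"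
proof -
  have "bounded ((\<lambda>(t, x). w t x) ` ({a..b} \<times> E))"
    using assms by (intro compact_imp_bounded compact_continuous_image compact_Times) auto
  then obtain B where "B > 0" "\<forall>y\<in>(\<lambda>(t, x). w t x) ` ({a..b} \<times> E). norm y \<le> B"
    unfolding bounded_pos by auto
  then show ?thesis using that[of B] by fastforce
qed

section \<open>Pairing measurable curves and Bochner integrals\<close>

text \<open>Only the summand \<open>v = s t\<close> survives. On the right the weight is paired with
  finitely many fixed functions, so dependence on time enters through indicators and through
  \<open>w\<close> alone.\<close>

lemma simple_into_pairing:
  fixes s :: "real \<Rightarrow> real^'n \<Rightarrow> real"
  assumes s: "simple_into {a..b} V s" and t: "t \<in> {a..b}"
  shows "(LINT x:E|lebesgue. s t x * w t x) =
    (\<Sum>v\<in>s ` {a..b}. indicator {t \<in> {a..b}. s t = v} t * (LINT x:E|lebesgue. v x * w t x))"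
proof -
  have "(\<Sum>v\<in>s ` {a..b}. indicator {t \<in> {a..b}. s t = v} t * (LINT x:E|lebesgue. v x * w t x)) =
      (\<Sum>v\<in>s ` {a..b}. if v = s t then (LINT x:E|lebesgue. v x * w t x) else 0)"
    using t by (intro sum.cong) (auto simp: indicator_def)
  also have "\<dots> = (LINT x:E|lebesgue. s t x * w t x)"
    using s t unfolding simple_into_def by (subst sum.delta) auto
  finally show ?thesis by simp
qed

text \<open>Strong measurability supplies simple curves converging in norm at almost every time;
  their pairings are finite sums of indicators times continuous functions and converge by the bound
  of \<open>Lq_pairing_diff\<close>.\<close>

lemma pairing_measurable:
  fixes F w :: "real \<Rightarrow> real^'n \<Rightarrow> real"
  assumes E: "compact E" and q: "1 \<le> q"
    and F: "strongly_measurable {a..b} (Lq E q) (Lq_norm E q) F"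
    and w: "continuous_on ({a..b} \<times> E) (\<lambda>(t, x). w t x)"
  shows "(\<lambda>t. LINT x:E|lebesgue. F t x * w t x) \<in> borel_measurable (lebesgue_on {a..b})"
proof -
  note Em = lmeasurable_compact[OF E]
  obtain B where B: "0 < B" "\<And>t x. t \<in> {a..b} \<Longrightarrow> x \<in> E \<Longrightarrow> \<bar>w t x\<bar> \<le> B"
    using bounded_family[OF w E] by metis
  obtain s where s: "\<And>k. simple_into {a..b} (Lq E q) (s k)"
    and F_ae: "AE t in lebesgue_on {a..b}. F t \<in> Lq E q"
    and lim: "AE t in lebesgue_on {a..b}. (\<lambda>k. Lq_norm E q (\<lambda>x. F t x - s k t x)) \<longlonglongrightarrow> 0"
    using F unfolding strongly_measurable_def by blast
  define h where "h t = (LINT x:E|lebesgue. F t x * w t x)" for t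
  define hk where "hk k t = (LINT x:E|lebesgue. s k t x * w t x)" for k t
  have meas: "(\<lambda>t. indicator {a..b} t *\<^sub>R hk k t) \<in> borel_measurable lebesgue" for k
  proof -
    have "(\<lambda>t. \<Sum>v\<in>s k ` {a..b}. indicator {t \<in> {a..b}. s k t = v} t *
        (indicator {a..b} t *\<^sub>R (LINT x:E|lebesgue. v x * w t x))) \<in> borel_measurable lebesgue"
    proof (intro borel_measurable_sum borel_measurable_times borel_measurable_indicator)
      fix v assume "v \<in> s k ` {a..b}"
      then have v: "v \<in> Lq E q" using s[of k] unfolding simple_into_def by blast
      show "{t \<in> {a..b}. s k t = v} \<in> sets lebesgue"
        using s[of k] unfolding simple_into_def by blast
      have "continuous_on {a..b} (\<lambda>t. LINT x:E|lebesgue. v x * w t x)"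
        using Em by (intro continuous_on_weighted_integral[OF w E Lq_imp_integrable(1)[OF Em q v]]) (auto simp: fmeasurable_def)
      then show "(\<lambda>t. indicator {a..b} t *\<^sub>R (LINT x:E|lebesgue. v x * w t x)) \<in> borel_measurable lebesgue"
        by (rule set_borel_measurable_continuous[unfolded set_borel_measurable_def]) simp
    qed
    also have "(\<lambda>t. \<Sum>v\<in>s k ` {a..b}. indicator {t \<in> {a..b}. s k t = v} t *
        (indicator {a..b} t *\<^sub>R (LINT x:E|lebesgue. v x * w t x))) = (\<lambda>t. indicator {a..b} t *\<^sub>R hk k t)"
      unfolding hk_def by (auto simp: fun_eq_iff indicator_def simple_into_pairing[OF s])
    finally show ?thesis .
  qed
  have conv: "AE t in lebesgue_on {a..b}. (\<lambda>k. hk k t) \<longlonglongrightarrow> h t"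
    using F_ae lim AE_space
  proof eventually_elim
    case (elim t)
    then have t: "t \<in> {a..b}" by simp
    have "norm (hk k t - h t) \<le> B * ((measure lebesgue E + 1) * Lq_norm E q (\<lambda>x. F t x - s k t x))" for k
    proof -
      have "s k t \<in> Lq E q" using s[of k] t unfolding simple_into_def by blast
      from Lq_pairing_diff[OF E q elim(1) this slice_continuous[OF w t] _ B(2)[OF t]]
      show ?thesis using B(1) unfolding h_def hk_def by (simp add: abs_minus_commute)
    qed
    then have le: "\<forall>k. norm (hk k t - h t) \<le> B * ((measure lebesgue E + 1) * Lq_norm E q (\<lambda>x. F t x - s k t x))"
      by blast
    have "(\<lambda>k. B * ((measure lebesgue E + 1) * Lq_norm E q (\<lambda>x. F t x - s k t x))) \<longlonglongrightarrow> 0"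
      using tendsto_mult_left[OF tendsto_mult_left[OF elim(2)], of B "measure lebesgue E + 1"]
      by (simp only: mult_zero_right)
    from Lim_null_comparison[OF always_eventually[OF le] this] show ?case
      by (simp only: LIM_zero_iff)
  qed
  \<comment> \<open>Convergence is known almost everywhere only. \<open>lim\<close> is total and
    measurable, and it agrees almost everywhere with the pairing.\<close>
  have "(\<lambda>t. lim (\<lambda>k. indicator {a..b} t *\<^sub>R hk k t)) \<in> borel_measurable lebesgue"
    by (intro borel_measurable_lim_metric meas)
  moreover have "AE t in lebesgue. lim (\<lambda>k. indicator {a..b} t *\<^sub>R hk k t) = indicator {a..b} t *\<^sub>R h t"
  proof -
    have "AE t in lebesgue. t \<in> {a..b} \<longrightarrow> (\<lambda>k. hk k t) \<longlonglongrightarrow> h t"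
      using conv by (subst (asm) AE_restrict_space_iff) auto
    then show ?thesis
    proof eventually_elim
      case (elim t)
      show ?case
        using limI[of "\<lambda>k. hk k t" "h t"] elim by (cases "t \<in> {a..b}") simp_all
    qed
  qed
  ultimately have "(\<lambda>t. indicator {a..b} t *\<^sub>R h t) \<in> borel_measurable lebesgue"
    by (rule borel_measurable_AE)
  then show ?thesis
    unfolding h_def by (subst borel_measurable_restrict_space_iff) auto
qed

text \<open>A bounded functional commutes with the Bochner integral: this is finite additivity for
  simple curves, and both sides pass to the limit under the bound
  \<open>c * Lq_norm\<close>.\<close>

lemma bochner_integral_pairing:
  fixes F :: "real \<Rightarrow> real^'n \<Rightarrow> real"
  assumes E: "compact E" and q: "1 \<le> q"
    and F: "has_bochner_integral_into {a..b} (Lq E q) (Lq_norm E q) F z"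
    and w: "continuous_on E w"
  shows "(LINT t:{a..b}|lebesgue. LINT x:E|lebesgue. F t x * w x) = (LINT x:E|lebesgue. z x * w x)"
proof -
  let ?M = "lebesgue_on {a..b}"
  have w': "continuous_on ({a..b} \<times> E) (\<lambda>(t, x). w x)"
    using w by (auto simp: case_prod_unfold intro!: continuous_on_compose2[OF w] continuous_intros)
  have "bounded (w ` E)"
    using w E by (intro compact_imp_bounded compact_continuous_image)
  then obtain B where B: "0 < B" "\<And>x. x \<in> E \<Longrightarrow> \<bar>w x\<bar> \<le> B"
    unfolding bounded_pos by auto
  define c where "c = B * (measure lebesgue E + 1)"
  have c: "c > 0" using B unfolding c_def by (auto intro!: mult_pos_pos simp: add_nonneg_pos)
  obtain s where Fm: "strongly_measurable {a..b} (Lq E q) (Lq_norm E q) F" and z: "z \<in> Lq E q"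
    and s: "\<And>k. simple_into {a..b} (Lq E q) (s k)"
    and lim: "(\<lambda>k. \<integral>\<^sup>+ t. ennreal (Lq_norm E q (\<lambda>x. F t x - s k t x)) \<partial>?M) \<longlonglongrightarrow> 0"
    and limz: "(\<lambda>k. Lq_norm E q (\<lambda>x. z x - simple_integral {a..b} (s k) x)) \<longlonglongrightarrow> 0"
    using F unfolding has_bochner_integral_into_def by blast
  define h where "h t = (LINT x:E|lebesgue. F t x * w x)" for t
  define hk where "hk k t = (LINT x:E|lebesgue. s k t x * w x)" for k t
  have F_ae: "AE t in ?M. F t \<in> Lq E q"
    using Fm unfolding strongly_measurable_def by blast
  have pair: "\<bar>(LINT x:E|lebesgue. v x * w x) - (LINT x:E|lebesgue. v' x * w x)\<bar> \<le> c * Lq_norm E q (\<lambda>x. v x - v' x)"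
    if "v \<in> Lq E q" "v' \<in> Lq E q" for v v'
    using Lq_pairing_diff[OF E q that w _ B(2)] B(1) unfolding c_def by (simp add: mult.assoc)
  have hm: "h \<in> borel_measurable ?M"
    unfolding h_def by (rule pairing_measurable[OF E q Fm w'])
  have sV: "v \<in> Lq E q" if "v \<in> s k ` {a..b}" for k v
    using s[of k] that unfolding simple_into_def by blast
  have fin: "finite (s k ` {a..b})" for k
    using s[of k] unfolding simple_into_def by blast
  have lm: "{t \<in> {a..b}. s k t = v} \<in> lmeasurable" for k v
  proof (rule bounded_set_imp_lmeasurable)
    show "bounded {t \<in> {a..b}. s k t = v}" by (rule bounded_subset[of "{a..b}"]) auto
    show "{t \<in> {a..b}. s k t = v} \<in> sets lebesgue"
      using s[of k] unfolding simple_into_def by blast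
  qed
  have lm': "{t \<in> {a..b}. s k t = v} \<in> sets lebesgue" "emeasure lebesgue {t \<in> {a..b}. s k t = v} < \<infinity>" for k v
    using lm[of k v] unfolding fmeasurable_def by auto
  have hk_eq: "indicator {a..b} t *\<^sub>R hk k t = (\<Sum>v\<in>s k ` {a..b}. indicator {t \<in> {a..b}. s k t = v} t *
        (LINT x:E|lebesgue. v x * w x))" for k t
    using simple_into_pairing[OF s[of k], where t = t and E = E and w = "\<lambda>t. w"] unfolding hk_def
    by (cases "t \<in> {a..b}") (auto simp: indicator_def)
  have hk_int: "integrable lebesgue (\<lambda>t. indicator {a..b} t *\<^sub>R hk k t)" for k
    unfolding hk_eq
    by (intro Bochner_Integration.integrable_sum integrable_mult_left integrable_real_indicator lm')
  then have hki: "integrable ?M (hk k)" for k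
    by (subst integrable_restrict_space) auto
  have si_Lq: "simple_integral {a..b} (s k) \<in> Lq E q" for k
    unfolding simple_integral_def using sV q by (intro Lq_sum fin Lq_scale) auto
  have hk_val: "(\<integral>t. hk k t \<partial>?M) = (LINT x:E|lebesgue. simple_integral {a..b} (s k) x * w x)" for k
  proof -
    have "(\<integral>t. hk k t \<partial>?M) = (\<integral>t. indicator {a..b} t *\<^sub>R hk k t \<partial>lebesgue)"
      by (subst integral_restrict_space) auto
    also have "\<dots> = (\<Sum>v\<in>s k ` {a..b}. measure lebesgue {t \<in> {a..b}. s k t = v} * (LINT x:E|lebesgue. v x * w x))"
      unfolding hk_eq
      by (subst Bochner_Integration.integral_sum) (intro integrable_mult_left integrable_real_indicator lm', simp)
    also have "\<dots> = (\<Sum>v\<in>s k ` {a..b}. LINT x:E|lebesgue. measure lebesgue {t \<in> {a..b}. s k t = v} * (v x * w x))"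
      by simp
    also have "\<dots> = (LINT x:E|lebesgue. \<Sum>v\<in>s k ` {a..b}. measure lebesgue {t \<in> {a..b}. s k t = v} * (v x * w x))"
    proof -
      have "set_integrable lebesgue E (\<lambda>x. measure lebesgue {t \<in> {a..b}. s k t = v} * (v x * w x))"
        if "v \<in> s k ` {a..b}" for v
        by (rule set_integrable_mult_right[OF Lq_pairing(1)[OF E q sV[OF that] w]])
      then show ?thesis
        unfolding set_lebesgue_integral_def scaleR_sum_right set_integrable_def
        by (subst Bochner_Integration.integral_sum) auto
    qed
    also have "\<dots> = (LINT x:E|lebesgue. simple_integral {a..b} (s k) x * w x)"
      unfolding simple_integral_def by (simp add: sum_distrib_right mult.assoc)
    finally show ?thesis .
  qed
  \<comment> \<open>Dividing by \<open>c\<close> on the left avoids moving a constant out of the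
    right-hand integral, whose integrand is not known to be measurable.\<close>
  have nn: "(\<integral>\<^sup>+ t. ennreal (\<bar>h t - hk k t\<bar> / c) \<partial>?M) \<le> (\<integral>\<^sup>+ t. ennreal (Lq_norm E q (\<lambda>x. F t x - s k t x)) \<partial>?M)" for k
  proof (rule nn_integral_mono_AE)
    show "AE t in ?M. ennreal (\<bar>h t - hk k t\<bar> / c) \<le> ennreal (Lq_norm E q (\<lambda>x. F t x - s k t x))"
      using F_ae AE_space
    proof eventually_elim
      case (elim t)
      then have "s k t \<in> Lq E q" by (intro sV[OF imageI]) auto
      then have "\<bar>h t - hk k t\<bar> \<le> c * Lq_norm E q (\<lambda>x. F t x - s k t x)"
        unfolding h_def hk_def using elim by (intro pair)
      then show ?case
        using c by (intro ennreal_leI) (simp add: field_simps)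
    qed
  qed
  have dm: "(\<lambda>t. (h t - hk k t) / c) \<in> borel_measurable ?M" for k
    using hm borel_measurable_integrable[OF hki] by (intro borel_measurable_divide borel_measurable_diff) auto
  have lim0: "(\<lambda>k. \<integral>\<^sup>+ t. ennreal (\<bar>h t - hk k t\<bar> / c) \<partial>?M) \<longlonglongrightarrow> 0"
    by (rule tendsto_sandwich[OF _ _ tendsto_const lim]) (use nn in auto)
  then have "\<forall>\<^sub>F k in sequentially. (\<integral>\<^sup>+ t. ennreal (\<bar>h t - hk k t\<bar> / c) \<partial>?M) < 1"
    by (rule order_tendstoD) simp
  then obtain k0 where k0: "\<And>k. k \<ge> k0 \<Longrightarrow> (\<integral>\<^sup>+ t. ennreal (\<bar>h t - hk k t\<bar> / c) \<partial>?M) < 1"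
    unfolding eventually_sequentially by blast
  \<comment> \<open>The approximation error is known to be finite only from some index on; one such
    index already shows that \<open>h\<close> is integrable.\<close>
  have di: "integrable ?M (\<lambda>t. (h t - hk k t) / c)" if "k \<ge> k0" for k
  proof (rule integrableI_bounded[OF dm])
    show "(\<integral>\<^sup>+ t. ennreal (norm ((h t - hk k t) / c)) \<partial>?M) < \<infinity>"
      using k0[OF that] c by (simp add: order_less_trans[OF _ ennreal_one_less_top])
  qed
  have hi: "integrable ?M h"
  proof -
    have "integrable ?M (\<lambda>t. c * ((h t - hk k0 t) / c) + hk k0 t)"
      by (intro Bochner_Integration.integrable_add integrable_mult_right di hki) auto
    then show ?thesis using c by simp
  qed
  have le: "\<bar>(\<integral>t. h t \<partial>?M) - (\<integral>t. hk k t \<partial>?M)\<bar> \<le> c * (\<integral>t. \<bar>h t - hk k t\<bar> / c \<partial>?M)" for k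
  proof -
    have "(\<integral>t. h t \<partial>?M) - (\<integral>t. hk k t \<partial>?M) = (\<integral>t. h t - hk k t \<partial>?M)"
      using hi hki by simp
    also have "\<bar>\<dots>\<bar> \<le> (\<integral>t. \<bar>h t - hk k t\<bar> \<partial>?M)"
      by (rule integral_abs_bound)
    finally show ?thesis using c by simp
  qed
  have "(\<integral>\<^sup>+ t. ennreal (\<bar>h t - hk k t\<bar> / c) \<partial>?M) = ennreal (\<integral>t. \<bar>h t - hk k t\<bar> / c \<partial>?M)" for k
    using hi hki c by (intro nn_integral_eq_integral) auto
  then have "(\<lambda>k. \<integral>t. \<bar>h t - hk k t\<bar> / c \<partial>?M) \<longlonglongrightarrow> 0"
    using lim0 c by (simp add: ennreal_tendsto_0_iff integral_nonneg_AE)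
  from tendsto_mult_left[OF this, of c]
  have "(\<lambda>k. (\<integral>t. h t \<partial>?M) - (\<integral>t. hk k t \<partial>?M)) \<longlonglongrightarrow> 0"
    using Lim_null_comparison[OF always_eventually, of "\<lambda>k. (\<integral>t. h t \<partial>?M) - (\<integral>t. hk k t \<partial>?M)"
      "\<lambda>k. c * (\<integral>t. \<bar>h t - hk k t\<bar> / c \<partial>?M)"] le by simp
  moreover have "(\<lambda>k. (LINT x:E|lebesgue. z x * w x) - (\<integral>t. hk k t \<partial>?M)) \<longlonglongrightarrow> 0"
  proof (rule Lim_null_comparison[OF always_eventually])
    show "\<forall>k. norm ((LINT x:E|lebesgue. z x * w x) - (\<integral>t. hk k t \<partial>?M)) \<le>
        c * Lq_norm E q (\<lambda>x. z x - simple_integral {a..b} (s k) x)"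
      unfolding hk_val using pair[OF z si_Lq] by auto
    show "(\<lambda>k. c * Lq_norm E q (\<lambda>x. z x - simple_integral {a..b} (s k) x)) \<longlonglongrightarrow> 0"
      using tendsto_mult_left[OF limz, of c] by simp
  qed
  ultimately have "(\<lambda>k. (\<integral>t. h t \<partial>?M) - (LINT x:E|lebesgue. z x * w x)) \<longlonglongrightarrow> 0"
    using tendsto_diff[of "\<lambda>k. (\<integral>t. h t \<partial>?M) - (\<integral>t. hk k t \<partial>?M)" 0 sequentially
      "\<lambda>k. (LINT x:E|lebesgue. z x * w x) - (\<integral>t. hk k t \<partial>?M)" 0] by simp
  then have "(\<integral>t. h t \<partial>?M) = (LINT x:E|lebesgue. z x * w x)"
    by (simp add: LIMSEQ_const_iff)
  then show ?thesis
    unfolding h_def by (subst (asm) integral_restrict_space) (auto simp: set_lebesgue_integral_def)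
qed

section \<open>Weak time derivatives\<close>

lemma set_lebesgue_integral_combine:
  fixes g :: "real \<Rightarrow> real"
  assumes "set_integrable lebesgue {a..c} g" "a \<le> b" "b \<le> c"
  shows "(LINT r:{a..c}|lebesgue. g r) = (LINT r:{a..b}|lebesgue. g r) + (LINT r:{b..c}|lebesgue. g r)"
proof -
  have "set_integrable lebesgue {a..b} g" "set_integrable lebesgue {b..c} g"
    using assms by (auto intro: set_integrable_subset)
  then show ?thesis
    using assms Henstock_Kurzweil_Integration.integral_combine[OF assms(2,3), of g]
    by (simp add: set_lebesgue_integral_eq_integral)
qed

lemma set_integral_abs_le:
  fixes f g :: "real \<Rightarrow> real"
  assumes "set_integrable lebesgue S f" "set_integrable lebesgue S g"
    and "AE r in lebesgue. r \<in> S \<longrightarrow> \<bar>f r\<bar> \<le> g r"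
  shows "\<bar>LINT r:S|lebesgue. f r\<bar> \<le> (LINT r:S|lebesgue. g r)"
proof -
  have "\<bar>LINT r:S|lebesgue. f r\<bar> \<le> (LINT r|lebesgue. \<bar>indicator S r *\<^sub>R f r\<bar>)"
    unfolding set_lebesgue_integral_def by (rule integral_abs_bound)
  also have "\<dots> \<le> (LINT r:S|lebesgue. g r)"
    unfolding set_lebesgue_integral_def
  proof (rule integral_mono_AE)
    show "integrable lebesgue (\<lambda>r. \<bar>indicator S r *\<^sub>R f r\<bar>)"
      using assms(1) unfolding set_integrable_def by (rule integrable_abs)
    show "integrable lebesgue (\<lambda>r. indicator S r *\<^sub>R g r)"
      using assms(2) unfolding set_integrable_def .
    show "AE r in lebesgue. \<bar>indicator S r *\<^sub>R f r\<bar> \<le> indicator S r *\<^sub>R g r"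
      using assms(3) by eventually_elim (auto simp: indicator_def)
  qed
  finally show ?thesis .
qed

text \<open>The kernel is nonnegative, lives on \<open>[s, s + 1 / n]\<close> and has mass one on
  \<open>{a..b}\<close> once \<open>1 / n < b - s\<close>. It looks only to the right of
  \<open>s\<close>, which is why \<open>s = a\<close> is allowed and \<open>s = b\<close> is
  not.\<close>

lemma approximate_identity:
  fixes f S S' :: "real \<Rightarrow> real"
  assumes S: "\<And>x. (S has_real_derivative S' x) (at x)" "continuous_on UNIV S'" "\<And>x. 0 \<le> S' x"
      "\<And>x. x \<le> 0 \<Longrightarrow> S x = 0" "\<And>x. x \<ge> 1 \<Longrightarrow> S x = 1" "\<And>x. x \<le> 0 \<or> 1 \<le> x \<Longrightarrow> S' x = 0"
    and f: "continuous_on {a..b} f" and s: "a \<le> s" "s < b"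
  shows "(\<lambda>n. LINT r:{a..b}|lebesgue. (real n * S' (real n * r + - real n * s)) * f r) \<longlonglongrightarrow> f s"
proof (rule LIMSEQ_I)
  fix e :: real assume e: "e > 0"
  obtain d where d: "d > 0" "\<And>r. r \<in> {a..b} \<Longrightarrow> \<bar>r - s\<bar> < d \<Longrightarrow> \<bar>f r - f s\<bar> < e / 2"
    using f s e unfolding continuous_on_iff dist_real_def
    by (metis atLeastAtMost_iff half_gt_zero less_eq_real_def)
  \<comment> \<open>The kernel must fit both into the modulus \<open>d\<close> of \<open>f\<close>
    at \<open>s\<close> and into \<open>{a..b}\<close>, so that no mass is lost at
    \<open>b\<close>.\<close>
  obtain N where N: "N > 0" "1 / real N < min d (b - s)"
    using reals_Archimedean[of "min d (b - s)"] d s by (metis diff_gt_0_iff_gt inverse_eq_divide min_less_iff_conj zero_less_Suc)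
  have "\<bar>(LINT r:{a..b}|lebesgue. (real n * S' (real n * r + - real n * s)) * f r) - f s\<bar> < e" if n: "n \<ge> N" for n
  proof -
    define D where "D r = real n * S' (real n * r + - real n * s)" for r
    have "1 / real n \<le> 1 / real N" using n N by (intro divide_left_mono) auto
    then have n1: "1 / real n < d" "1 / real n < b - s" "n > 0" using N n by auto
    have D_cont: "continuous_on A D" for A
      unfolding D_def by (intro continuous_intros continuous_on_compose2[OF S(2)]) auto
    have Di: "set_integrable lebesgue {a..b} D" and Dfi: "set_integrable lebesgue {a..b} (\<lambda>r. D r * f r)"
      using f D_cont by (auto intro!: compact_set_integrable_lebesgue continuous_intros)
    have D_nonneg: "D r \<ge> 0" for r unfolding D_def using S(3) by simp
    have "(D has_integral (S (real n * b + - real n * s) - S (real n * a + - real n * s))) {a..b}"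
    proof (rule fundamental_theorem_of_calculus)
      fix r assume "r \<in> {a..b}"
      have "((\<lambda>r. S (real n * r + - real n * s)) has_real_derivative S' (real n * r + - real n * s) * real n) (at r)"
        by (rule DERIV_chain2[OF S(1)]) (auto intro!: derivative_eq_intros)
      then show "((\<lambda>r. S (real n * r + - real n * s)) has_vector_derivative D r) (at r within {a..b})"
        unfolding D_def by (simp add: has_real_derivative_iff_has_vector_derivative mult.commute has_vector_derivative_at_within)
    qed (use s in simp)
    moreover have "1 \<le> real n * b + - real n * s"
      using n1 by (simp add: field_simps)
    moreover have "real n * a + - real n * s \<le> 0"
      using s by (simp add: mult_left_mono)
    ultimately have "integral {a..b} D = 1"
      using S(4,5) by (simp add: integral_unique)
    then have D1: "(LINT r:{a..b}|lebesgue. D r) = 1"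
      using Di by (simp add: set_lebesgue_integral_eq_integral)
    have bound: "\<bar>D r * (f r - f s)\<bar> \<le> D r * (e / 2)" if r: "r \<in> {a..b}" for r
    proof (cases "D r = 0")
      case False
      then have "0 < real n * r + - real n * s" "real n * r + - real n * s < 1"
        using S(6)[of "real n * r + - real n * s"] unfolding D_def by fastforce+
      then have "0 < real n * (r - s)" "r - s < 1 / real n"
        using n1 by (simp_all add: field_simps)
      then have "\<bar>r - s\<bar> < d"
        using n1 by (auto simp: zero_less_mult_iff)
      from d(2)[OF r this] show ?thesis
        unfolding abs_mult using D_nonneg[of r] by (intro mult_mono) auto
    qed simp
    have "(LINT r:{a..b}|lebesgue. D r * f r) - f s = (LINT r:{a..b}|lebesgue. D r * f r) - (LINT r:{a..b}|lebesgue. D r * f s)"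
      using D1 by simp
    also have "\<dots> = (LINT r:{a..b}|lebesgue. D r * (f r - f s))"
      unfolding right_diff_distrib using Di Dfi by (subst set_integral_diff(2)) auto
    also have "\<bar>\<dots>\<bar> \<le> (LINT r:{a..b}|lebesgue. D r * (e / 2))"
      using bound D_cont f
      by (intro set_integral_abs_le compact_set_integrable_lebesgue AE_I2) (auto intro!: continuous_intros)
    also have "\<dots> = e / 2"
      using D1 by simp
    finally show ?thesis
      using e unfolding D_def by linarith
  qed
  then show "\<exists>N. \<forall>n\<ge>N. norm ((LINT r:{a..b}|lebesgue. (real n * S' (real n * r + - real n * s)) * f r) - f s) < e"
    by auto
qed

text \<open>The test functions are smoothed indicators of \<open>(s, t]\<close>, differences of two
  steps. Their derivatives are differences of two one-sided kernels and reproduce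
  \<open>f s - f t\<close> in the limit.\<close>

lemma weak_derivative_increment:
  fixes f k :: "real \<Rightarrow> real"
  assumes f: "continuous_on {a..b} f" and k: "set_integrable lebesgue {a..b} k"
    and weak: "\<And>\<eta>. \<eta> \<in> Cc_infinity {a<..<b} \<Longrightarrow>
      (LINT r:{a..b}|lebesgue. deriv \<eta> r * f r) = - (LINT r:{a..b}|lebesgue. \<eta> r * k r)"
    and st: "a < s" "s \<le> t" "t < b"
  shows "f t - f s = (LINT r:{s..t}|lebesgue. k r)"
proof -
  obtain S S' :: "real \<Rightarrow> real" where Sk: "\<And>k. C_k k S" and S: "\<And>x. (S has_real_derivative S' x) (at x)"
      "continuous_on UNIV S'" "\<And>x. 0 \<le> S' x"
      "\<And>x. x \<le> 0 \<Longrightarrow> S x = 0" "\<And>x. x \<ge> 1 \<Longrightarrow> S x = 1" "\<And>x. x \<le> 0 \<or> 1 \<le> x \<Longrightarrow> S' x = 0"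
      and S01: "\<And>x. 0 \<le> S x" "\<And>x. S x \<le> 1"
    using smooth_step_exists by metis
  define \<eta> where "\<eta> n r = S (real n * r + - real n * s) + (-1) * S (real n * r + - real n * t)" for n r
  define D where "D c n r = real n * S' (real n * r + - real n * c)" for c n r
  have der: "(\<eta> n has_real_derivative D s n r - D t n r) (at r)" for n r
  proof -
    have "((\<lambda>r. S (real n * r + - real n * c)) has_real_derivative S' (real n * r + - real n * c) * real n) (at r)" for c
      by (rule DERIV_chain2[OF S(1)]) (auto intro!: derivative_eq_intros)
    from DERIV_add[OF this[of s] DERIV_cmult[OF this[of t], of "-1"]] show ?thesis
      unfolding \<eta>_def[abs_def] D_def by (simp add: mult.commute)
  qed
  have small: "\<eta> n r = 0" if "r \<le> s" for n r
  proof -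
    have "real n * r \<le> real n * s" "real n * r \<le> real n * t"
      using that st by (auto intro: mult_left_mono)
    then show ?thesis by (simp add: \<eta>_def S)
  qed
  \<comment> \<open>The second step finishes at \<open>t + 1 / n\<close>, which must stay below
    \<open>b\<close> for the test function to be admissible.\<close>
  obtain N where N: "N > 0" "1 / real N < b - t"
    using reals_Archimedean[of "b - t"] st by (metis diff_gt_0_iff_gt inverse_eq_divide zero_less_Suc)
  have large: "\<eta> n r = 0" if "n \<ge> N" "r \<ge> t + 1 / real N" for n r
  proof -
    have "1 / real n \<le> 1 / real N" using that N by (intro divide_left_mono) auto
    then have "1 / real n \<le> r - t" "1 / real n \<le> r - s" using that st by linarith+
    then have "1 \<le> real n * r + - real n * t" "1 \<le> real n * r + - real n * s"
      using that N by (simp_all add: field_simps)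
    then show ?thesis by (simp add: \<eta>_def S)
  qed
  have Cc: "\<eta> n \<in> Cc_infinity {a<..<b}" if n: "n \<ge> N" for n
  proof -
    have "C_k k (\<eta> n)" for k
      unfolding \<eta>_def[abs_def] by (intro C_k_add C_k_mult C_k_const C_k_affine Sk)
    moreover have sub: "closure {r. \<eta> n r \<noteq> 0} \<subseteq> {s..t + 1 / real N}"
    proof (intro closure_minimal closed_atLeastAtMost subsetI)
      fix r assume "r \<in> {r. \<eta> n r \<noteq> 0}"
      then have "\<not> r \<le> s" "\<not> r \<ge> t + 1 / real N"
        using small[of r n] large[OF n, of r] by auto
      then show "r \<in> {s..t + 1 / real N}" by simp
    qed
    moreover have "compact (closure {r. \<eta> n r \<noteq> 0})"
      using sub by (meson bounded_closed_interval bounded_subset closed_closure compact_eq_bounded_closed)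
    ultimately show ?thesis
      unfolding Cc_infinity_def using st N by fastforce
  qed
  have D_cont: "continuous_on A (D c n)" for A c n
    unfolding D_def[abs_def] by (intro continuous_intros continuous_on_compose2[OF S(2)]) auto
  have "(\<lambda>n. (LINT r:{a..b}|lebesgue. D s n r * f r) - (LINT r:{a..b}|lebesgue. D t n r * f r)) \<longlonglongrightarrow> f s - f t"
    unfolding D_def using st by (intro tendsto_diff approximate_identity[OF S f]) auto
  moreover have "(LINT r:{a..b}|lebesgue. D s n r * f r) - (LINT r:{a..b}|lebesgue. D t n r * f r) =
      (LINT r:{a..b}|lebesgue. deriv (\<eta> n) r * f r)" for n
  proof -
    have "set_integrable lebesgue {a..b} (\<lambda>r. D c n r * f r)" for c
      using f D_cont by (intro compact_set_integrable_lebesgue continuous_intros) auto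
    then show ?thesis
      unfolding DERIV_imp_deriv[OF der] left_diff_distrib by (simp add: set_integral_diff)
  qed
  ultimately have 1: "(\<lambda>n. LINT r:{a..b}|lebesgue. deriv (\<eta> n) r * f r) \<longlonglongrightarrow> f s - f t"
    by simp
  have \<eta>_cont: "continuous_on A (\<eta> n)" for A n
    by (intro continuous_at_imp_continuous_on ballI DERIV_isCont[OF der])
  have 2: "(\<lambda>n. LINT r:{a..b}|lebesgue. \<eta> n r * k r) \<longlonglongrightarrow> (LINT r:{s..t}|lebesgue. k r)"
    unfolding set_lebesgue_integral_def
  proof (rule integral_dominated_convergence)
    show "integrable lebesgue (\<lambda>r. norm (indicator {a..b} r *\<^sub>R k r))"
      using k unfolding set_integrable_def by (rule integrable_norm)
    have "set_integrable lebesgue {s..t} k"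
      using st by (intro set_integrable_subset[OF k]) auto
    then show "(\<lambda>r. indicator {s..t} r *\<^sub>R k r) \<in> borel_measurable lebesgue"
      unfolding set_integrable_def by (rule borel_measurable_integrable)
    show "(\<lambda>r. indicator {a..b} r *\<^sub>R (\<eta> n r * k r)) \<in> borel_measurable lebesgue" for n
      using set_integrable_mult_continuous[OF k compact_Icc \<eta>_cont, of n]
      unfolding set_integrable_def by (auto simp: mult.commute intro: borel_measurable_integrable)
    show "AE r in lebesgue. norm (indicator {a..b} r *\<^sub>R (\<eta> n r * k r)) \<le> norm (indicator {a..b} r *\<^sub>R k r)" for n
    proof (intro AE_I2)
      fix r
      have "\<bar>\<eta> n r\<bar> \<le> 1"
        using S01[of "real n * r + - real n * s"] S01[of "real n * r + - real n * t"] unfolding \<eta>_def by (simp add: abs_le_iff)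
      then show "norm (indicator {a..b} r *\<^sub>R (\<eta> n r * k r)) \<le> norm (indicator {a..b} r *\<^sub>R k r)"
        by (auto simp: indicator_def abs_mult mult_left_le_one_le)
    qed
    have step: "(\<lambda>n. S (real n * r + - real n * c)) \<longlonglongrightarrow> (if r > c then 1 else 0)" for r c
    proof (cases "r > c")
      case True
      obtain M where M: "1 / (r - c) \<le> real M" using real_arch_simple by blast
      have "S (real n * r + - real n * c) = 1" if "n \<ge> M" for n
      proof -
        have "1 / (r - c) \<le> real n" using M that by linarith
        then show ?thesis using True by (intro S) (simp add: field_simps)
      qed
      then show ?thesis
        using True by (intro tendsto_eventually) (auto simp: eventually_sequentially)
    next
      case False
      then have "real n * r + - real n * c \<le> 0" for n
        by (simp add: mult_left_mono)
      then show ?thesis using False by (simp add: S)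
    qed
    \<comment> \<open>At \<open>r = s\<close> the step is \<open>S 0 = 0\<close>, so the limit is
      the indicator of \<open>(s, t]\<close>; the point \<open>s\<close> is discarded as a null
      set.\<close>
    have "(\<lambda>n. indicator {a..b} r *\<^sub>R (\<eta> n r * k r)) \<longlonglongrightarrow> indicator {s..t} r *\<^sub>R k r" if r: "r \<noteq> s" for r
    proof -
      have "(\<lambda>n. indicator {a..b} r *\<^sub>R (\<eta> n r * k r)) \<longlonglongrightarrow>
          indicator {a..b} r *\<^sub>R (((if r > s then 1 else 0) + (-1) * (if r > t then 1 else 0)) * k r)"
        unfolding \<eta>_def by (intro tendsto_intros step)
      moreover have "indicator {a..b} r *\<^sub>R (((if r > s then 1 else 0) + (-1) * (if r > t then 1 else 0)) * k r) =
          indicator {s..t} r *\<^sub>R k r"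
        using st r by (auto simp: indicator_def)
      ultimately show ?thesis by (simp only:)
    qed
    moreover have "AE r in lebesgue. r \<noteq> s"
      using AE_lborel_singleton[of s] by (rule AE_completion)
    ultimately show "AE r in lebesgue. (\<lambda>n. indicator {a..b} r *\<^sub>R (\<eta> n r * k r)) \<longlonglongrightarrow> indicator {s..t} r *\<^sub>R k r"
      by (auto elim!: eventually_mono)
  qed
  have "(\<lambda>n. LINT r:{a..b}|lebesgue. deriv (\<eta> n) r * f r) \<longlonglongrightarrow> - (LINT r:{s..t}|lebesgue. k r)"
    using tendsto_minus[OF 2]
    by (rule Lim_transform_eventually) (auto simp: eventually_sequentially weak[OF Cc] intro!: exI[of _ N])
  with 1 have "f s - f t = - (LINT r:{s..t}|lebesgue. k r)"
    by (rule LIMSEQ_unique)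
  then show ?thesis by simp
qed

lemma in_bochner_Lq_integrable:
  fixes F w :: "real \<Rightarrow> real^'n \<Rightarrow> real"
  assumes E: "compact E" and q: "1 \<le> q"
    and F: "in_bochner_Lq {a..b} q (Lq E q) (Lq_norm E q) F"
    and w: "continuous_on ({a..b} \<times> E) (\<lambda>(t, x). w t x)"
  shows "set_integrable lebesgue {a..b} (\<lambda>t. Lq_norm E q (F t))"
    and "set_integrable lebesgue {a..b} (\<lambda>t. LINT x:E|lebesgue. F t x * w t x)"
proof -
  have Fm: "strongly_measurable {a..b} (Lq E q) (Lq_norm E q) F"
    and Fq: "set_integrable lebesgue {a..b} (\<lambda>t. Lq_norm E q (F t) powr q)"
    using F unfolding in_bochner_Lq_def by auto
  have one: "set_integrable lebesgue {a..b} (\<lambda>t. 1 :: real)"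
    by (rule compact_set_integrable_lebesgue) auto
  show norm_int: "set_integrable lebesgue {a..b} (\<lambda>t. Lq_norm E q (F t))"
  proof (rule set_integrable_bound)
    show "set_integrable lebesgue {a..b} (\<lambda>t. 1 + Lq_norm E q (F t) powr q)"
      using one Fq by (rule set_integral_add)
    \<comment> \<open>Only the \<open>q\<close>-th power of the norm is given as integrable;
      measurability of the norm itself is recovered by taking the root.\<close>
    have "(\<lambda>t. (indicator {a..b} t *\<^sub>R (Lq_norm E q (F t) powr q)) powr (1 / q)) \<in> borel_measurable lebesgue"
      using borel_measurable_integrable[OF Fq[unfolded set_integrable_def]] by measurable
    moreover have "(\<lambda>t. (indicator {a..b} t *\<^sub>R (Lq_norm E q (F t) powr q)) powr (1 / q)) =
        (\<lambda>t. indicator {a..b} t *\<^sub>R Lq_norm E q (F t))"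
      using q abs_of_nonneg[OF Lq_norm_nonneg] by (auto simp: fun_eq_iff indicator_def powr_powr)
    ultimately show "set_borel_measurable lebesgue {a..b} (\<lambda>t. Lq_norm E q (F t))"
      unfolding set_borel_measurable_def by simp
    have "y \<le> 1 + y powr q" if "y \<ge> 0" for y :: real
      using powr_mono[of 1 q y] q that by (cases "y \<le> 1") (auto intro: add_increasing2)
    then show "AE t in lebesgue. t \<in> {a..b} \<longrightarrow> norm (Lq_norm E q (F t)) \<le> norm (1 + Lq_norm E q (F t) powr q)"
      using Lq_norm_nonneg[of E q] by (auto intro!: AE_I2)
  qed
  obtain B where B: "0 < B" "\<And>t x. t \<in> {a..b} \<Longrightarrow> x \<in> E \<Longrightarrow> \<bar>w t x\<bar> \<le> B"
    using bounded_family[OF w E] by metis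
  show "set_integrable lebesgue {a..b} (\<lambda>t. LINT x:E|lebesgue. F t x * w t x)"
  proof (rule set_integrable_bound)
    show "set_integrable lebesgue {a..b} (\<lambda>t. B * ((measure lebesgue E + 1) * Lq_norm E q (F t)))"
      by (intro set_integrable_mult_right norm_int)
    show "set_borel_measurable lebesgue {a..b} (\<lambda>t. LINT x:E|lebesgue. F t x * w t x)"
      using pairing_measurable[OF E q Fm w] unfolding set_borel_measurable_def
      by (subst (asm) borel_measurable_restrict_space_iff) auto
    have "AE t in lebesgue. t \<in> {a..b} \<longrightarrow> F t \<in> Lq E q"
      using Fm unfolding strongly_measurable_def by (subst (asm) AE_restrict_space_iff) auto
    then show "AE t in lebesgue. t \<in> {a..b} \<longrightarrow> norm (LINT x:E|lebesgue. F t x * w t x) \<le>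
        norm (B * ((measure lebesgue E + 1) * Lq_norm E q (F t)))"
    proof eventually_elim
      case (elim t)
      show ?case
      proof
        assume t: "t \<in> {a..b}"
        then have "F t \<in> Lq E q" using elim by blast
        from Lq_pairing(2)[OF E q this slice_continuous[OF w t] _ B(2)[OF t]]
        show "norm (LINT x:E|lebesgue. F t x * w t x) \<le>
            norm (B * ((measure lebesgue E + 1) * Lq_norm E q (F t)))"
          using B(1) by (auto intro: order_trans[OF _ abs_ge_self])
      qed
    qed
  qed
qed

section \<open>Time regularity of paired test functions\<close>

text \<open>One factor changes at a time: the change of \<open>\<phi>\<close> is small in
  \<open>Lq\<close> against a bounded weight, and with \<open>\<phi> t\<close> fixed the weight
  varies uniformly on \<open>E\<close>.\<close>

lemma continuous_into_pairing:
  fixes \<phi> :: "real \<Rightarrow> real^'n \<Rightarrow> real"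
  assumes E: "compact E" and q: "1 \<le> q"
    and \<phi>: "continuous_into I (Lq E q) (Lq_norm E q) \<phi>" and ab: "{a..b} \<subseteq> I"
    and w: "continuous_on ({a..b} \<times> E) (\<lambda>(t, x). w t x)"
  shows "continuous_on {a..b} (\<lambda>t. LINT x:E|lebesgue. \<phi> t x * w t x)"
  unfolding continuous_on_def
proof
  fix t assume t: "t \<in> {a..b}"
  have \<phi>L: "\<phi> s \<in> Lq E q" if "s \<in> {a..b}" for s
    using \<phi> ab that unfolding continuous_into_def by auto
  obtain B where B: "0 < B" "\<And>t x. t \<in> {a..b} \<Longrightarrow> x \<in> E \<Longrightarrow> \<bar>w t x\<bar> \<le> B"
    using bounded_family[OF w E] by metis
  note Em = lmeasurable_compact[OF E]
  have lim: "((\<lambda>s. Lq_norm E q (\<lambda>x. \<phi> s x - \<phi> t x)) \<longlongrightarrow> 0) (at t within {a..b})"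
    using \<phi> ab t unfolding continuous_into_def by (meson subsetD tendsto_within_subset)
  have "((\<lambda>s. LINT x:E|lebesgue. \<phi> t x * w s x) \<longlongrightarrow> (LINT x:E|lebesgue. \<phi> t x * w t x)) (at t within {a..b})"
    using continuous_on_weighted_integral[OF w E Lq_imp_integrable(1)[OF Em q \<phi>L[OF t]] order_refl] Em t
    unfolding continuous_on_def by (auto simp: fmeasurable_def)
  moreover have "((\<lambda>s. (LINT x:E|lebesgue. \<phi> s x * w s x) - (LINT x:E|lebesgue. \<phi> t x * w s x)) \<longlongrightarrow> 0) (at t within {a..b})"
  proof (rule Lim_null_comparison)
    show "((\<lambda>s. B * ((measure lebesgue E + 1) * Lq_norm E q (\<lambda>x. \<phi> s x - \<phi> t x))) \<longlongrightarrow> 0) (at t within {a..b})"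
      using tendsto_mult_left[OF tendsto_mult_left[OF lim], of B "measure lebesgue E + 1"]
      by (simp only: mult_zero_right)
    show "\<forall>\<^sub>F s in at t within {a..b}. norm ((LINT x:E|lebesgue. \<phi> s x * w s x) - (LINT x:E|lebesgue. \<phi> t x * w s x))
        \<le> B * ((measure lebesgue E + 1) * Lq_norm E q (\<lambda>x. \<phi> s x - \<phi> t x))"
    proof (rule eventually_mono[of "\<lambda>s. s \<in> {a..b}"])
      fix s assume s: "s \<in> {a..b}"
      from Lq_pairing_diff[OF E q \<phi>L[OF s] \<phi>L[OF t] slice_continuous[OF w s] _ B(2)[OF s]]
      show "norm ((LINT x:E|lebesgue. \<phi> s x * w s x) - (LINT x:E|lebesgue. \<phi> t x * w s x))
        \<le> B * ((measure lebesgue E + 1) * Lq_norm E q (\<lambda>x. \<phi> s x - \<phi> t x))"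
        using B(1) by simp
    qed (simp add: eventually_at_filter)
  qed
  ultimately show "((\<lambda>s. LINT x:E|lebesgue. \<phi> s x * w s x) \<longlongrightarrow> (LINT x:E|lebesgue. \<phi> t x * w t x)) (at t within {a..b})"
    using tendsto_add by fastforce
qed

text \<open>By the reverse triangle inequality the L1 norm is continuous in time, hence bounded on a
  compact interval. The bound controls the Taylor remainder in the product rule.\<close>

lemma continuous_into_L1_bounded:
  fixes \<phi> :: "real \<Rightarrow> real^'n \<Rightarrow> real"
  assumes E: "compact E" and q: "1 \<le> q"
    and \<phi>: "continuous_into I (Lq E q) (Lq_norm E q) \<phi>" and ab: "{a..b} \<subseteq> I"
  obtains m where "0 \<le> m" "\<And>t. t \<in> {a..b} \<Longrightarrow> (LINT x:E|lebesgue. \<bar>\<phi> t x\<bar>) \<le> m"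
proof -
  note Em = lmeasurable_compact[OF E]
  have \<phi>L: "\<phi> s \<in> Lq E q" if "s \<in> {a..b}" for s
    using \<phi> ab that unfolding continuous_into_def by auto
  note \<phi>i = Lq_imp_integrable(1)[OF Em q \<phi>L]
  let ?g = "\<lambda>t. LINT x:E|lebesgue. \<bar>\<phi> t x\<bar>"
  have diff: "\<bar>?g s - ?g t\<bar> \<le> (measure lebesgue E + 1) * Lq_norm E q (\<lambda>x. \<phi> s x - \<phi> t x)"
    if st: "s \<in> {a..b}" "t \<in> {a..b}" for s t
  proof -
    have d: "(\<lambda>x. \<phi> s x - \<phi> t x) \<in> Lq E q"
      using q by (intro Lq_diff \<phi>L st) auto
    have "?g s - ?g t = (LINT x:E|lebesgue. \<bar>\<phi> s x\<bar> - \<bar>\<phi> t x\<bar>)"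
      using \<phi>i st by (simp add: set_integral_diff set_integrable_abs)
    also have "\<bar>\<dots>\<bar> \<le> (LINT x|lebesgue. \<bar>indicator E x *\<^sub>R (\<bar>\<phi> s x\<bar> - \<bar>\<phi> t x\<bar>)\<bar>)"
      unfolding set_lebesgue_integral_def by (rule integral_abs_bound)
    also have "\<dots> = (LINT x:E|lebesgue. \<bar>\<bar>\<phi> s x\<bar> - \<bar>\<phi> t x\<bar>\<bar>)"
      unfolding set_lebesgue_integral_def by (simp add: abs_mult)
    also have "\<dots> \<le> (LINT x:E|lebesgue. \<bar>\<phi> s x - \<phi> t x\<bar>)"
      using \<phi>i st by (intro set_integral_mono set_integrable_abs set_integral_diff) auto
    also have "\<dots> \<le> (measure lebesgue E + 1) * Lq_norm E q (\<lambda>x. \<phi> s x - \<phi> t x)"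
      by (rule Lq_imp_integrable(2)[OF Em q d])
    finally show ?thesis .
  qed
  have "continuous_on {a..b} ?g"
    unfolding continuous_on_def
  proof
    fix t assume t: "t \<in> {a..b}"
    have lim: "((\<lambda>s. Lq_norm E q (\<lambda>x. \<phi> s x - \<phi> t x)) \<longlongrightarrow> 0) (at t within {a..b})"
      using \<phi> ab t unfolding continuous_into_def by (meson subsetD tendsto_within_subset)
    have "((\<lambda>s. ?g s - ?g t) \<longlongrightarrow> 0) (at t within {a..b})"
    proof (rule Lim_null_comparison)
      show "((\<lambda>s. (measure lebesgue E + 1) * Lq_norm E q (\<lambda>x. \<phi> s x - \<phi> t x)) \<longlongrightarrow> 0) (at t within {a..b})"
        using tendsto_mult_left[OF lim, of "measure lebesgue E + 1"] by (simp only: mult_zero_right)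
      show "\<forall>\<^sub>F s in at t within {a..b}. norm (?g s - ?g t) \<le> (measure lebesgue E + 1) * Lq_norm E q (\<lambda>x. \<phi> s x - \<phi> t x)"
        by (rule eventually_mono[of "\<lambda>s. s \<in> {a..b}"]) (use diff[OF _ t] in \<open>simp_all add: eventually_at_filter\<close>)
    qed
    then show "(?g \<longlongrightarrow> ?g t) (at t within {a..b})"
      by (simp only: LIM_zero_iff)
  qed
  then have "bounded (?g ` {a..b})"
    by (intro compact_imp_bounded compact_continuous_image) auto
  then obtain m where "m > 0" "\<forall>y\<in>?g ` {a..b}. norm y \<le> m"
    unfolding bounded_pos by blast
  then show ?thesis by (intro that[of m]) force+
qed

text \<open>Pairing the two Bochner integrals in the definition of \<open>\<psi>\<close> with a
  fixed \<open>w\<close> says that the scalar pairing with \<open>\<psi>\<close> is the weak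
  derivative of the pairing with \<open>\<phi>\<close>.\<close>

lemma test_pairing_increment:
  fixes \<phi> \<psi> :: "real \<Rightarrow> real^'n \<Rightarrow> real"
  assumes E: "compact E" and q: "1 \<le> q"
    and W: "W1q_loc_time I q (Lq E q) (Lq_norm E q) \<phi> \<psi>"
    and \<phi>: "continuous_into I (Lq E q) (Lq_norm E q) \<phi>" and ab: "{a..b} \<subseteq> I"
    and w: "continuous_on E w" and st: "a < s" "s \<le> t" "t < b"
  shows "(LINT x:E|lebesgue. \<phi> t x * w x) - (LINT x:E|lebesgue. \<phi> s x * w x) =
    (LINT r:{s..t}|lebesgue. LINT x:E|lebesgue. \<psi> r x * w x)"
proof -
  have w': "continuous_on ({a..b} \<times> E) (\<lambda>(t, x). w x)"
    using w by (auto simp: case_prod_unfold intro!: continuous_on_compose2[OF w] continuous_intros)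
  have \<psi>: "in_bochner_Lq {a..b} q (Lq E q) (Lq_norm E q) \<psi>"
    using W ab unfolding W1q_loc_time_def by blast
  show ?thesis
  proof (rule weak_derivative_increment[OF _ _ _ st])
    show "continuous_on {a..b} (\<lambda>t. LINT x:E|lebesgue. \<phi> t x * w x)"
      by (rule continuous_into_pairing[OF E q \<phi> ab w'])
    show "set_integrable lebesgue {a..b} (\<lambda>r. LINT x:E|lebesgue. \<psi> r x * w x)"
      by (rule in_bochner_Lq_integrable(2)[OF E q \<psi> w'])
    fix \<eta> assume "\<eta> \<in> Cc_infinity {a<..<b}"
    then obtain z where z: "has_bochner_integral_into {a..b} (Lq E q) (Lq_norm E q) (\<lambda>t x. deriv \<eta> t * \<phi> t x) z"
      "has_bochner_integral_into {a..b} (Lq E q) (Lq_norm E q) (\<lambda>t x. \<eta> t * \<psi> t x) (\<lambda>x. - z x)"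
      using W ab unfolding W1q_loc_time_def by blast
    show "(LINT r:{a..b}|lebesgue. deriv \<eta> r * (LINT x:E|lebesgue. \<phi> r x * w x)) =
        - (LINT r:{a..b}|lebesgue. \<eta> r * (LINT x:E|lebesgue. \<psi> r x * w x))"
      using bochner_integral_pairing[OF E q z(1) w] bochner_integral_pairing[OF E q z(2) w]
      by (simp add: mult.assoc set_lebesgue_integral_def)
  qed
qed

section \<open>The product rule in time\<close>

text \<open>The right-hand sides telescope along a subdivision while the left-hand sides obey the
  triangle inequality. Steps of length at most \<open>d / 2\<close> respect the strict condition
  \<open>t - s < d\<close>.\<close>

lemma small_increments_imp_increment:
  fixes f M :: "real \<Rightarrow> real"
  assumes d: "d > 0" and le: "a \<le> b"
    and incr: "\<And>s t. a \<le> s \<Longrightarrow> s \<le> t \<Longrightarrow> t \<le> b \<Longrightarrow> t - s < d \<Longrightarrow> \<bar>f t - f s\<bar> \<le> M t - M s"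
  shows "\<bar>f b - f a\<bar> \<le> M b - M a"
proof -
  have step: "\<bar>f t - f a\<bar> \<le> M t - M a" if "a \<le> t" "t \<le> b" "t - a \<le> real n * (d / 2)" for n t
    using that
  proof (induction n arbitrary: t)
    case 0
    then show ?case by simp
  next
    case (Suc n)
    define s where "s = max a (t - d / 2)"
    have "t - a \<le> real n * (d / 2) + d / 2"
      using Suc.prems by (simp add: algebra_simps)
    then have s: "a \<le> s" "s \<le> t" "t - s < d" "s - a \<le> real n * (d / 2)"
      using Suc.prems d by (auto simp: s_def max_def)
    then have "\<bar>f t - f s\<bar> \<le> M t - M s" "\<bar>f s - f a\<bar> \<le> M s - M a"
      using incr[of s t] Suc.IH[of s] Suc.prems by auto
    then show ?case by linarith
  qed
  obtain n where "(b - a) / (d / 2) \<le> real n"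
    using real_arch_simple by blast
  then show ?thesis
    using step[of b n] le d by (simp add: field_simps)
qed

lemma eq_0_if_abs_le_multiples:
  fixes x K :: real
  assumes "\<And>e. e > 0 \<Longrightarrow> \<bar>x\<bar> \<le> e * K" shows "x = 0"
proof -
  have "((\<lambda>e. e * K) \<longlongrightarrow> 0 * K) (at_right 0)"
    by (intro tendsto_intros)
  moreover have "\<forall>\<^sub>F e in at_right 0. \<bar>x\<bar> \<le> e * K"
    using assms by (auto simp: eventually_at_right_field intro!: exI[of _ 1])
  ultimately have "\<bar>x\<bar> \<le> 0 * K"
    by (intro tendsto_lowerbound[of "\<lambda>e. e * K" _ "at_right 0"]) auto
  then show ?thesis by simp
qed

text \<open>
  No joint measurability of the test function is available, so Fubini cannot be used. Instead the
  increments over short time intervals are compared, with \<open>u\<close> frozen in time.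
\<close>

lemma test_product_rule:
  fixes \<phi> \<psi> u u' :: "real \<Rightarrow> real^'n \<Rightarrow> real"
  assumes E: "compact E" and q: "1 \<le> q"
    and W: "W1q_loc_time I q (Lq E q) (Lq_norm E q) \<phi> \<psi>"
    and \<phi>: "continuous_into I (Lq E q) (Lq_norm E q) \<phi>" and ab: "{a..b} \<subseteq> I"
    and u: "continuous_on ({a..b} \<times> E) (\<lambda>(t, x). u t x)"
    and u': "continuous_on ({a..b} \<times> E) (\<lambda>(t, x). u' t x)"
    and deriv: "\<And>t x. t \<in> {a..b} \<Longrightarrow> x \<in> E \<Longrightarrow> ((\<lambda>t. u t x) has_real_derivative u' t x) (at t)"
    and t12: "a < t1" "t1 \<le> t2" "t2 < b"
  shows "set_integrable lebesgue {t1..t2}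
      (\<lambda>r. (LINT x:E|lebesgue. \<psi> r x * u r x) + (LINT x:E|lebesgue. \<phi> r x * u' r x))"
    and "(LINT x:E|lebesgue. \<phi> t2 x * u t2 x) - (LINT x:E|lebesgue. \<phi> t1 x * u t1 x) =
    (LINT r:{t1..t2}|lebesgue. (LINT x:E|lebesgue. \<psi> r x * u r x) + (LINT x:E|lebesgue. \<phi> r x * u' r x))"
proof -
  note Em = lmeasurable_compact[OF E]
  define C where "C = measure lebesgue E + 1"
  have C: "C \<ge> 0" unfolding C_def by (simp add: add_nonneg_nonneg)
  define P where "P v w = (LINT x:E|lebesgue. v x * w x)" for v w :: "real^'n \<Rightarrow> real"
  have \<psi>: "in_bochner_Lq {a..b} q (Lq E q) (Lq_norm E q) \<psi>"
    using W ab unfolding W1q_loc_time_def by blast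
  have \<psi>_ae: "AE r in lebesgue. r \<in> {a..b} \<longrightarrow> \<psi> r \<in> Lq E q"
    using \<psi> unfolding in_bochner_Lq_def strongly_measurable_def
    by (subst (asm) AE_restrict_space_iff) auto
  have \<phi>L: "\<phi> s \<in> Lq E q" if "s \<in> {a..b}" for s
    using \<phi> ab that unfolding continuous_into_def by auto
  obtain m where m: "0 \<le> m" "\<And>t. t \<in> {a..b} \<Longrightarrow> (LINT x:E|lebesgue. \<bar>\<phi> t x\<bar>) \<le> m"
    using continuous_into_L1_bounded[OF E q \<phi> ab] by metis
  have u_cont: "continuous_on E (u t)" and u'_cont: "continuous_on E (u' t)" if "t \<in> {a..b}" for t
    using slice_continuous[OF u that] slice_continuous[OF u' that] .
  have const: "continuous_on ({a..b} \<times> E) (\<lambda>(t, x). w x)" if "continuous_on E w" for w :: "real^'n \<Rightarrow> real"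
    by (auto simp: case_prod_unfold intro!: continuous_on_compose2[OF that] continuous_intros)
  have N_int: "set_integrable lebesgue {a..b} (\<lambda>r. Lq_norm E q (\<psi> r))"
    by (rule in_bochner_Lq_integrable(1)[OF E q \<psi> u])
  have Pu_int: "set_integrable lebesgue {a..b} (\<lambda>r. P (\<psi> r) (u r))"
    unfolding P_def by (rule in_bochner_Lq_integrable(2)[OF E q \<psi> u])
  have Pw_int: "set_integrable lebesgue {a..b} (\<lambda>r. P (\<psi> r) w)" if "continuous_on E w" for w
    unfolding P_def by (rule in_bochner_Lq_integrable(2)[OF E q \<psi> const[OF that]])
  have G_cont: "continuous_on {a..b} (\<lambda>r. P (\<phi> r) (u' r))"
    unfolding P_def by (rule continuous_into_pairing[OF E q \<phi> ab u'])
  have G_int: "set_integrable lebesgue {a..b} (\<lambda>r. P (\<phi> r) (u' r))"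
    using G_cont by (rule compact_set_integrable_lebesgue[OF compact_Icc])
  have one: "set_integrable lebesgue {a..b} (\<lambda>r. 1 :: real)"
    by (rule compact_set_integrable_lebesgue) auto
  define g where "g r = P (\<psi> r) (u r) + P (\<phi> r) (u' r)" for r
  \<comment> \<open>An integrable majorant for the error rate on a short interval: the first term
    pays for freezing \<open>u\<close> against \<open>\<psi>\<close>, \<open>m\<close> for the
    Taylor remainder of \<open>u\<close>, and 1 for freezing the pairing of \<open>\<phi>\<close>
    with \<open>u'\<close>.\<close>
  define \<mu> where "\<mu> r = C * Lq_norm E q (\<psi> r) + (m + 1)" for r
  have g_int: "set_integrable lebesgue {a..b} g"
    unfolding g_def by (intro set_integral_add Pu_int G_int)
  have \<mu>_int: "set_integrable lebesgue {a..b} \<mu>"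
    unfolding \<mu>_def using set_integrable_mult_right[OF one, of "m + 1"] N_int
    by (intro set_integral_add set_integrable_mult_right) auto
  have sub: "set_integrable lebesgue {s..t} f" if "set_integrable lebesgue {a..b} f" "a \<le> s" "t \<le> b" for f :: "real \<Rightarrow> real" and s t
    using that by (intro set_integrable_subset[OF that(1)]) auto
  \<comment> \<open>The product rule says that \<open>F\<close> takes equal values at
    \<open>t1\<close> and \<open>t2\<close>. This follows once its increments are at most
    \<open>e\<close> times those of \<open>M\<close> for every positive \<open>e\<close>.\<close>
  define F where "F t = P (\<phi> t) (u t) - (LINT r:{t1..t}|lebesgue. g r)" for t
  define M where "M t = (LINT r:{t1..t}|lebesgue. \<mu> r)" for t
  have "\<bar>F t2 - F t1\<bar> \<le> e * (M t2 - M t1)" if e: "e > 0" for e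
  proof -
    obtain d1 where d1: "0 < d1" "\<And>s t x. s \<in> {a..b} \<Longrightarrow> t \<in> {a..b} \<Longrightarrow> \<bar>s - t\<bar> < d1 \<Longrightarrow> x \<in> E \<Longrightarrow> \<bar>u s x - u t x\<bar> \<le> e"
      using slices_uniformly_continuous[OF u E e] by metis
    obtain d2 where d2: "0 < d2" "\<And>s t x. s \<in> {a..b} \<Longrightarrow> t \<in> {a..b} \<Longrightarrow> \<bar>s - t\<bar> < d2 \<Longrightarrow> x \<in> E \<Longrightarrow> \<bar>u' s x - u' t x\<bar> \<le> e"
      using slices_uniformly_continuous[OF u' E e] by metis
    have "uniformly_continuous_on {a..b} (\<lambda>r. P (\<phi> r) (u' r))"
      using G_cont by (intro compact_uniformly_continuous) auto
    then obtain d3 where d3: "0 < d3" "\<And>s r. s \<in> {a..b} \<Longrightarrow> r \<in> {a..b} \<Longrightarrow> \<bar>r - s\<bar> < d3 \<Longrightarrow>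
        \<bar>P (\<phi> r) (u' r) - P (\<phi> s) (u' s)\<bar> < e"
      using e unfolding uniformly_continuous_on_def dist_real_def by metis
    define d where "d = min d1 (min d2 d3)"
    have d: "d > 0" "d \<le> d1" "d \<le> d2" "d \<le> d3" using d1 d2 d3 by (auto simp: d_def)
    have "\<bar>F t2 - F t1\<bar> \<le> e * M t2 - e * M t1"
    proof (rule small_increments_imp_increment[OF d(1) t12(2), where M = "\<lambda>t. e * M t"])
      fix s t assume st: "t1 \<le> s" "s \<le> t" "t \<le> t2" "t - s < d"
      then have st_ab: "s \<in> {a..b}" "t \<in> {a..b}" "a \<le> s" "t \<le> b" using t12 by auto
      have split: "(LINT r:{t1..t}|lebesgue. f r) - (LINT r:{t1..s}|lebesgue. f r) = (LINT r:{s..t}|lebesgue. f r)"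
        if "set_integrable lebesgue {a..b} f" for f :: "real \<Rightarrow> real"
        using set_lebesgue_integral_combine[of t1 t f s] sub[OF that, of t1 t] st t12 by simp
      define w0 where "w0 x = u t x - u s x - (t - s) * u' s x" for x
      have w_cont: "continuous_on E w0"
        unfolding w0_def by (intro continuous_intros u_cont u'_cont st_ab)
      have pair_add: "P v w1 + P v w2 = P v (\<lambda>x. w1 x + w2 x)"
        if "v \<in> Lq E q" "continuous_on E w1" "continuous_on E w2" for v w1 w2
        using Lq_pairing(1)[OF E q that(1,2)] Lq_pairing(1)[OF E q that(1,3)]
        unfolding P_def by (simp add: distrib_left set_integral_add)
      have pair_diff: "P v w1 - P v w2 = P v (\<lambda>x. w1 x - w2 x)"
        if "v \<in> Lq E q" "continuous_on E w1" "continuous_on E w2" for v w1 w2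
        using Lq_pairing(1)[OF E q that(1,2)] Lq_pairing(1)[OF E q that(1,3)]
        unfolding P_def by (simp add: right_diff_distrib set_integral_diff)
      have len: "(LINT r:{s..t}|lebesgue. c) = (t - s) * c" for c :: real
        using st by (simp add: set_lebesgue_integral_def)
      \<comment> \<open>The increment of the product is split into two parts: here
        \<open>\<phi>\<close> moves with the weight frozen at time \<open>t\<close>, and in
        \<open>B\<close> the weight moves with \<open>\<phi>\<close> frozen at time
        \<open>s\<close>.\<close>
      have A: "P (\<phi> t) (u t) - P (\<phi> s) (u t) = (LINT r:{s..t}|lebesgue. P (\<psi> r) (u t))"
        unfolding P_def
        by (rule test_pairing_increment[OF E q W \<phi> ab u_cont[OF st_ab(2)]]) (use st t12 in auto)
      have B: "P (\<phi> s) (u t) - P (\<phi> s) (u s) = P (\<phi> s) w0 + (t - s) * P (\<phi> s) (u' s)"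
      proof -
        have "P (\<phi> s) w0 + P (\<phi> s) (\<lambda>x. (t - s) * u' s x) = P (\<phi> s) (\<lambda>x. u t x - u s x)"
          by (subst pair_add) (auto simp: w0_def intro!: \<phi>L st_ab w_cont continuous_intros u'_cont u_cont[OF st_ab(1)] u_cont[OF st_ab(2)])
        moreover have "P (\<phi> s) (\<lambda>x. (t - s) * u' s x) = (t - s) * P (\<phi> s) (u' s)"
          unfolding P_def by (simp add: mult.left_commute)
        moreover have "P (\<phi> s) (u t) - P (\<phi> s) (u s) = P (\<phi> s) (\<lambda>x. u t x - u s x)"
          by (intro pair_diff \<phi>L u_cont st_ab)
        ultimately show ?thesis by simp
      qed
      have 1: "\<bar>LINT r:{s..t}|lebesgue. P (\<psi> r) (u t) - P (\<psi> r) (u r)\<bar> \<le>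
          (LINT r:{s..t}|lebesgue. e * (C * Lq_norm E q (\<psi> r)))"
      proof (rule set_integral_abs_le)
        show "set_integrable lebesgue {s..t} (\<lambda>r. P (\<psi> r) (u t) - P (\<psi> r) (u r))"
          by (rule sub[OF set_integral_diff(1)[OF Pw_int[OF u_cont[OF st_ab(2)]] Pu_int] st_ab(3,4)])
        show "set_integrable lebesgue {s..t} (\<lambda>r. e * (C * Lq_norm E q (\<psi> r)))"
          by (rule sub[OF set_integrable_mult_right[OF set_integrable_mult_right[OF N_int]] st_ab(3,4)])
        show "AE r in lebesgue. r \<in> {s..t} \<longrightarrow> \<bar>P (\<psi> r) (u t) - P (\<psi> r) (u r)\<bar> \<le> e * (C * Lq_norm E q (\<psi> r))"
          using \<psi>_ae
        proof eventually_elim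
          case (elim r)
          show ?case
          proof
            assume r: "r \<in> {s..t}"
            then have r_ab: "r \<in> {a..b}" using st_ab by auto
            then have \<psi>r: "\<psi> r \<in> Lq E q" using elim by blast
            have le: "\<bar>u t x - u r x\<bar> \<le> e" if "x \<in> E" for x
              using r st d by (intro d1(2) st_ab r_ab that) auto
            have "\<bar>P (\<psi> r) (\<lambda>x. u t x - u r x)\<bar> \<le> e * (C * Lq_norm E q (\<psi> r))"
              unfolding P_def C_def using e le
              by (intro Lq_pairing(2)[OF E q \<psi>r] continuous_intros u_cont st_ab r_ab) auto
            then show "\<bar>P (\<psi> r) (u t) - P (\<psi> r) (u r)\<bar> \<le> e * (C * Lq_norm E q (\<psi> r))"
              by (simp add: pair_diff[OF \<psi>r u_cont[OF st_ab(2)] u_cont[OF r_ab]])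
          qed
        qed
      qed
      \<comment> \<open>The mean value theorem is applied separately at each \<open>x\<close>; the
        intermediate time \<open>z\<close> may depend on \<open>x\<close>, but the modulus of
        \<open>u'\<close> is uniform on \<open>E\<close>.\<close>
      have w0_le: "\<bar>w0 x\<bar> \<le> (t - s) * e" if x: "x \<in> E" for x
      proof (cases "s = t")
        case False
        then have "s < t" using st by simp
        then obtain z where z: "s < z" "z < t" "u t x - u s x = (t - s) * u' z x"
          using MVT2[of s t "\<lambda>t. u t x" "\<lambda>t. u' t x"] deriv x st_ab by auto
        have "\<bar>u' z x - u' s x\<bar> \<le> e"
          using z st st_ab d by (intro d2(2) x) auto
        moreover have "w0 x = (t - s) * (u' z x - u' s x)"
          unfolding w0_def z(3) by (simp add: algebra_simps)
        ultimately show ?thesis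
          using \<open>s < t\<close> by (simp add: abs_mult mult_left_mono)
      qed (simp add: w0_def)
      have 2: "\<bar>P (\<phi> s) w0\<bar> \<le> (t - s) * (e * m)"
      proof -
        have "\<bar>P (\<phi> s) w0\<bar> \<le> (LINT x|lebesgue. \<bar>indicator E x *\<^sub>R (\<phi> s x * w0 x)\<bar>)"
          unfolding P_def set_lebesgue_integral_def by (rule integral_abs_bound)
        also have "\<dots> = (LINT x:E|lebesgue. \<bar>\<phi> s x * w0 x\<bar>)"
          unfolding set_lebesgue_integral_def by (simp add: abs_mult)
        also have "\<dots> \<le> (LINT x:E|lebesgue. (t - s) * e * \<bar>\<phi> s x\<bar>)"
        proof (rule set_integral_mono)
          show "set_integrable lebesgue E (\<lambda>x. \<bar>\<phi> s x * w0 x\<bar>)"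
            by (intro set_integrable_abs Lq_pairing(1)[OF E q \<phi>L[OF st_ab(1)] w_cont])
          show "set_integrable lebesgue E (\<lambda>x. (t - s) * e * \<bar>\<phi> s x\<bar>)"
            by (intro set_integrable_mult_right set_integrable_abs Lq_imp_integrable(1)[OF Em q \<phi>L[OF st_ab(1)]])
          show "\<bar>\<phi> s x * w0 x\<bar> \<le> (t - s) * e * \<bar>\<phi> s x\<bar>" if "x \<in> E" for x
            using mult_right_mono[OF w0_le[OF that], of "\<bar>\<phi> s x\<bar>"] by (simp add: abs_mult mult.commute)
        qed
        also have "\<dots> = (t - s) * e * (LINT x:E|lebesgue. \<bar>\<phi> s x\<bar>)" by simp
        also have "\<dots> \<le> (t - s) * e * m"
          using m(2)[OF st_ab(1)] st e by (intro mult_left_mono) auto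
        finally show ?thesis by (simp add: mult.assoc)
      qed
      \<comment> \<open>Error of replacing the time integral of the continuous pairing of
        \<open>\<phi>\<close> with \<open>u'\<close> by its value at the left endpoint.\<close>
      have 3: "\<bar>(t - s) * P (\<phi> s) (u' s) - (LINT r:{s..t}|lebesgue. P (\<phi> r) (u' r))\<bar> \<le> (t - s) * e"
      proof -
        have "(t - s) * P (\<phi> s) (u' s) - (LINT r:{s..t}|lebesgue. P (\<phi> r) (u' r)) =
            (LINT r:{s..t}|lebesgue. P (\<phi> s) (u' s) - P (\<phi> r) (u' r))"
          using st_ab sub[OF G_int] compact_set_integrable_lebesgue[OF compact_Icc, of s t "\<lambda>r. P (\<phi> s) (u' s)"]
          by (simp add: set_integral_diff len)
        also have "\<bar>\<dots>\<bar> \<le> (LINT r:{s..t}|lebesgue. e)"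
        proof (rule set_integral_abs_le)
          show "set_integrable lebesgue {s..t} (\<lambda>r. e)"
            by (rule compact_set_integrable_lebesgue) auto
          show "set_integrable lebesgue {s..t} (\<lambda>r. P (\<phi> s) (u' s) - P (\<phi> r) (u' r))"
            using st_ab by (intro set_integral_diff sub[OF G_int] compact_set_integrable_lebesgue) auto
          have "\<bar>P (\<phi> r) (u' r) - P (\<phi> s) (u' s)\<bar> < e" if "r \<in> {s..t}" for r
            using that st d st_ab by (intro d3(2)) auto
          then show "AE r in lebesgue. r \<in> {s..t} \<longrightarrow> \<bar>P (\<phi> s) (u' s) - P (\<phi> r) (u' r)\<bar> \<le> e"
            by (force intro!: AE_I2)
        qed
        finally show ?thesis by (simp add: len)
      qed
      have Fd: "F t - F s = (LINT r:{s..t}|lebesgue. P (\<psi> r) (u t) - P (\<psi> r) (u r)) + P (\<phi> s) w0 +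
          ((t - s) * P (\<phi> s) (u' s) - (LINT r:{s..t}|lebesgue. P (\<phi> r) (u' r)))"
      proof -
        have "F t - F s = P (\<phi> t) (u t) - P (\<phi> s) (u s) - (LINT r:{s..t}|lebesgue. g r)"
          unfolding F_def using split[OF g_int] by simp
        also have "(LINT r:{s..t}|lebesgue. g r) =
            (LINT r:{s..t}|lebesgue. P (\<psi> r) (u r)) + (LINT r:{s..t}|lebesgue. P (\<phi> r) (u' r))"
          unfolding g_def by (intro set_integral_add sub[OF Pu_int] sub[OF G_int] st_ab)
        also have "(LINT r:{s..t}|lebesgue. P (\<psi> r) (u t) - P (\<psi> r) (u r)) =
            (LINT r:{s..t}|lebesgue. P (\<psi> r) (u t)) - (LINT r:{s..t}|lebesgue. P (\<psi> r) (u r))"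
          by (rule set_integral_diff(2)[OF sub[OF Pw_int[OF u_cont[OF st_ab(2)]] st_ab(3,4)] sub[OF Pu_int st_ab(3,4)]])
        ultimately show ?thesis
          using A B by simp
      qed
      have "e * M t - e * M s = e * (LINT r:{s..t}|lebesgue. \<mu> r)"
        unfolding M_def right_diff_distrib[symmetric] split[OF \<mu>_int] ..
      also have "(LINT r:{s..t}|lebesgue. \<mu> r) = (LINT r:{s..t}|lebesgue. C * Lq_norm E q (\<psi> r)) + (LINT r:{s..t}|lebesgue. m + 1)"
        unfolding \<mu>_def using st_ab
        by (intro set_integral_add sub[OF set_integrable_mult_right[OF N_int]] compact_set_integrable_lebesgue) auto
      also have "e * \<dots> = (LINT r:{s..t}|lebesgue. e * (C * Lq_norm E q (\<psi> r))) + (t - s) * (e * m) + (t - s) * e"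
        unfolding len by (simp add: algebra_simps)
      finally show "\<bar>F t - F s\<bar> \<le> e * M t - e * M s"
        unfolding Fd using 1 2 3 by linarith
    qed
    then show ?thesis by (simp add: right_diff_distrib)
  qed
  then have "F t2 - F t1 = 0"
    by (rule eq_0_if_abs_le_multiples)
  moreover have "(LINT r:{t1..t1}|lebesgue. g r) = 0"
  proof -
    have "(LINT r:{t1..t1}|lebesgue. g r) = integral {t1..t1} g"
      using t12 by (intro set_lebesgue_integral_eq_integral sub[OF g_int]) auto
    then show ?thesis by simp
  qed
  ultimately show "(LINT x:E|lebesgue. \<phi> t2 x * u t2 x) - (LINT x:E|lebesgue. \<phi> t1 x * u t1 x) =
      (LINT r:{t1..t2}|lebesgue. (LINT x:E|lebesgue. \<psi> r x * u r x) + (LINT x:E|lebesgue. \<phi> r x * u' r x))"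
    unfolding F_def P_def g_def by simp
  show "set_integrable lebesgue {t1..t2}
      (\<lambda>r. (LINT x:E|lebesgue. \<psi> r x * u r x) + (LINT x:E|lebesgue. \<phi> r x * u' r x))"
    using sub[OF g_int, of t1 t2] t12 unfolding g_def P_def by simp
qed

section \<open>Integration by parts against test functions\<close>

lemma Lq_1:
  fixes v :: "real^'n \<Rightarrow> real"
  shows "v \<in> Lq S 1 \<longleftrightarrow> set_integrable lebesgue S v"
proof
  assume "v \<in> Lq S 1"
  then show "set_integrable lebesgue S v"
    using set_integrable_abs_iff[of lebesgue S v] unfolding Lq_def by simp
next
  assume v: "set_integrable lebesgue S v"
  then have "set_borel_measurable lebesgue S v"
    unfolding set_integrable_def set_borel_measurable_def by (rule borel_measurable_integrable)
  then show "v \<in> Lq S 1"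
    unfolding Lq_def using v by (simp add: set_integrable_abs)
qed

lemma L1_convergence_pairing:
  fixes h w :: "real^'n \<Rightarrow> real" and g :: "nat \<Rightarrow> real^'n \<Rightarrow> real"
  assumes E: "compact E" and w: "continuous_on E w"
    and h: "h \<in> Lq UNIV 1" and g: "\<And>k. g k \<in> Lq UNIV 1"
    and lim: "(\<lambda>k. Lq_norm UNIV 1 (\<lambda>x. h x - g k x)) \<longlonglongrightarrow> 0"
  shows "(\<lambda>k. LINT x:E|lebesgue. g k x * w x) \<longlonglongrightarrow> (LINT x:E|lebesgue. h x * w x)"
proof -
  have "bounded (w ` E)"
    using w E by (intro compact_imp_bounded compact_continuous_image)
  then obtain B where B: "0 < B" "\<And>x. x \<in> E \<Longrightarrow> \<bar>w x\<bar> \<le> B"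
    unfolding bounded_pos by auto
  have Es: "E \<in> sets lebesgue" using lmeasurable_compact[OF E] by (simp add: fmeasurable_def)
  have int: "set_integrable lebesgue E (\<lambda>x. v x * w x)" if "v \<in> Lq UNIV 1" for v
    using that by (intro set_integrable_mult_continuous[OF _ E w] set_integrable_subset[OF _ Es subset_UNIV])
      (simp add: Lq_1)
  have le: "\<bar>(LINT x:E|lebesgue. g k x * w x) - (LINT x:E|lebesgue. h x * w x)\<bar> \<le> B * Lq_norm UNIV 1 (\<lambda>x. h x - g k x)" for k
  proof -
    have d: "(\<lambda>x. h x - g k x) \<in> Lq UNIV 1" by (rule Lq_diff[OF h g]) simp
    then have di: "integrable lebesgue (\<lambda>x. \<bar>h x - g k x\<bar>)"
      by (auto simp: Lq_1 set_integrable_def)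
    have "\<bar>(LINT x:E|lebesgue. g k x * w x) - (LINT x:E|lebesgue. h x * w x)\<bar> =
        \<bar>(LINT x:E|lebesgue. h x * w x) - (LINT x:E|lebesgue. g k x * w x)\<bar>"
      by (rule abs_minus_commute)
    also have "(LINT x:E|lebesgue. h x * w x) - (LINT x:E|lebesgue. g k x * w x) = (LINT x:E|lebesgue. (h x - g k x) * w x)"
      unfolding left_diff_distrib by (rule set_integral_diff(2)[symmetric, OF int[OF h] int[OF g]])
    also have "\<bar>\<dots>\<bar> \<le> (LINT x|lebesgue. \<bar>indicator E x *\<^sub>R ((h x - g k x) * w x)\<bar>)"
      unfolding set_lebesgue_integral_def by (rule integral_abs_bound)
    also have "\<dots> \<le> (LINT x|lebesgue. B * \<bar>h x - g k x\<bar>)"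
    proof (rule integral_mono)
      show "integrable lebesgue (\<lambda>x. \<bar>indicator E x *\<^sub>R ((h x - g k x) * w x)\<bar>)"
        using int[OF d] unfolding set_integrable_def by (rule integrable_abs)
      show "integrable lebesgue (\<lambda>x. B * \<bar>h x - g k x\<bar>)" using di by simp
      show "\<bar>indicator E x *\<^sub>R ((h x - g k x) * w x)\<bar> \<le> B * \<bar>h x - g k x\<bar>" for x
      proof (cases "x \<in> E")
        case True
        then show ?thesis
          using mult_right_mono[OF B(2)[OF True], of "\<bar>h x - g k x\<bar>"] by (simp add: abs_mult mult.commute)
      qed (use B in simp)
    qed
    also have "\<dots> = B * (LINT x|lebesgue. \<bar>h x - g k x\<bar>)" by simp
    also have "(LINT x|lebesgue. \<bar>h x - g k x\<bar>) = Lq_norm UNIV 1 (\<lambda>x. h x - g k x)"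
      unfolding Lq_norm_def set_lebesgue_integral_def by (simp add: integral_nonneg_AE)
    finally show ?thesis .
  qed
  have "(\<lambda>k. (LINT x:E|lebesgue. g k x * w x) - (LINT x:E|lebesgue. h x * w x)) \<longlonglongrightarrow> 0"
  proof (rule Lim_null_comparison[OF always_eventually])
    show "\<forall>k. norm ((LINT x:E|lebesgue. g k x * w x) - (LINT x:E|lebesgue. h x * w x)) \<le> B * Lq_norm UNIV 1 (\<lambda>x. h x - g k x)"
      using le by simp
    show "(\<lambda>k. B * Lq_norm UNIV 1 (\<lambda>x. h x - g k x)) \<longlonglongrightarrow> 0"
      using tendsto_mult_left[OF lim, of B] by simp
  qed
  then show ?thesis by (simp only: LIM_zero_iff)
qed

text \<open>The identity is classical for the approximants \<open>\<eta> k\<close>, which vanish off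
  \<open>E\<close>. Convergence in the \<open>W11\<close> norm is L1 convergence of functions and
  derivatives, enough since \<open>A\<close> and \<open>A'\<close> are bounded on
  \<open>E\<close>.\<close>

lemma W11_0_integration_by_parts:
  fixes v A A' :: "real^'n \<Rightarrow> real"
  assumes E: "compact E" and v: "v \<in> W11_0 E"
    and A: "continuous_on UNIV A" and A': "continuous_on UNIV A'"
    and deriv: "\<And>x. ((\<lambda>h. A (x + h *\<^sub>R axis i 1)) has_real_derivative A' x) (at 0)"
  shows "set_integrable lebesgue E (\<lambda>x. wD UNIV i v x * A x)"
    and "(LINT x:E|lebesgue. wD UNIV i v x * A x) = - (LINT x:E|lebesgue. v x * A' x)"
proof -
  obtain \<eta> where v1: "v \<in> W11 UNIV" and \<eta>: "\<And>k. \<eta> k \<in> Cc_infinity E"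
    and lim: "(\<lambda>k. W11_norm UNIV (\<lambda>x. v x - \<eta> k x)) \<longlonglongrightarrow> 0"
    using v unfolding W11_0_def by blast
  obtain g where g: "weak_deriv UNIV i v g" and vL: "v \<in> Lq UNIV 1" and DvL: "wD UNIV i v \<in> Lq UNIV 1"
    using v1 unfolding W11_def by blast
  have Dv: "weak_deriv UNIV i v (wD UNIV i v)"
    by (rule weak_deriv_wD[OF g])
  have Es: "E \<in> sets lebesgue" using lmeasurable_compact[OF E] by (simp add: fmeasurable_def)
  show "set_integrable lebesgue E (\<lambda>x. wD UNIV i v x * A x)"
    using DvL by (intro set_integrable_mult_continuous[OF _ E continuous_on_subset[OF A subset_UNIV]]
        set_integrable_subset[OF _ Es subset_UNIV]) (simp add: Lq_1)
  define \<eta>' where "\<eta>' k x = frechet_derivative (\<eta> k) (at x) (axis i 1)" for k x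
  have wd\<eta>: "weak_deriv UNIV i (\<eta> k) (\<eta>' k)" for k
    unfolding \<eta>'_def by (intro weak_deriv_C1 Cc_infinityD(1-3)[OF \<eta>])
  have L: "f \<in> Lq UNIV 1" if "continuous_on UNIV f" "\<And>x. x \<notin> E \<Longrightarrow> f x = 0" for f :: "real^'n \<Rightarrow> real"
  proof -
    have "integrable lborel f" by (rule integrable_compact_support[OF that(1) E that(2)])
    then have "integrable lebesgue f"
      using that(1) by (subst integrable_completion) (auto intro: borel_measurable_continuous_onI)
    then show ?thesis by (simp add: Lq_1 set_integrable_def)
  qed
  have \<eta>L: "\<eta> k \<in> Lq UNIV 1" and \<eta>'L: "\<eta>' k \<in> Lq UNIV 1" for k
    unfolding \<eta>'_def by (auto intro!: L Cc_infinityD[OF \<eta>])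
  \<comment> \<open>The norm contains \<open>wD\<close> of \<open>v - \<eta> k\<close>; up to a null
    set this is the difference of the derivatives, and one coordinate is dominated by the sum over
    all.\<close>
  have D_lim: "(\<lambda>k. Lq_norm UNIV 1 (\<lambda>x. wD UNIV i v x - \<eta>' k x)) \<longlonglongrightarrow> 0"
  proof (rule Lim_null_comparison[OF always_eventually lim], rule allI)
    fix k
    have dL: "(\<lambda>x. wD UNIV i v x - \<eta>' k x) \<in> Lq UNIV 1"
      by (rule Lq_diff[OF DvL \<eta>'L]) simp
    have "AE x in lebesgue. x \<in> UNIV \<longrightarrow> wD UNIV i (\<lambda>x. v x - \<eta> k x) x = wD UNIV i v x - \<eta>' k x"
      by (rule wD_AE_eq[OF open_UNIV weak_deriv_diff[OF Dv wd\<eta>]])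
    from Lq_norm_cong_AE[OF LqD(1)[OF dL] this]
    have "Lq_norm UNIV 1 (\<lambda>x. wD UNIV i v x - \<eta>' k x) = Lq_norm UNIV 1 (wD UNIV i (\<lambda>x. v x - \<eta> k x))"
      by simp
    also have "\<dots> \<le> (\<Sum>i\<in>UNIV. Lq_norm UNIV 1 (wD UNIV i (\<lambda>x. v x - \<eta> k x)))"
      by (rule member_le_sum) (auto simp: Lq_norm_nonneg)
    also have "\<dots> \<le> W11_norm UNIV (\<lambda>x. v x - \<eta> k x)"
      unfolding W11_norm_def by (simp add: Lq_norm_nonneg)
    finally show "norm (Lq_norm UNIV 1 (\<lambda>x. wD UNIV i v x - \<eta>' k x)) \<le> W11_norm UNIV (\<lambda>x. v x - \<eta> k x)"
      by (simp add: Lq_norm_nonneg)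
  qed
  have v_lim: "(\<lambda>k. Lq_norm UNIV 1 (\<lambda>x. v x - \<eta> k x)) \<longlonglongrightarrow> 0"
    by (rule Lim_null_comparison[OF always_eventually lim])
      (auto simp: W11_norm_def Lq_norm_nonneg intro!: sum_nonneg)
  have "(LINT x:E|lebesgue. \<eta>' k x * A x) = - (LINT x:E|lebesgue. \<eta> k x * A' x)" for k
    using integration_by_parts_Cc[OF A A' deriv \<eta>, of k] unfolding \<eta>'_def by (simp add: mult.commute)
  moreover have "(\<lambda>k. LINT x:E|lebesgue. \<eta>' k x * A x) \<longlonglongrightarrow> (LINT x:E|lebesgue. wD UNIV i v x * A x)"
    by (rule L1_convergence_pairing[OF E continuous_on_subset[OF A subset_UNIV] DvL \<eta>'L D_lim])
  moreover have "(\<lambda>k. - (LINT x:E|lebesgue. \<eta> k x * A' x)) \<longlonglongrightarrow> - (LINT x:E|lebesgue. v x * A' x)"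
    by (intro tendsto_minus L1_convergence_pairing[OF E continuous_on_subset[OF A' subset_UNIV] vL \<eta>L v_lim])
  ultimately show "(LINT x:E|lebesgue. wD UNIV i v x * A x) = - (LINT x:E|lebesgue. v x * A' x)"
    using LIMSEQ_unique by fastforce
qed

section \<open>The anisotropic Barenblatt profile\<close>

text \<open>Splitting into positive and negative parts removes the jump of \<open>sgn\<close> at
  0.\<close>

lemma continuous_on_signed_powr:
  assumes "0 < m" shows "continuous_on UNIV (\<lambda>y::real. sgn y * \<bar>y\<bar> powr m)"
proof -
  have "continuous_on UNIV (\<lambda>y::real. max y 0 powr m - max (- y) 0 powr m)"
    using assms by (intro continuous_intros continuous_on_powr') auto
  also have "(\<lambda>y::real. max y 0 powr m - max (- y) 0 powr m) = (\<lambda>y. sgn y * \<bar>y\<bar> powr m)"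
    by (auto simp: fun_eq_iff max_def sgn_if)
  finally show ?thesis .
qed

lemma has_real_derivative_abs_powr:
  assumes q: "1 < q"
  shows "((\<lambda>y::real. \<bar>y\<bar> powr q) has_real_derivative q * (sgn y * \<bar>y\<bar> powr (q - 1))) (at y)"
proof -
  consider "y > 0" | "y < 0" | "y = 0" by linarith
  then show ?thesis
  proof cases
    case 1
    have "((\<lambda>y. y powr q) has_real_derivative q * (sgn y * \<bar>y\<bar> powr (q - 1))) (at y)"
      using 1 by (auto intro!: derivative_eq_intros)
    then show ?thesis
      by (rule DERIV_cong_ev[THEN iffD1, rotated 3])
        (use 1 in \<open>auto simp: eventually_nhds intro!: exI[of _ "{0<..}"]\<close>)
  next
    case 2
    have "((\<lambda>y. (- y) powr q) has_real_derivative q * (sgn y * \<bar>y\<bar> powr (q - 1))) (at y)"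
      using 2 by (auto intro!: derivative_eq_intros)
    then show ?thesis
      by (rule DERIV_cong_ev[THEN iffD1, rotated 3])
        (use 2 in \<open>auto simp: eventually_nhds intro!: exI[of _ "{..<0}"]\<close>)
  next
    case 3
    have "isCont (\<lambda>y::real. sgn y * \<bar>y\<bar> powr (q - 1)) 0"
      using continuous_on_signed_powr[of "q - 1"] q
      by (simp add: continuous_on_eq_continuous_at)
    then have "(\<lambda>y::real. sgn y * \<bar>y\<bar> powr (q - 1)) \<midarrow>0\<rightarrow> 0"
      unfolding isCont_def by simp
    \<comment> \<open>At 0 the difference quotient is the claimed derivative formula evaluated at
      \<open>h\<close>, up to the factor \<open>q\<close>, and it tends to 0.\<close>
    moreover have "(\<bar>0 + h\<bar> powr q - \<bar>0\<bar> powr q) / h = sgn h * \<bar>h\<bar> powr (q - 1)" if "h \<noteq> 0" for h :: real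
      using that q by (auto simp: powr_diff sgn_if field_simps)
    ultimately have "(\<lambda>h. (\<bar>0 + h\<bar> powr q - \<bar>0\<bar> powr q) / h) \<midarrow>0\<rightarrow> (0::real)"
      by (rule_tac Lim_transform_eventually) (auto simp: eventually_at intro!: exI[of _ 1])
    then show ?thesis
      using 3 by (simp add: DERIV_def)
  qed
qed

section \<open>The profile family and its classical derivatives\<close>

locale profile =
  fixes p :: "'n::{finite,linorder} \<Rightarrow> real"
  assumes p_gt_1: "1 < p i"
begin

text \<open>\<open>1 + m i\<close> is the conjugate exponent of \<open>p i\<close>. The identities
  \<open>m i * (p i - 1) = 1\<close> and \<open>1 + m i = p i * m i\<close> drive all computations
  below.\<close>

definition m :: "'n \<Rightarrow> real" where "m i = 1 / (p i - 1)"

text \<open>Amplitude, time exponent and weights are left free so that powers stay in the family.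
  The body copies the formula of the theorem; \<open>W_eq\<close> provides the form that is
  convenient to differentiate.\<close>

definition W :: "real \<Rightarrow> real \<Rightarrow> ('n \<Rightarrow> real) \<Rightarrow> real \<Rightarrow> (real, 'n) vec \<Rightarrow> real" where
  "W K a e t x = K * t powr a * exp (- (\<Sum>i\<in>UNIV. e i * (\<bar>x $ i\<bar> powr p i / t) powr (1 / (p i - 1))))"

text \<open>The classical partial derivative in direction \<open>i\<close>. The signed power is the
  derivative of \<open>\<bar>y\<bar> powr (1 + m i) / (1 + m i)\<close> and is continuous through 0
  because \<open>m i\<close> is positive.\<close>

definition DW :: "real \<Rightarrow> real \<Rightarrow> ('n \<Rightarrow> real) \<Rightarrow> 'n \<Rightarrow> real \<Rightarrow> (real, 'n) vec \<Rightarrow> real" where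
  "DW K a e i t x = - W K a e t x * (e i * ((1 + m i) * (sgn (x $ i) * \<bar>x $ i\<bar> powr m i)) * t powr (- m i))"

text \<open>The time derivative, factored as \<open>W\<close> times a logarithmic derivative; in
  this form it is matched with the divergence of the flux.\<close>

definition W_t :: "real \<Rightarrow> real \<Rightarrow> ('n \<Rightarrow> real) \<Rightarrow> real \<Rightarrow> (real, 'n) vec \<Rightarrow> real" where
  "W_t K a e t x = W K a e t x *
     (a / t + (\<Sum>i\<in>UNIV. e i * (\<bar>x $ i\<bar> powr (1 + m i) * (m i * t powr (- m i - 1)))))"

lemma m_pos: "0 < m i"
  using p_gt_1[of i] by (simp add: m_def)

lemma W_eq:
  assumes "0 < t"
  shows "W K a e t x = K * t powr a * exp (- (\<Sum>i\<in>UNIV. e i * (\<bar>x $ i\<bar> powr (1 + m i) * t powr (- m i))))"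
proof -
  have "(\<bar>x $ i\<bar> powr p i / t) powr (1 / (p i - 1)) = \<bar>x $ i\<bar> powr (1 + m i) * t powr (- m i)" for i
  proof -
    have "p i * (1 / (p i - 1)) = 1 + m i"
      using p_gt_1[of i] by (simp add: m_def field_simps)
    then show ?thesis
      using assms by (simp add: powr_divide powr_powr powr_minus_divide m_def)
  qed
  then show ?thesis unfolding W_def by simp
qed

lemma W_continuous: "continuous_on ({0<..} \<times> UNIV) (\<lambda>(t, x). W K a e t x)"
proof -
  have "continuous_on ({0<..} \<times> UNIV) (\<lambda>z::real \<times> (real, 'n) vec. K * fst z powr a *
      exp (- (\<Sum>i\<in>UNIV. e i * (\<bar>snd z $ i\<bar> powr (1 + m i) * fst z powr (- m i)))))"
    using m_pos by (intro continuous_intros continuous_on_powr') (auto simp: add_pos_pos)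
  then show ?thesis
    by (rule continuous_on_cong[THEN iffD1, rotated 2]) (auto simp: W_eq)
qed

lemma DW_continuous: "continuous_on ({0<..} \<times> UNIV) (\<lambda>(t, x). DW K a e i t x)"
proof -
  have "continuous_on ({0<..} \<times> UNIV) (\<lambda>z::real \<times> (real, 'n) vec. - (\<lambda>(t, x). W K a e t x) z *
      (e i * ((1 + m i) * (\<lambda>y. sgn y * \<bar>y\<bar> powr m i) (snd z $ i)) * fst z powr (- m i)))"
    by (intro continuous_intros continuous_on_powr' W_continuous
        continuous_on_compose2[OF continuous_on_signed_powr[OF m_pos]]) auto
  then show ?thesis
    by (simp add: DW_def case_prod_unfold)
qed

lemma W_t_continuous: "continuous_on ({0<..} \<times> UNIV) (\<lambda>(t, x). W_t K a e t x)"
proof -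
  have "continuous_on ({0<..} \<times> UNIV) (\<lambda>z::real \<times> (real, 'n) vec. (\<lambda>(t, x). W K a e t x) z *
      (a / fst z + (\<Sum>i\<in>UNIV. e i * (\<bar>snd z $ i\<bar> powr (1 + m i) * (m i * fst z powr (- m i - 1))))))"
    using m_pos by (intro continuous_intros continuous_on_powr' W_continuous) (auto simp: add_pos_pos)
  then show ?thesis
    by (simp add: W_t_def case_prod_unfold)
qed

lemma W_partial_derivative:
  assumes t: "0 < t"
  shows "((\<lambda>h. W K a e t (x + h *\<^sub>R axis i 1)) has_real_derivative DW K a e i t x) (at 0)"
proof -
  have d: "((\<lambda>h. \<bar>(x + h *\<^sub>R axis i 1) $ j\<bar> powr (1 + m j)) has_real_derivative
      (1 + m j) * (sgn (x $ j) * \<bar>x $ j\<bar> powr m j) * (if j = i then 1 else 0)) (at 0)" for j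
  proof -
    have "((\<lambda>h. (x + h *\<^sub>R axis i 1) $ j) has_real_derivative (if j = i then 1 else 0)) (at 0)"
      by (auto simp: axis_def intro!: derivative_eq_intros)
    from DERIV_chain2[OF _ this, of "\<lambda>y. \<bar>y\<bar> powr (1 + m j)"]
    show ?thesis
      using has_real_derivative_abs_powr[of "1 + m j" "x $ j"] m_pos[of j] by simp
  qed
  have "((\<lambda>h. \<Sum>j\<in>UNIV. e j * (\<bar>(x + h *\<^sub>R axis i 1) $ j\<bar> powr (1 + m j) * t powr (- m j))) has_real_derivative
      (\<Sum>j\<in>UNIV. e j * ((1 + m j) * (sgn (x $ j) * \<bar>x $ j\<bar> powr m j) * (if j = i then 1 else 0) * t powr (- m j)))) (at 0)"
    by (intro DERIV_sum DERIV_cmult DERIV_cmult_right d)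
  also have "(\<Sum>j\<in>UNIV. e j * ((1 + m j) * (sgn (x $ j) * \<bar>x $ j\<bar> powr m j) * (if j = i then 1 else 0) * t powr (- m j))) =
      (\<Sum>j\<in>UNIV. if j = i then e j * ((1 + m j) * (sgn (x $ j) * \<bar>x $ j\<bar> powr m j)) * t powr (- m j) else 0)"
    by (intro sum.cong) auto
  also have "\<dots> = e i * ((1 + m i) * (sgn (x $ i) * \<bar>x $ i\<bar> powr m i)) * t powr (- m i)"
    by simp
  finally have S: "((\<lambda>h. \<Sum>j\<in>UNIV. e j * (\<bar>(x + h *\<^sub>R axis i 1) $ j\<bar> powr (1 + m j) * t powr (- m j))) has_real_derivative
      e i * ((1 + m i) * (sgn (x $ i) * \<bar>x $ i\<bar> powr m i)) * t powr (- m i)) (at 0)" .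
  show ?thesis
    unfolding DW_def W_eq[OF t]
    using DERIV_cmult[OF DERIV_fun_exp[OF DERIV_minus[OF S]], of "K * t powr a"]
    by (simp add: mult.assoc)
qed

lemma W_time_derivative:
  assumes t: "0 < t"
  shows "((\<lambda>t. W K a e t x) has_real_derivative W_t K a e t x) (at t)"
proof -
  have pd: "((\<lambda>t. t powr r) has_real_derivative r * t powr (r - 1)) (at t)" for r
    using t by (rule has_real_derivative_powr)
  define S where "S t = (\<Sum>i\<in>UNIV. e i * (\<bar>x $ i\<bar> powr (1 + m i) * t powr (- m i)))" for t
  have S: "(S has_real_derivative (\<Sum>i\<in>UNIV. e i * (\<bar>x $ i\<bar> powr (1 + m i) * (- m i * t powr (- m i - 1))))) (at t)"
    unfolding S_def by (intro DERIV_sum DERIV_cmult pd)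
  have "((\<lambda>t. K * t powr a * exp (- S t)) has_real_derivative
      K * (a * t powr (a - 1)) * exp (- S t) + exp (- S t) * - (\<Sum>i\<in>UNIV. e i * (\<bar>x $ i\<bar> powr (1 + m i) * (- m i * t powr (- m i - 1)))) * (K * t powr a)) (at t)"
    by (rule DERIV_mult[OF DERIV_cmult[OF pd] DERIV_fun_exp[OF DERIV_minus[OF S]]])
  also have "K * (a * t powr (a - 1)) * exp (- S t) + exp (- S t) * - (\<Sum>i\<in>UNIV. e i * (\<bar>x $ i\<bar> powr (1 + m i) * (- m i * t powr (- m i - 1)))) * (K * t powr a) = W_t K a e t x"
    using t unfolding W_t_def W_eq[OF t] S_def[symmetric]
    by (simp add: sum_negf powr_diff field_simps)
  finally show ?thesis
    by (rule DERIV_cong_ev[THEN iffD1, rotated 3])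
      (use t in \<open>auto simp: eventually_nhds W_eq S_def intro!: exI[of _ "{0<..}"]\<close>)
qed

lemma W_powr:
  assumes "0 < K" "0 < t"
  shows "W K a e t x powr b = W (K powr b) (a * b) (\<lambda>i. b * e i) t x"
  using assms unfolding W_def
  by (simp add: powr_mult powr_powr exp_powr_real sum_distrib_left mult.assoc mult.commute[of _ b])

lemma W_nonneg: "0 \<le> K \<Longrightarrow> 0 \<le> W K a e t x"
  unfolding W_def by simp

lemma W_slice_continuous: "0 < t \<Longrightarrow> continuous_on UNIV (W K a e t)"
  and DW_slice_continuous: "0 < t \<Longrightarrow> continuous_on UNIV (DW K a e i t)"
  using slice_continuous[OF W_continuous] slice_continuous[OF DW_continuous] by auto

lemma W_weak_deriv: "0 < t \<Longrightarrow> weak_deriv \<Omega> i (W K a e t) (DW K a e i t)"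
  by (intro weak_deriv_C1 W_slice_continuous DW_slice_continuous W_partial_derivative)

section \<open>Flux, regularity and weak form of the profile\<close>

text \<open>In the derivative of \<open>W powr m i\<close> the powers of \<open>W\<close>,
  \<open>\<bar>x $ i\<bar>\<close> and \<open>1 / t\<close> all have exponent \<open>m i\<close>.
  Raising to \<open>p i - 1\<close> makes these exponents 1, and the prefactor of
  \<open>flux\<close> cancels \<open>m i powr (p i - 1)\<close>.\<close>

lemma flux_W:
  assumes K: "0 < K" and t: "0 < t" and e: "0 \<le> e i"
  shows "AE x in lebesgue. flux p UNIV i (W K a e t) x =
    - ((e i * p i / (p i - 1)) powr (p i - 1) / t) * (x $ i * W K a e t x)"
proof -
  have eq: "(\<lambda>y. W K a e t y powr (1 / (p i - 1))) = W (K powr m i) (a * m i) (\<lambda>j. m i * e j) t"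
    using W_powr[OF K t, of a e _ "m i"] by (simp add: m_def)
  have "AE x in lebesgue. x \<in> UNIV \<longrightarrow>
      wD UNIV i (\<lambda>y. W K a e t y powr (1 / (p i - 1))) x = DW (K powr m i) (a * m i) (\<lambda>j. m i * e j) i t x"
    unfolding eq by (rule wD_AE_eq[OF open_UNIV W_weak_deriv[OF t]])
  then show ?thesis
  proof eventually_elim
    case (elim x)
    define g where "g = DW (K powr m i) (a * m i) (\<lambda>j. m i * e j) i t x"
    define w where "w = W K a e t x"
    have w: "w > 0" unfolding w_def W_def using K t by simp
    have g: "g = - (w powr m i * (m i * e i * ((1 + m i) * (sgn (x $ i) * \<bar>x $ i\<bar> powr m i)) * t powr (- m i)))"
      unfolding g_def DW_def w_def by (simp add: W_powr[OF K t])
    have fl: "flux p UNIV i (W K a e t) x = (p i - 1) powr (p i - 1) * \<bar>g\<bar> powr (p i - 2) * g"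
      using elim unfolding flux_def g_def Let_def by simp
    show ?case
    proof (cases "x $ i = 0")
      case True
      then show ?thesis unfolding fl g by simp
    next
      case False
      have p1: "p i - 1 > 0" using p_gt_1[of i] by simp
      have mp: "m i * (p i - 1) = 1" using p1 by (simp add: m_def)
      have ag: "\<bar>g\<bar> = m i * (e i * (1 + m i)) * (w powr m i * \<bar>x $ i\<bar> powr m i * t powr (- m i))"
        unfolding g using w m_pos[of i] e False
        by (simp add: abs_mult abs_sgn_eq)
      have "g = - (sgn (x $ i) * \<bar>g\<bar>)"
        unfolding ag unfolding g by simp
      then have "\<bar>g\<bar> powr (p i - 2) * g = - sgn (x $ i) * (\<bar>g\<bar> powr (p i - 2) * \<bar>g\<bar>)"
        by (metis (no_types, opaque_lifting) mult.left_commute mult_minus_left mult_minus_right)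
      \<comment> \<open>\<open>e i = 0\<close> is permitted, so \<open>g\<close> may vanish although
        \<open>x $ i\<close> does not; then both sides are 0 because \<open>0 powr r = 0\<close> for
        every \<open>r\<close>.\<close>
      also have "\<bar>g\<bar> powr (p i - 2) * \<bar>g\<bar> = \<bar>g\<bar> powr (p i - 1)"
      proof (cases "g = 0")
        case False
        then have "\<bar>g\<bar> powr (p i - 2) * \<bar>g\<bar> powr 1 = \<bar>g\<bar> powr (p i - 2 + 1)"
          by (simp only: powr_add)
        then show ?thesis using False by (simp add: algebra_simps)
      qed (use p1 in simp)
      also have "\<bar>g\<bar> powr (p i - 1) = m i powr (p i - 1) * (e i * (1 + m i)) powr (p i - 1) *
          (w * \<bar>x $ i\<bar> * (1 / t))"
      proof -
        have "t powr (- m i * (p i - 1)) = 1 / t"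
          using t mp by (simp add: powr_minus_divide)
        then show ?thesis
          unfolding ag using w t e m_pos[of i] mp by (simp add: powr_mult powr_powr)
      qed
      finally have "flux p UNIV i (W K a e t) x = ((p i - 1) powr (p i - 1) * m i powr (p i - 1)) *
          (e i * (1 + m i)) powr (p i - 1) * (- (sgn (x $ i) * \<bar>x $ i\<bar>)) * w / t"
        unfolding fl by (simp add: mult.assoc mult.left_commute)
      also have "(p i - 1) powr (p i - 1) * m i powr (p i - 1) = 1"
        using p1 m_pos[of i] mp by (simp add: powr_mult[symmetric] mult.commute)
      also have "e i * (1 + m i) = e i * p i / (p i - 1)"
        using p1 by (simp add: m_def field_simps)
      also have "sgn (x $ i) * \<bar>x $ i\<bar> = x $ i"
        by (simp add: sgn_if abs_if)
      finally show ?thesis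
        unfolding w_def by (simp add: field_simps)
    qed
  qed
qed

lemma solution_class_W:
  assumes K: "0 < K"
  shows "solution_class p UNIV {0<..} (W K a e)"
proof -
  define P where "P = last_exponent p"
  have P: "1 < P" unfolding P_def last_exponent_def by (rule p_gt_1)
  have sub: "{s..t} \<times> S \<subseteq> {0<..} \<times> UNIV" if "{s..t} \<subseteq> {0<..}" for s t :: real and S :: "(real, 'n) vec set"
    using that by auto
  have pos: "0 < r" if "{s..t} \<subseteq> {0<..}" "r \<in> {s..t}" for s t r :: real
    using that by auto
  have meas: "(\<lambda>(t, x). W K a e t x) \<in> borel_measurable (lebesgue_on ({0<..} \<times> UNIV))"
    by (intro continuous_imp_measurable_on_sets_lebesgue W_continuous sets_completionI_sets) (simp add: open_Times)
  have cont: "continuous_into {s..t} (Lq S (P / (P - 1))) (Lq_norm S (P / (P - 1))) (W K a e)"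
    if "{s..t} \<subseteq> {0<..}" "compact S" for s t S
    using that P lmeasurable_compact[OF that(2)]
    by (intro Lq_continuous_family(2)[OF continuous_on_subset[OF W_continuous sub] _ order_refl])
      (auto simp: fmeasurable_def)
  \<comment> \<open>The power \<open>b\<close> is arbitrary here and in \<open>wd\<close>,
    \<open>D\<close>, \<open>ex\<close>, since the solution class involves the last exponent as well
    as each \<open>p i\<close>.\<close>
  have Sob: "in_LpW1p_loc {0<..} UNIV p (\<lambda>t x. W K a e t x powr b)" for b
    unfolding in_LpW1p_loc_def
  proof (intro allI impI, elim conjE)
    fix s t :: real and \<Omega> :: "(real, 'n) vec set"
    assume st: "{s..t} \<subseteq> {0<..}" and \<Omega>: "open \<Omega>" "compact (closure \<Omega>)"
    have eq: "(\<lambda>x. W K a e r x powr b) = W (K powr b) (a * b) (\<lambda>i. b * e i) r" if "r \<in> {s..t}" for r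
      using W_powr[OF K pos[OF st that]] by auto
    show "in_LpW1p {s..t} \<Omega> p (\<lambda>t x. W K a e t x powr b)"
    proof (rule in_LpW1p_continuous_family[OF _ continuous_on_subset[OF DW_continuous sub[OF st]] \<Omega>])
      show "continuous_on ({s..t} \<times> closure \<Omega>) (\<lambda>(t, x). W K a e t x powr b)"
        by (rule continuous_on_cong[THEN iffD1, OF refl _ continuous_on_subset[OF W_continuous sub[OF st]]])
          (use fun_cong[OF eq] in auto)
      show "weak_deriv \<Omega> i (\<lambda>x. W K a e r x powr b) (DW (K powr b) (a * b) (\<lambda>i. b * e i) i r)"
        if "r \<in> {s..t}" for i r
        unfolding eq[OF that] by (rule W_weak_deriv[OF pos[OF st that]])
    qed (use p_gt_1 in \<open>auto intro: less_trans[OF zero_less_one]\<close>)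
  qed
  have wd: "weak_deriv UNIV i (\<lambda>x. W K a e t x powr b) (DW (K powr b) (a * b) (\<lambda>i. b * e i) i t)" if "0 < t" for i t b
    using W_weak_deriv[OF that] W_powr[OF K that] by simp
  have D: "in_bochner_Lq {s..t} (p i) (Lq S (p i)) (Lq_norm S (p i)) (\<lambda>t. wD UNIV i (\<lambda>x. W K a e t x powr b))"
    if st: "{s..t} \<subseteq> {0<..}" "compact S" for s t S i b
  proof (rule Lq_continuous_family(1)[OF continuous_on_subset[OF DW_continuous sub[OF st(1)]] st(2) order_refl])
    show "S \<in> sets lebesgue" using lmeasurable_compact[OF st(2)] by (simp add: fmeasurable_def)
    show "\<forall>r\<in>{s..t}. AE x in lebesgue. x \<in> S \<longrightarrow>
        wD UNIV i (\<lambda>x. W K a e r x powr b) x = DW (K powr b) (a * b) (\<lambda>i. b * e i) i r x"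
    proof
      fix r assume "r \<in> {s..t}"
      from wD_AE_eq[OF open_UNIV wd[where i = i and b = b, OF pos[OF st(1) this]]]
      show "AE x in lebesgue. x \<in> S \<longrightarrow>
          wD UNIV i (\<lambda>x. W K a e r x powr b) x = DW (K powr b) (a * b) (\<lambda>i. b * e i) i r x"
        by eventually_elim simp
    qed
  qed (use p_gt_1[of i] in simp)
  have ex: "AE t in lebesgue_on {0<..}. \<exists>g. weak_deriv UNIV i (\<lambda>x. W K a e t x powr b) g" for i b
    using wd by (intro AE_I2) auto
  show ?thesis
    unfolding solution_class_def Let_def P_def[symmetric]
    using meas cont Sob D ex W_nonneg[of K] K by simp
qed

text \<open>By \<open>d\<close> the flux is \<open>- x $ i * u / (p i * t)\<close>. Differentiating
  the factor \<open>x $ i\<close> produces the term with \<open>a\<close>; differentiating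
  \<open>u\<close> produces a factor \<open>1 + m i = p i * m i\<close>, whose \<open>p i\<close> is
  cancelled by the weight. So the divergence of the flux equals \<open>W_t\<close>, and the spatial
  terms cancel those of the product rule.\<close>

lemma weak_form_W:
  assumes K: "0 < K" and e: "\<And>i. 0 \<le> e i"
    and d: "\<And>i. (e i * p i / (p i - 1)) powr (p i - 1) = 1 / p i"
    and a: "a = - (\<Sum>i\<in>UNIV. 1 / p i)"
    and E: "compact E" and t12: "t1 \<le> t2" "{t1..t2} \<subseteq> {0<..}"
    and test: "test_function p E {0<..} \<phi> \<psi>"
  shows "weak_form p UNIV E t1 t2 (W K a e) \<phi> \<psi> = 0"
proof -
  define q where "q = last_exponent p"
  have q: "1 \<le> q" using p_gt_1 unfolding q_def last_exponent_def by (simp add: less_imp_le)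
  have t1: "0 < t1" using t12 by auto
  \<comment> \<open>The product rule needs \<open>t1\<close> and \<open>t2\<close> strictly inside
    an interval; halving \<open>t1\<close> keeps that interval within the positive times.\<close>
  have pos: "0 < t" if "t \<in> {t1 / 2..t2 + 1}" for t using that t1 by auto
  have W1q: "W1q_loc_time {0<..} q (Lq E q) (Lq_norm E q) \<phi> \<psi>"
    and \<phi>: "continuous_into {0<..} (Lq E q) (Lq_norm E q) \<phi>"
    and \<phi>0: "in_LpW1p_0 {t1..t2} E p \<phi>"
    using test t12 unfolding test_function_def Let_def q_def by auto
  have I: "{t1 / 2..t2 + 1} \<subseteq> {0<..}" using pos by auto
  let ?u = "W K a e" and ?u' = "W_t K a e"
  have sub: "{t1 / 2..t2 + 1} \<times> E \<subseteq> {0<..} \<times> UNIV" using I by auto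
  have in12: "t1 / 2 < t1" "t2 < t2 + 1" using t1 by auto
  note rule = test_product_rule[OF E q W1q \<phi> I continuous_on_subset[OF W_continuous sub]
      continuous_on_subset[OF W_t_continuous sub] W_time_derivative[OF pos] in12(1) t12(1) in12(2)]
  define R where "R r = (LINT x:E|lebesgue. \<psi> r x * ?u r x) + (LINT x:E|lebesgue. \<phi> r x * ?u' r x)" for r
  define Q where "Q r = (LINT x:E|lebesgue. - ?u r x * \<psi> r x + (\<Sum>i\<in>UNIV. flux p UNIV i (?u r) x * wD UNIV i (\<phi> r) x))" for r
  have Es: "E \<in> sets lebesgue" using lmeasurable_compact[OF E] by (simp add: fmeasurable_def)
  have "AE r in lebesgue. r \<in> {t1..t2} \<longrightarrow> \<phi> r \<in> W11_0 E"
    using \<phi>0 unfolding in_LpW1p_0_def in_bochner_Lq_def strongly_measurable_def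
    by (subst (asm) AE_restrict_space_iff) auto
  moreover have "AE r in lebesgue. r \<in> {t1..t2} \<longrightarrow> \<psi> r \<in> Lq E q"
  proof -
    have "in_bochner_Lq {t1..t2} q (Lq E q) (Lq_norm E q) \<psi>"
      using W1q t12 unfolding W1q_loc_time_def by blast
    then show ?thesis
      unfolding in_bochner_Lq_def strongly_measurable_def by (subst (asm) AE_restrict_space_iff) auto
  qed
  \<comment> \<open>Integration by parts in space is possible only at almost every time, because
    membership of \<open>\<phi> r\<close> in \<open>W11_0 E\<close> and of \<open>\<psi> r\<close>
    in \<open>Lq E q\<close> is known only there.\<close>
  ultimately have Q_eq: "AE r in lebesgue. r \<in> {t1..t2} \<longrightarrow> - R r = Q r"
  proof eventually_elim
    case (elim r)
    show ?case
    proof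
      assume r: "r \<in> {t1..t2}"
      then have r0: "0 < r" using t1 by auto
      have \<phi>r: "\<phi> r \<in> W11_0 E" and \<psi>r: "\<psi> r \<in> Lq E q" using elim r by auto
      have \<phi>L: "\<phi> r \<in> Lq E q" using \<phi> r0 unfolding continuous_into_def by auto
      define A where "A i x = - (1 / (p i * r)) * (x $ i * ?u r x)" for i and x :: "(real, 'n) vec"
      define A' where "A' i x = - (1 / (p i * r)) * (?u r x + x $ i * DW K a e i r x)" for i and x :: "(real, 'n) vec"
      have A: "continuous_on UNIV (A i)" and A': "continuous_on UNIV (A' i)" for i
        unfolding A_def A'_def by (intro continuous_intros W_slice_continuous DW_slice_continuous r0)+
      have A_deriv: "((\<lambda>h. A i (x + h *\<^sub>R axis i 1)) has_real_derivative A' i x) (at 0)" for i x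
      proof -
        have "((\<lambda>h. (x + h *\<^sub>R axis i 1) $ i) has_real_derivative 1) (at 0)"
          by (auto simp: axis_def intro!: derivative_eq_intros)
        from DERIV_cmult[OF DERIV_mult[OF this W_partial_derivative[OF r0]], of "- (1 / (p i * r))"]
        show ?thesis unfolding A_def A'_def by (simp add: algebra_simps)
      qed
      note ibp = W11_0_integration_by_parts[OF E \<phi>r A A' A_deriv]
      have flux_ae: "AE x in lebesgue. x \<in> E \<longrightarrow> (\<forall>i. flux p UNIV i (?u r) x = A i x)"
      proof -
        have "AE x in lebesgue. flux p UNIV i (?u r) x = A i x" for i
          using flux_W[where i = i and a = a and e = e, OF K r0 e] unfolding d A_def by (simp add: mult.commute)
        then have "AE x in lebesgue. \<forall>i\<in>UNIV. flux p UNIV i (?u r) x = A i x"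
          by (intro AE_finite_allI) auto
        then show ?thesis by eventually_elim auto
      qed
      have div: "(\<Sum>i\<in>UNIV. A' i x) = ?u' r x" for x
      proof -
        have "A' i x = ?u r x * (- (1 / p i) / r + e i * (\<bar>x $ i\<bar> powr (1 + m i) * (m i * r powr (- m i - 1))))" for i
        proof -
          have x: "x $ i * (sgn (x $ i) * \<bar>x $ i\<bar> powr m i) = \<bar>x $ i\<bar> powr (1 + m i)"
            by (cases "x $ i = 0") (auto simp: powr_add sgn_if)
          have pm: "1 + m i = p i * m i"
            using p_gt_1[of i] by (simp add: m_def field_simps)
          have p0: "p i > 0" using p_gt_1[of i] by simp
          have rr: "r powr (- m i - 1) = r powr (- m i) / r"
            using r0 by (simp add: powr_diff)
          have "x $ i * DW K a e i r x = - ?u r x * (e i * ((1 + m i) * (x $ i * (sgn (x $ i) * \<bar>x $ i\<bar> powr m i))) * r powr (- m i))"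
            unfolding DW_def by (simp add: mult_ac)
          also have "\<dots> = - ?u r x * (e i * ((p i * m i) * \<bar>x $ i\<bar> powr (1 + m i)) * r powr (- m i))"
            unfolding x by (simp add: pm)
          finally have xd: "x $ i * DW K a e i r x = - ?u r x * (e i * ((p i * m i) * \<bar>x $ i\<bar> powr (1 + m i)) * r powr (- m i))" .
          show ?thesis
            unfolding A'_def xd rr using p0 r0 by (simp add: field_simps)
        qed
        then have "(\<Sum>i\<in>UNIV. A' i x) = (\<Sum>i\<in>UNIV. ?u r x * (- (1 / p i) / r + e i * (\<bar>x $ i\<bar> powr (1 + m i) * (m i * r powr (- m i - 1)))))"
          by simp
        also have "\<dots> = ?u' r x"
          unfolding W_t_def a sum_distrib_left[symmetric] sum.distrib sum_divide_distrib[symmetric] sum_negf ..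
        finally show ?thesis .
      qed
      have \<psi>u: "set_integrable lebesgue E (\<lambda>x. \<psi> r x * ?u r x)"
        by (rule Lq_pairing(1)[OF E q \<psi>r continuous_on_subset[OF W_slice_continuous[OF r0] subset_UNIV]])
      have \<phi>A': "set_integrable lebesgue E (\<lambda>x. \<phi> r x * A' i x)" for i
        by (rule Lq_pairing(1)[OF E q \<phi>L continuous_on_subset[OF A' subset_UNIV]])
      have sum_int: "set_integrable lebesgue E (\<lambda>x. \<Sum>i\<in>UNIV. f i x)"
          "(LINT x:E|lebesgue. \<Sum>i\<in>UNIV. f i x) = (\<Sum>i\<in>UNIV. LINT x:E|lebesgue. f i x)"
        if "\<And>i. set_integrable lebesgue E (f i)" for f :: "'n \<Rightarrow> (real, 'n) vec \<Rightarrow> real"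
        unfolding set_integrable_def set_lebesgue_integral_def scaleR_sum_right
        by (rule Bochner_Integration.integrable_sum Bochner_Integration.integral_sum,
            rule that[unfolded set_integrable_def])+
      let ?h = "\<lambda>x. - (\<psi> r x * ?u r x) + (\<Sum>i\<in>UNIV. wD UNIV i (\<phi> r) x * A i x)"
      have neg: "set_integrable lebesgue E (\<lambda>x. - (\<psi> r x * ?u r x))"
        using set_integrable_mult_right[OF \<psi>u, of "-1"] by simp
      have h_int: "set_integrable lebesgue E ?h"
        by (intro set_integral_add neg sum_int ibp(1))
      have "Q r = (LINT x:E|lebesgue. ?h x)"
        unfolding Q_def set_lebesgue_integral_def
      proof (rule lebesgue_integral_cong_AE[symmetric])
        show "(\<lambda>x. indicator E x *\<^sub>R ?h x) \<in> borel_measurable lebesgue"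
          using h_int unfolding set_integrable_def by (rule borel_measurable_integrable)
        show "AE x in lebesgue. indicator E x *\<^sub>R ?h x = indicator E x *\<^sub>R
            (- ?u r x * \<psi> r x + (\<Sum>i\<in>UNIV. flux p UNIV i (?u r) x * wD UNIV i (\<phi> r) x))"
          using flux_ae by eventually_elim (auto simp: indicator_def mult.commute)
      qed
      also have "\<dots> = - (LINT x:E|lebesgue. \<psi> r x * ?u r x) + (\<Sum>i\<in>UNIV. LINT x:E|lebesgue. wD UNIV i (\<phi> r) x * A i x)"
        unfolding set_integral_add(2)[OF neg sum_int(1)[OF ibp(1)]] sum_int(2)[OF ibp(1)]
        by (simp add: set_lebesgue_integral_def)
      also have "(\<Sum>i\<in>UNIV. LINT x:E|lebesgue. wD UNIV i (\<phi> r) x * A i x) = - (\<Sum>i\<in>UNIV. LINT x:E|lebesgue. \<phi> r x * A' i x)"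
        unfolding ibp(2) by (simp add: sum_negf)
      also have "(\<Sum>i\<in>UNIV. LINT x:E|lebesgue. \<phi> r x * A' i x) = (LINT x:E|lebesgue. \<phi> r x * ?u' r x)"
        unfolding sum_int(2)[OF \<phi>A', symmetric] sum_distrib_left[symmetric] div ..
      finally show "- R r = Q r"
        unfolding R_def by simp
    qed
  qed
  \<comment> \<open>The product rule makes \<open>R\<close> measurable in time; completeness of the
    measure passes this on to \<open>Q\<close>, which contains the chosen derivatives.\<close>
  have "(LINT r:{t1..t2}|lebesgue. - R r) = (LINT r:{t1..t2}|lebesgue. Q r)"
    unfolding set_lebesgue_integral_def
  proof (rule lebesgue_integral_cong_AE)
    have "set_integrable lebesgue {t1..t2} (\<lambda>r. - R r)"
      using set_integrable_mult_right[OF rule(1), of "-1"] unfolding R_def by simp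
    then show "(\<lambda>r. indicator {t1..t2} r *\<^sub>R - R r) \<in> borel_measurable lebesgue"
      unfolding set_integrable_def by (rule borel_measurable_integrable)
    show "AE r in lebesgue. indicator {t1..t2} r *\<^sub>R - R r = indicator {t1..t2} r *\<^sub>R Q r"
      using Q_eq by eventually_elim (auto simp: indicator_def)
  qed
  then have "(LINT r:{t1..t2}|lebesgue. Q r) = - (LINT r:{t1..t2}|lebesgue. R r)"
    by (simp add: set_lebesgue_integral_def)
  then show ?thesis
    using rule(2) unfolding weak_form_def Q_def R_def by (simp add: mult.commute)
qed

end

section \<open>Specialisation to the stated constants\<close>

theorem mainTheorem4:
  fixes p :: "'n::{finite,linorder} \<Rightarrow> real"
    and pbar D \<alpha> :: real
    and c \<delta> :: "'n \<Rightarrow> real"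
  assumes "\<And>i. 1 < p i"
    and "mono p"
    and "1 / pbar = 1 / real CARD('n) * (\<Sum>i\<in>UNIV. 1 / p i)"
    and "pbar < real CARD('n)"
    and "D > 0"
    and "\<And>i. c i = ((p i - 1) powr (p i - 1) * p i powr (- p i)) powr (1 / (p i - 1))"
    and "\<And>i. \<delta> i = (c i * p i / (p i - 1)) powr (p i - 1)"
    and "\<alpha> = - (\<Sum>i\<in>UNIV. \<delta> i)"
  shows "local_weak_solution p (UNIV :: (real, 'n) vec set) {0<..}
    (\<lambda>t x. D * t powr \<alpha> *
       exp (- (\<Sum>i\<in>UNIV. c i * (\<bar>x $ i\<bar> powr p i / t) powr (1 / (p i - 1)))))"
proof -
  interpret profile p
    by standard (rule assms(1))
  have c: "0 \<le> c i" for i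
    unfolding assms(6) by simp
  \<comment> \<open>The power \<open>p i - 1\<close> undoes the outer root in \<open>c i\<close>,
    the factors \<open>(p i - 1) powr (p i - 1)\<close> cancel, and the exponents
    \<open>- p i\<close> and \<open>p i - 1\<close> of \<open>p i\<close> add up to -1.\<close>
  have \<delta>: "\<delta> i = 1 / p i" for i
  proof -
    have p: "0 < p i - 1" "0 < p i" using assms(1)[of i] by auto
    have "c i powr (p i - 1) = (p i - 1) powr (p i - 1) * p i powr (- p i)"
      unfolding assms(6) using p by (simp add: powr_powr)
    then have "\<delta> i = (p i - 1) powr (p i - 1) * p i powr (- p i) * p i powr (p i - 1) / (p i - 1) powr (p i - 1)"
      unfolding assms(7) using p c[of i] by (simp add: powr_mult powr_divide)
    also have "\<dots> = p i powr (- p i) * p i powr (p i - 1)"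
      using p by simp
    also have "\<dots> = p i powr (- p i + (p i - 1))"
      by (simp only: powr_add)
    also have "\<dots> = 1 / p i"
      using p by (simp add: powr_minus_divide)
    finally show ?thesis .
  qed
  have \<alpha>: "\<alpha> = - (\<Sum>i\<in>UNIV. 1 / p i)"
    unfolding assms(8) \<delta> ..
  have d: "(c i * p i / (p i - 1)) powr (p i - 1) = 1 / p i" for i
    using \<delta>[of i] unfolding assms(7) .
  \<comment> \<open>The weak form vanishes exactly, so the inequalities for sub- and supersolutions
    both follow.\<close>
  have "weak_form p UNIV E t1 t2 (W D \<alpha> c) \<phi> \<psi> = 0"
    if "compact E" "t1 \<le> t2" "{t1..t2} \<subseteq> {0<..}" "test_function p E {0<..} \<phi> \<psi>" for E t1 t2 \<phi> \<psi>
    using weak_form_W[OF \<open>D > 0\<close> c d \<alpha>] that by blast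
  then have "local_weak_solution p UNIV {0<..} (W D \<alpha> c)"
    unfolding local_weak_solution_def weak_subsolution_def weak_supersolution_def
    using solution_class_W[OF \<open>D > 0\<close>] by simp
  then show ?thesis
    unfolding W_def[abs_def] .
qed

end
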